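(* If $A,B,C,D$ are $\mathfrak h$-prealgebras, then the map $$\sigma_{23}(a\otimes b\otimes c\otimes d)=a\otimes c\otimes b\otimes d$$ factors to an $\mathfrak h$-prealgebra homomorphism $$\sigma_{23}:(A\widetilde\otimes B)\widehat\otimes(C\widetilde\otimes D)\to(A\widehat\otimes C)\widetilde\otimes(B\widehat\otimes D).$$
   Context: $\mathfrak h$ is a finite-dimensional complex commutative Lie algebra, $M_{\mathfrak h^*}$ is the field of meromorphic functions on $\mathfrak h^*$, $T_\alpha f(\lambda)=f(\lambda+\alpha)$. An $\mathfrak h$-prealgebra is a complex vector space with a bigrading $A=\bigoplus_{\alpha,\beta\in\mathfrak h^*}A_{\alpha\beta}$ and two left actions $\mu_l,\mu_r:M_{\mathfrak h^*}\to\mathrm{End}_{\mathbb C}(A)$ which preserve the bigrading and whose images commute. Two right actions of $M_{\mathfrak h^*}$ are defined by $\mu_l(f)a=a\,\mu_l(T_\alpha f)$, $\mu_r(f)a=a\,\mu_r(T_\beta f)$ for $a\in A_{\alpha\beta}$. A homomorphism of $\mathfrak h$-prealgebras is a linear map preserving the bigrading and the two left actions (equivalently, all four actions). The tensor product $A\widetilde\otimes B$ is given by $(A\widetilde\otimes B)_{\alpha\beta}=\bigoplus_\gamma A_{\alpha\gamma}\otimes_{M_{\mathfrak h^*}}B_{\gamma\beta}$, where $\otimes_{M_{\mathfrak h^*}}$ is the tensor product over $\mathbb C$ modulo $\mu_r^A(f)a\otimes b=a\otimes\mu_l^B(f)b$, with left actions $\mu_l^A(f)\otimes1$ and $1\otimes\mu_r^B(f)$.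 The tensor product $A\widehat\otimes B$ is the tensor product over $\mathbb C$ modulo $a\mu_l^A(f)\otimes b=a\otimes\mu_l^B(f)b$ and $a\mu_r^A(f)\otimes b=a\otimes\mu_r^B(f)b$, with bigrading $A_{\alpha\beta}\widehat\otimes A'_{\gamma\delta}\subseteq(A\widehat\otimes A')_{\alpha+\gamma,\beta+\delta}$ (here $A'=B$) and left actions $\mu_l(f)(a\otimes b)=\mu_l^A(f)a\otimes b$, $\mu_r(f)(a\otimes b)=\mu_r^A(f)a\otimes b$. *)

theory Defs
  imports
    "HOL-Complex_Analysis.Complex_Analysis"
    "HOL-Library.Poly_Mapping"
    "HOL-Algebra.Algebraic_Closure_Type"
begin

section \<open>Finite-dimensional complex commutative Lie algebras and their duals\<close>

class complex_vector = ab_group_add +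
  fixes cscale :: "complex \<Rightarrow> 'a \<Rightarrow> 'a" (infixr \<open>*\<^sub>c\<close> 75)
  assumes cscale_add_right: "c *\<^sub>c (x + y) = c *\<^sub>c x + c *\<^sub>c y"
    and cscale_add_left: "(c + d) *\<^sub>c x = c *\<^sub>c x + d *\<^sub>c x"
    and cscale_cscale: "c *\<^sub>c d *\<^sub>c x = (c * d) *\<^sub>c x"
    and cscale_one: "1 *\<^sub>c x = x"

class complex_lie_algebra = complex_vector +
  fixes lie_bracket :: "'a \<Rightarrow> 'a \<Rightarrow> 'a"
  assumes lie_add_left: "lie_bracket (x + y) z = lie_bracket x z + lie_bracket y z"
    and lie_add_right: "lie_bracket x (y + z) = lie_bracket x y + lie_bracket x z"
    and lie_cscale_left: "lie_bracket (c *\<^sub>c x) y = c *\<^sub>c lie_bracket x y"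
    and lie_cscale_right: "lie_bracket x (c *\<^sub>c y) = c *\<^sub>c lie_bracket x y"
    and lie_alternating: "lie_bracket x x = 0"
    and lie_jacobi: "lie_bracket x (lie_bracket y z) + lie_bracket y (lie_bracket z x)
      + lie_bracket z (lie_bracket x y) = 0"

class fd_commutative_lie_algebra = complex_lie_algebra +
  assumes lie_commutative: "lie_bracket x y = 0"
    and finite_dimensional: "\<exists>B. finite B \<and> (\<forall>x. \<exists>c. x = (\<Sum>b\<in>B. c b *\<^sub>c b))"

typedef (overloaded) ('h::complex_vector) dual =
  "{\<phi> :: 'h \<Rightarrow> complex. (\<forall>x y. \<phi> (x + y) = \<phi> x + \<phi> y) \<and> (\<forall>c x. \<phi> (c *\<^sub>c x) = c * \<phi> x)}"
  morphisms dual_apply Abs_dual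
  by (rule exI[of _ "\<lambda>_. 0"]) simp

setup_lifting type_definition_dual

lemma dual_apply_add: "dual_apply \<phi> (x + y) = dual_apply \<phi> x + dual_apply \<phi> y"
  and dual_apply_cscale: "dual_apply \<phi> (c *\<^sub>c x) = c * dual_apply \<phi> x"
  using dual_apply[of \<phi>] by auto

instantiation dual :: (complex_vector) complex_vector
begin

lift_definition zero_dual :: "'a dual" is "\<lambda>_. 0" by simp
lift_definition plus_dual :: "'a dual \<Rightarrow> 'a dual \<Rightarrow> 'a dual" is "\<lambda>\<phi> \<psi> x. \<phi> x + \<psi> x"
  by (simp add: algebra_simps)
lift_definition uminus_dual :: "'a dual \<Rightarrow> 'a dual" is "\<lambda>\<phi> x. - \<phi> x" by simp
lift_definition minus_dual :: "'a dual \<Rightarrow> 'a dual \<Rightarrow> 'a dual" is "\<lambda>\<phi> \<psi> x. \<phi> x - \<psi> x"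
  by (simp add: algebra_simps)
lift_definition cscale_dual :: "complex \<Rightarrow> 'a dual \<Rightarrow> 'a dual" is "\<lambda>c \<phi> x. c * \<phi> x"
  by (simp add: algebra_simps)

instance by standard (transfer; auto simp: algebra_simps)+

end

definition spanning_set :: "'h::fd_commutative_lie_algebra set" where
  "spanning_set = (SOME B. finite B \<and> (\<forall>x. \<exists>c. x = (\<Sum>b\<in>B. c b *\<^sub>c b)))"

lemma finite_spanning_set: "finite (spanning_set :: 'h::fd_commutative_lie_algebra set)"
  and spanning_set_spans: "\<exists>c. (x :: 'h) = (\<Sum>b\<in>spanning_set. c b *\<^sub>c b)"
  using someI_ex[OF finite_dimensional] unfolding spanning_set_def by blast+

lemma dual_apply_zero: "dual_apply \<phi> 0 = 0"
  using dual_apply_add[of \<phi> 0 0] by simp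

lemma dual_apply_sum: "dual_apply \<phi> (sum f A) = (\<Sum>i\<in>A. dual_apply \<phi> (f i))"
  by (induction A rule: infinite_finite_induct) (simp_all add: dual_apply_add dual_apply_zero)

text \<open>The norm depends on an arbitrary choice of a finite spanning set, but all norms on a
  finite-dimensional space are equivalent, so topology and differentiability do not.\<close>

instantiation dual :: (fd_commutative_lie_algebra) real_normed_vector
begin

definition scaleR_dual :: "real \<Rightarrow> 'a dual \<Rightarrow> 'a dual" where
  "scaleR_dual r \<phi> = complex_of_real r *\<^sub>c \<phi>"
definition norm_dual :: "'a dual \<Rightarrow> real" where
  "norm_dual \<phi> = (\<Sum>b\<in>spanning_set. cmod (dual_apply \<phi> b))"
definition dist_dual :: "'a dual \<Rightarrow> 'a dual \<Rightarrow> real" where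
  "dist_dual \<phi> \<psi> = norm (\<phi> - \<psi>)"
definition sgn_dual :: "'a dual \<Rightarrow> 'a dual" where
  "sgn_dual \<phi> = inverse (norm \<phi>) *\<^sub>R \<phi>"
definition uniformity_dual :: "('a dual \<times> 'a dual) filter" where
  "uniformity_dual = (INF e\<in>{0<..}. principal {(x, y). dist x y < e})"
definition open_dual :: "'a dual set \<Rightarrow> bool" where
  "open_dual U \<longleftrightarrow> (\<forall>x\<in>U. \<forall>\<^sub>F (x', y) in uniformity. x' = x \<longrightarrow> y \<in> U)"

instance
proof
  fix x y :: "'a dual" and r s :: real
  show "norm x = 0 \<longleftrightarrow> x = 0"
  proof
    assume "norm x = 0"
    then have *: "\<forall>b\<in>spanning_set. dual_apply x b = 0"
      by (simp add: norm_dual_def sum_nonneg_eq_0_iff finite_spanning_set)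
    have "dual_apply x v = 0" for v
    proof -
      obtain c where "v = (\<Sum>b\<in>spanning_set. c b *\<^sub>c b)" using spanning_set_spans by blast
      then show ?thesis using * by (simp add: dual_apply_sum dual_apply_cscale)
    qed
    then show "x = 0" by transfer auto
  qed (simp add: norm_dual_def zero_dual.rep_eq)
  show "norm (x + y) \<le> norm x + norm y"
    by (simp add: norm_dual_def plus_dual.rep_eq flip: sum.distrib)
       (intro sum_mono norm_triangle_ineq)
  show "norm (r *\<^sub>R x) = \<bar>r\<bar> * norm x"
    by (simp add: norm_dual_def scaleR_dual_def cscale_dual.rep_eq norm_mult sum_distrib_left)
  show "r *\<^sub>R (x + y) = r *\<^sub>R x + r *\<^sub>R y" "(r + s) *\<^sub>R x = r *\<^sub>R x + s *\<^sub>R x"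
    "r *\<^sub>R s *\<^sub>R x = (r * s) *\<^sub>R x" "1 *\<^sub>R x = x"
    by (simp_all add: scaleR_dual_def cscale_add_left cscale_add_right cscale_cscale cscale_one)
qed (simp_all add: dist_dual_def sgn_dual_def uniformity_dual_def open_dual_def)

end

section \<open>Meromorphic functions on the dual\<close>

definition holomorphic_dual ::
  "('h::fd_commutative_lie_algebra dual \<Rightarrow> complex) \<Rightarrow> 'h dual set \<Rightarrow> bool" where
  "holomorphic_dual f U \<longleftrightarrow>
    (\<forall>x\<in>U. \<exists>D. (f has_derivative D) (at x) \<and> (\<forall>c v. D (c *\<^sub>c v) = c * D v))"

definition nonvanishing :: "('h::fd_commutative_lie_algebra dual \<Rightarrow> complex) \<Rightarrow> 'h dual set \<Rightarrow> bool" where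
  "nonvanishing h U \<longleftrightarrow> (\<forall>V. open V \<and> V \<noteq> {} \<and> V \<subseteq> U \<longrightarrow> (\<exists>x\<in>V. h x \<noteq> 0))"

text \<open>A meromorphic function is locally a quotient of holomorphic functions, the denominator not
  vanishing identically on any nonempty open set.  Its representatives below are total functions
  whose values at the zeros of the local denominators are irrelevant; they are identified when they
  agree on a dense open set.\<close>

definition meromorphic_rep :: "('h::fd_commutative_lie_algebra dual \<Rightarrow> complex) \<Rightarrow> bool" where
  "meromorphic_rep f \<longleftrightarrow> (\<forall>p. \<exists>U g h. open U \<and> p \<in> U \<and> holomorphic_dual g U \<and>
    holomorphic_dual h U \<and> nonvanishing h U \<and> (\<forall>x\<in>U. h x \<noteq> 0 \<longrightarrow> f x = g x / h x))"

definition generically_equal ::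
  "('h::fd_commutative_lie_algebra dual \<Rightarrow> complex) \<Rightarrow> ('h dual \<Rightarrow> complex) \<Rightarrow> bool" where
  "generically_equal f g \<longleftrightarrow> (\<exists>W. open W \<and> closure W = UNIV \<and> (\<forall>x\<in>W. f x = g x))"

lemma holomorphic_dual_subset: "holomorphic_dual f U \<Longrightarrow> V \<subseteq> U \<Longrightarrow> holomorphic_dual f V"
  unfolding holomorphic_dual_def by blast

lemma holomorphic_dual_const: "holomorphic_dual (\<lambda>_. c) U"
  unfolding holomorphic_dual_def by (auto intro!: exI[of _ "\<lambda>_. 0"])

lemma holomorphic_dual_add:
  assumes "holomorphic_dual f U" "holomorphic_dual g U"
  shows "holomorphic_dual (\<lambda>x. f x + g x) U"
  unfolding holomorphic_dual_def
proof
  fix x assume "x \<in> U"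
  then obtain D E where "(f has_derivative D) (at x)" "\<forall>c v. D (c *\<^sub>c v) = c * D v"
    "(g has_derivative E) (at x)" "\<forall>c v. E (c *\<^sub>c v) = c * E v"
    using assms unfolding holomorphic_dual_def by blast
  then show "\<exists>D. ((\<lambda>x. f x + g x) has_derivative D) (at x) \<and> (\<forall>c v. D (c *\<^sub>c v) = c * D v)"
    by (intro exI[of _ "\<lambda>v. D v + E v"]) (auto intro: has_derivative_add simp: algebra_simps)
qed

lemma holomorphic_dual_mult:
  assumes "holomorphic_dual f U" "holomorphic_dual g U"
  shows "holomorphic_dual (\<lambda>x. f x * g x) U"
  unfolding holomorphic_dual_def
proof
  fix x assume "x \<in> U"
  then obtain D E where "(f has_derivative D) (at x)" "\<forall>c v. D (c *\<^sub>c v) = c * D v"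
    "(g has_derivative E) (at x)" "\<forall>c v. E (c *\<^sub>c v) = c * E v"
    using assms unfolding holomorphic_dual_def by blast
  note * = this
  have "((\<lambda>x. f x * g x) has_derivative (\<lambda>v. f x * E v + D v * g x)) (at x)"
    by (rule has_derivative_mult) (fact *)+
  moreover have "\<forall>c v. f x * E (c *\<^sub>c v) + D (c *\<^sub>c v) * g x = c * (f x * E v + D v * g x)"
    using * by (simp add: algebra_simps)
  ultimately show "\<exists>D. ((\<lambda>x. f x * g x) has_derivative D) (at x) \<and> (\<forall>c v. D (c *\<^sub>c v) = c * D v)"
    by blast
qed

lemma holomorphic_dual_shift:
  assumes "holomorphic_dual f U"
  shows "holomorphic_dual (\<lambda>x. f (x + \<alpha>)) ((\<lambda>x. x + \<alpha>) -` U)"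
  unfolding holomorphic_dual_def
proof
  fix x assume "x \<in> (\<lambda>x. x + \<alpha>) -` U"
  then obtain D where D: "(f has_derivative D) (at (x + \<alpha>))" "\<forall>c v. D (c *\<^sub>c v) = c * D v"
    using assms unfolding holomorphic_dual_def by auto
  have "((\<lambda>x. x + \<alpha>) has_derivative (\<lambda>v. v)) (at x)"
    by (auto intro!: derivative_eq_intros)
  from has_derivative_compose[OF this D(1)]
  show "\<exists>D. ((\<lambda>x. f (x + \<alpha>)) has_derivative D) (at x) \<and> (\<forall>c v. D (c *\<^sub>c v) = c * D v)"
    using D(2) by blast
qed

lemma holomorphic_dual_continuous: "holomorphic_dual f U \<Longrightarrow> continuous_on U f"
  unfolding holomorphic_dual_def
  by (meson continuous_at_imp_continuous_on has_derivative_continuous)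

lemma nonvanishing_subset: "nonvanishing h U \<Longrightarrow> V \<subseteq> U \<Longrightarrow> nonvanishing h V"
  unfolding nonvanishing_def by (meson subset_trans)

lemma nonvanishing_mult:
  assumes "open U" "continuous_on U h" "nonvanishing h U" "nonvanishing k U"
  shows "nonvanishing (\<lambda>x. h x * k x) U"
  unfolding nonvanishing_def
proof (intro allI impI)
  fix V assume V: "open V \<and> V \<noteq> {} \<and> V \<subseteq> U"
  then obtain x where x: "x \<in> V" "h x \<noteq> 0" using assms unfolding nonvanishing_def by blast
  have "open (V \<inter> h -` (- {0}))"
    using V assms by (intro continuous_open_preimage) (auto intro: continuous_on_subset)
  then show "\<exists>x\<in>V. h x * k x \<noteq> 0"
    using assms(4) x V unfolding nonvanishing_def
    by (elim allE[of _ "V \<inter> h -` (- {0})"]) auto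
qed

lemma dense_open_Int:
  fixes S T :: "'a::topological_space set"
  assumes "open S" "closure S = UNIV" "open T" "closure T = UNIV"
  shows "closure (S \<inter> T) = UNIV"
  using open_Int_closure_subset[OF assms(1), of T] assms
  by (metis Int_UNIV_right closure_closure closure_mono top.extremum_uniqueI)

lemma generically_equal_refl: "generically_equal f f"
  unfolding generically_equal_def by (rule exI[of _ UNIV]) simp

lemma generically_equal_sym: "generically_equal f g \<Longrightarrow> generically_equal g f"
  unfolding generically_equal_def by metis

lemma generically_equal2:
  assumes "generically_equal f f'" "generically_equal g g'"
    and "\<And>x. f x = f' x \<Longrightarrow> g x = g' x \<Longrightarrow> k x = k' x"
  shows "generically_equal k k'"
proof -
  obtain S where S: "open S" "closure S = UNIV" "\<forall>x\<in>S. f x = f' x"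
    using assms(1) unfolding generically_equal_def by blast
  obtain T where T: "open T" "closure T = UNIV" "\<forall>x\<in>T. g x = g' x"
    using assms(2) unfolding generically_equal_def by blast
  show ?thesis unfolding generically_equal_def
    using S T dense_open_Int[OF S(1,2) T(1,2)] assms(3) by (intro exI[of _ "S \<inter> T"]) auto
qed

lemma generically_equal_trans:
  "generically_equal f g \<Longrightarrow> generically_equal g h \<Longrightarrow> generically_equal f h"
  by (rule generically_equal2[of f g g h]) auto

lemma generically_equal_map:
  assumes "generically_equal f f'"
  shows "generically_equal (\<lambda>x. F (f x)) (\<lambda>x. F (f' x))"
  by (rule generically_equal2[OF assms assms]) simp

lemma generically_equal_map2:
  assumes "generically_equal f f'" "generically_equal g g'"
  shows "generically_equal (\<lambda>x. F (f x) (g x)) (\<lambda>x. F (f' x) (g' x))"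
  by (rule generically_equal2[OF assms]) simp

lemma meromorphic_rep_const: "meromorphic_rep (\<lambda>_. c)"
  unfolding meromorphic_rep_def
  by (intro allI exI[of _ UNIV] exI[of _ "\<lambda>_. c"] exI[of _ "\<lambda>_. 1"])
     (auto simp: holomorphic_dual_const nonvanishing_def)

lemma meromorphic_rep_common:
  assumes "meromorphic_rep f" "meromorphic_rep f'"
  obtains U g h g' h' where "open U" "p \<in> U" "holomorphic_dual g U" "holomorphic_dual h U"
    "holomorphic_dual g' U" "holomorphic_dual h' U" "nonvanishing (\<lambda>x. h x * h' x) U"
    "\<forall>x\<in>U. h x \<noteq> 0 \<longrightarrow> f x = g x / h x"
    "\<forall>x\<in>U. h' x \<noteq> 0 \<longrightarrow> f' x = g' x / h' x"
proof -
  obtain U g h where 1: "open U" "p \<in> U" "holomorphic_dual g U" "holomorphic_dual h U"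
    "nonvanishing h U" "\<forall>x\<in>U. h x \<noteq> 0 \<longrightarrow> f x = g x / h x"
    using assms(1) unfolding meromorphic_rep_def by meson
  obtain U' g' h' where 2: "open U'" "p \<in> U'" "holomorphic_dual g' U'" "holomorphic_dual h' U'"
    "nonvanishing h' U'" "\<forall>x\<in>U'. h' x \<noteq> 0 \<longrightarrow> f' x = g' x / h' x"
    using assms(2) unfolding meromorphic_rep_def by meson
  have "nonvanishing (\<lambda>x. h x * h' x) (U \<inter> U')"
    using 1 2 by (intro nonvanishing_mult)
      (auto intro: nonvanishing_subset holomorphic_dual_continuous holomorphic_dual_subset)
  then show ?thesis
    using 1 2 by (intro that[of "U \<inter> U'" g h g' h']) (auto intro: holomorphic_dual_subset)
qed

lemma meromorphic_rep_add:
  assumes "meromorphic_rep f" "meromorphic_rep f'"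
  shows "meromorphic_rep (\<lambda>x. f x + f' x)"
  unfolding meromorphic_rep_def
proof
  fix p
  obtain U g h g' h' where *: "open U" "p \<in> U" "holomorphic_dual g U" "holomorphic_dual h U"
    "holomorphic_dual g' U" "holomorphic_dual h' U" "nonvanishing (\<lambda>x. h x * h' x) U"
    "\<forall>x\<in>U. h x \<noteq> 0 \<longrightarrow> f x = g x / h x"
    "\<forall>x\<in>U. h' x \<noteq> 0 \<longrightarrow> f' x = g' x / h' x"
    by (rule meromorphic_rep_common[where p = p, OF assms])
  show "\<exists>U g h. open U \<and> p \<in> U \<and> holomorphic_dual g U \<and> holomorphic_dual h U \<and>
    nonvanishing h U \<and> (\<forall>x\<in>U. h x \<noteq> 0 \<longrightarrow> f x + f' x = g x / h x)"
    by (rule exI[of _ U], rule exI[of _ "\<lambda>x. g x * h' x + g' x * h x"],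
        rule exI[of _ "\<lambda>x. h x * h' x"])
      (use * in \<open>auto intro!: holomorphic_dual_add holomorphic_dual_mult simp: field_simps\<close>)
qed

lemma meromorphic_rep_mult:
  assumes "meromorphic_rep f" "meromorphic_rep f'"
  shows "meromorphic_rep (\<lambda>x. f x * f' x)"
  unfolding meromorphic_rep_def
proof
  fix p
  obtain U g h g' h' where *: "open U" "p \<in> U" "holomorphic_dual g U" "holomorphic_dual h U"
    "holomorphic_dual g' U" "holomorphic_dual h' U" "nonvanishing (\<lambda>x. h x * h' x) U"
    "\<forall>x\<in>U. h x \<noteq> 0 \<longrightarrow> f x = g x / h x"
    "\<forall>x\<in>U. h' x \<noteq> 0 \<longrightarrow> f' x = g' x / h' x"
    by (rule meromorphic_rep_common[where p = p, OF assms])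
  show "\<exists>U g h. open U \<and> p \<in> U \<and> holomorphic_dual g U \<and> holomorphic_dual h U \<and>
    nonvanishing h U \<and> (\<forall>x\<in>U. h x \<noteq> 0 \<longrightarrow> f x * f' x = g x / h x)"
    by (rule exI[of _ U], rule exI[of _ "\<lambda>x. g x * g' x"], rule exI[of _ "\<lambda>x. h x * h' x"])
      (use * in \<open>auto intro!: holomorphic_dual_mult\<close>)
qed

lemma meromorphic_rep_uminus: "meromorphic_rep f \<Longrightarrow> meromorphic_rep (\<lambda>x. - f x)"
  using meromorphic_rep_mult[OF meromorphic_rep_const[of "-1"], of f] by simp

lemma open_shift_vimage: "open U \<Longrightarrow> open ((\<lambda>x. x + \<alpha>) -` U)"
  for U :: "'a::real_normed_vector set"
  by (intro open_vimage continuous_intros)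

lemma closure_shift_vimage:
  fixes W :: "'a::real_normed_vector set"
  assumes "closure W = UNIV"
  shows "closure ((\<lambda>x. x + \<alpha>) -` W) = UNIV"
proof -
  have "(\<lambda>x. x + \<alpha>) -` W = (\<lambda>x. - \<alpha> + x) ` W"
    by (force simp: image_iff algebra_simps)
  then have "closure ((\<lambda>x. x + \<alpha>) -` W) = range ((+) (- \<alpha>))"
    using assms by (simp only: closure_translation)
  also have "\<dots> = UNIV" by (rule surj_plus)
  finally show ?thesis .
qed

lemma meromorphic_rep_shift:
  assumes "meromorphic_rep f"
  shows "meromorphic_rep (\<lambda>x. f (x + \<alpha>))"
  unfolding meromorphic_rep_def
proof
  fix p
  obtain U g h where *: "open U" "p + \<alpha> \<in> U" "holomorphic_dual g U" "holomorphic_dual h U"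
    "nonvanishing h U" "\<forall>x\<in>U. h x \<noteq> 0 \<longrightarrow> f x = g x / h x"
    using assms unfolding meromorphic_rep_def by meson
  have "nonvanishing (\<lambda>x. h (x + \<alpha>)) ((\<lambda>x. x + \<alpha>) -` U)"
    unfolding nonvanishing_def
  proof (intro allI impI)
    fix V assume V: "open V \<and> V \<noteq> {} \<and> V \<subseteq> (\<lambda>x. x + \<alpha>) -` U"
    have "open ((\<lambda>x. x + - \<alpha>) -` V)" using V by (intro open_shift_vimage) auto
    moreover have "(\<lambda>x. x + - \<alpha>) -` V \<subseteq> U" "(\<lambda>x. x + - \<alpha>) -` V \<noteq> {}"
    proof -
      show "(\<lambda>x. x + - \<alpha>) -` V \<subseteq> U"
      proof
        fix x assume "x \<in> (\<lambda>x. x + - \<alpha>) -` V"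
        then have "x + - \<alpha> \<in> (\<lambda>x. x + \<alpha>) -` U" using V by blast
        then show "x \<in> U" by simp
      qed
      obtain v where "v \<in> V" using V by blast
      then have "v + \<alpha> \<in> (\<lambda>x. x + - \<alpha>) -` V" by simp
      then show "(\<lambda>x. x + - \<alpha>) -` V \<noteq> {}" by blast
    qed
    ultimately have "\<exists>x\<in>(\<lambda>x. x + - \<alpha>) -` V. h x \<noteq> 0"
      using *(5) unfolding nonvanishing_def by blast
    then obtain x where "x - \<alpha> \<in> V" "h x \<noteq> 0" by auto
    then show "\<exists>x\<in>V. h (x + \<alpha>) \<noteq> 0" by (intro bexI[of _ "x - \<alpha>"]) auto
  qed
  then show "\<exists>U g h. open U \<and> p \<in> U \<and> holomorphic_dual g U \<and> holomorphic_dual h U \<and>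
    nonvanishing h U \<and> (\<forall>x\<in>U. h x \<noteq> 0 \<longrightarrow> f (x + \<alpha>) = g x / h x)"
    by - (rule exI[of _ "(\<lambda>x. x + \<alpha>) -` U"], rule exI[of _ "\<lambda>x. g (x + \<alpha>)"],
        rule exI[of _ "\<lambda>x. h (x + \<alpha>)"],
        use * in \<open>auto intro: open_shift_vimage holomorphic_dual_shift\<close>)
qed

quotient_type (overloaded) 'h mero = "'h::fd_commutative_lie_algebra dual \<Rightarrow> complex" / partial:
  "\<lambda>f g. meromorphic_rep f \<and> meromorphic_rep g \<and> generically_equal f g"
  by (rule part_equivpI)
     (auto intro!: sympI transpI exI[of _ "\<lambda>_. 0"] meromorphic_rep_const generically_equal_refl
       intro: generically_equal_sym generically_equal_trans)

definition shift_mero :: "'h::fd_commutative_lie_algebra dual \<Rightarrow> 'h mero \<Rightarrow> 'h mero" where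
  "shift_mero \<alpha> f = abs_mero (\<lambda>x. rep_mero f (x + \<alpha>))"

lemma generically_equal_shift:
  assumes "generically_equal f g"
  shows "generically_equal (\<lambda>x. f (x + \<alpha>)) (\<lambda>x. g (x + \<alpha>))"
proof -
  obtain W where "open W" "closure W = UNIV" "\<forall>x\<in>W. f x = g x"
    using assms unfolding generically_equal_def by blast
  then show ?thesis
    unfolding generically_equal_def
    by (intro exI[of _ "(\<lambda>x. x + \<alpha>) -` W"])
       (auto intro: open_shift_vimage simp: closure_shift_vimage)
qed

lemma shift_mero_abs_mero:
  assumes "meromorphic_rep f"
  shows "shift_mero \<alpha> (abs_mero f) = abs_mero (\<lambda>x. f (x + \<alpha>))"
proof -
  have "meromorphic_rep (rep_mero (abs_mero f)) \<and> generically_equal (rep_mero (abs_mero f)) f"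
    using Quotient3_rep_abs[OF Quotient3_mero, of f] assms generically_equal_refl by blast
  then show ?thesis
    unfolding shift_mero_def using assms
    by (intro Quotient3_rel_abs[OF Quotient3_mero])
       (simp add: meromorphic_rep_shift generically_equal_shift)
qed

lift_definition const_mero :: "complex \<Rightarrow> 'h::fd_commutative_lie_algebra mero" is "\<lambda>c _. c"
  by (simp add: meromorphic_rep_const generically_equal_refl)

lemma has_derivative_cscale_left:
  fixes v :: "'h::fd_commutative_lie_algebra dual"
  shows "((\<lambda>z. z *\<^sub>c v) has_derivative (\<lambda>z. z *\<^sub>c v)) F"
proof (rule bounded_linear_imp_has_derivative, rule bounded_linear_intro[where K = "norm v"])
  fix y z :: complex and r :: real
  show "(y + z) *\<^sub>c v = y *\<^sub>c v + z *\<^sub>c v" by (rule cscale_add_left)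
  show "(r *\<^sub>R y) *\<^sub>c v = r *\<^sub>R (y *\<^sub>c v)"
    by (simp add: scaleR_dual_def cscale_cscale scaleR_conv_of_real)
  show "norm (y *\<^sub>c v) \<le> norm y * norm v"
    by (simp add: norm_dual_def cscale_dual.rep_eq norm_mult sum_distrib_left)
qed

lemma holomorphic_dual_identity_ball:
  fixes g :: "'h::fd_commutative_lie_algebra dual \<Rightarrow> complex"
  assumes g: "holomorphic_dual g (ball p r)"
    and V: "open V" "V \<noteq> {}" "V \<subseteq> ball p r" "\<And>x. x \<in> V \<Longrightarrow> g x = 0"
    and x: "x \<in> ball p r"
  shows "g x = 0"
proof -
  obtain q where q: "q \<in> V" using V by blast
  define l where "l z = q + z *\<^sub>c (x - q)" for z
  have l_der: "(l has_derivative (\<lambda>w. w *\<^sub>c (x - q))) (at z)" for z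
    using has_derivative_add[OF has_derivative_const has_derivative_cscale_left]
    unfolding l_def by force
  have l_cont: "continuous_on UNIV l"
    using l_der by (meson continuous_at_imp_continuous_on has_derivative_continuous)
  define S where "S = l -` ball p r"
  have S: "open S" unfolding S_def using l_cont by (simp add: open_vimage)
  have "convex S"
  proof (rule convexI)
    fix y z and u v :: real assume *: "y \<in> S" "z \<in> S" "0 \<le> u" "0 \<le> v" "u + v = 1"
    have "u *\<^sub>R l y + v *\<^sub>R l z = (u *\<^sub>R q + v *\<^sub>R q) + (u *\<^sub>R y + v *\<^sub>R z) *\<^sub>c (x - q)"
      by (simp add: l_def cscale_add_right cscale_add_left scaleR_dual_def cscale_cscale
          scaleR_conv_of_real algebra_simps)
    also have "\<dots> = l (u *\<^sub>R y + v *\<^sub>R z)"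
      using *(5) by (simp add: l_def flip: scaleR_add_left)
    finally have "l (u *\<^sub>R y + v *\<^sub>R z) = u *\<^sub>R l y + v *\<^sub>R l z" ..
    moreover have "u *\<^sub>R l y + v *\<^sub>R l z \<in> ball p r"
      by (rule convexD[OF convex_ball]) (use * in \<open>auto simp: S_def\<close>)
    ultimately show "u *\<^sub>R y + v *\<^sub>R z \<in> S" by (simp add: S_def)
  qed
  then have "connected S" by (rule convex_connected)
  have "(\<lambda>z. g (l z)) holomorphic_on S"
    unfolding holomorphic_on_def field_differentiable_def
  proof
    fix z assume "z \<in> S"
    then have "l z \<in> ball p r" unfolding S_def by simp
    then obtain D where D: "(g has_derivative D) (at (l z))" "\<forall>c v. D (c *\<^sub>c v) = c * D v"
      using g unfolding holomorphic_dual_def by blast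
    have "((\<lambda>z. g (l z)) has_derivative (\<lambda>w. D (w *\<^sub>c (x - q)))) (at z)"
      by (rule has_derivative_compose[OF l_der D(1)])
    moreover have "(\<lambda>w. D (w *\<^sub>c (x - q))) = (*) (D (x - q))"
      using D(2) by (auto simp: mult.commute)
    ultimately have "((\<lambda>z. g (l z)) has_field_derivative D (x - q)) (at z)"
      by (simp add: has_field_derivative_def)
    then show "\<exists>d. ((\<lambda>z. g (l z)) has_field_derivative d) (at z within S)"
      using has_field_derivative_at_within by blast
  qed
  moreover have "open (l -` V)" using l_cont V by (simp add: open_vimage)
  moreover have "0 \<in> l -` V"
    using q cscale_add_left[of 0 0 "x - q"] by (simp add: l_def)
  moreover have "l 1 = x" by (simp add: l_def cscale_one)
  moreover have "l -` V \<subseteq> S" using V unfolding S_def by blast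
  ultimately have "g (l 1) = 0"
    using analytic_continuation_open[of "l -` V" S "\<lambda>z. g (l z)" "\<lambda>_. 0" 1] S \<open>connected S\<close> V x
    by (auto simp: S_def)
  then show ?thesis using \<open>l 1 = x\<close> by simp
qed

lemma nonvanishing_or_zero_ball:
  assumes "holomorphic_dual g (ball p r)"
  shows "nonvanishing g (ball p r) \<or> (\<forall>x\<in>ball p r. g x = 0)"
  using holomorphic_dual_identity_ball[OF assms] unfolding nonvanishing_def by blast

lemma meromorphic_rep_inverse_or_zero:
  fixes f :: "'h::fd_commutative_lie_algebra dual \<Rightarrow> complex"
  assumes f: "meromorphic_rep f"
  shows "meromorphic_rep (\<lambda>x. inverse (f x))"
    and "generically_equal f (\<lambda>_. 0) \<or> generically_equal (\<lambda>x. inverse (f x) * f x) (\<lambda>_. 1)"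
proof -
  have "\<exists>r g h. r > 0 \<and> holomorphic_dual g (ball p r) \<and> holomorphic_dual h (ball p r) \<and>
    nonvanishing h (ball p r) \<and> (\<forall>x\<in>ball p r. h x \<noteq> 0 \<longrightarrow> f x = g x / h x)" for p
  proof -
    obtain U g h where *: "open U" "p \<in> U" "holomorphic_dual g U" "holomorphic_dual h U"
      "nonvanishing h U" "\<forall>x\<in>U. h x \<noteq> 0 \<longrightarrow> f x = g x / h x"
      using f unfolding meromorphic_rep_def by meson
    then obtain r where r: "r > 0" "ball p r \<subseteq> U" by (meson openE)
    show ?thesis
      by (rule exI[of _ r], rule exI[of _ g], rule exI[of _ h])
         (use * r in \<open>auto intro: holomorphic_dual_subset nonvanishing_subset\<close>)
  qed
  then obtain r g h where *: "\<And>p. r p > 0" "\<And>p. holomorphic_dual (g p) (ball p (r p))"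
    "\<And>p. holomorphic_dual (h p) (ball p (r p))" "\<And>p. nonvanishing (h p) (ball p (r p))"
    "\<And>p x. x \<in> ball p (r p) \<Longrightarrow> h p x \<noteq> 0 \<Longrightarrow> f x = g p x / h p x"
    by metis
  define B where "B p = ball p (r p)" for p
  define N where "N p \<longleftrightarrow> nonvanishing (g p) (B p)" for p
  have notN: "g p x = 0" if "\<not> N p" "x \<in> B p" for p x
    using nonvanishing_or_zero_ball[OF *(2)] that unfolding N_def B_def by blast
  have gh: "nonvanishing (\<lambda>x. g p x * h p x) (B p)" if "N p" for p
    using that *(2-4) unfolding N_def B_def
    by (intro nonvanishing_mult holomorphic_dual_continuous) auto
  show "meromorphic_rep (\<lambda>x. inverse (f x))"
    unfolding meromorphic_rep_def
  proof
    fix p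
    show "\<exists>U k l. open U \<and> p \<in> U \<and> holomorphic_dual k U \<and> holomorphic_dual l U \<and>
      nonvanishing l U \<and> (\<forall>x\<in>U. l x \<noteq> 0 \<longrightarrow> inverse (f x) = k x / l x)"
    proof (cases "N p")
      case True
      then show ?thesis
        using *(1)[of p] *(2)[of p] *(3)[of p] *(5)[of _ p] gh[OF True] unfolding B_def
        by - (rule exI[of _ "ball p (r p)"], rule exI[of _ "\<lambda>x. h p x * h p x"],
            rule exI[of _ "\<lambda>x. g p x * h p x"], auto intro!: holomorphic_dual_mult)
    next
      case False
      then show ?thesis
        using *(1)[of p] *(3)[of p] *(4)[of p] *(5)[of _ p] notN[OF False] unfolding B_def
        by - (rule exI[of _ "ball p (r p)"], rule exI[of _ "\<lambda>x. 0"], rule exI[of _ "h p"],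
           auto intro!: holomorphic_dual_const)
    qed
  qed
  have NN: "N p \<longleftrightarrow> N q" if "B p \<inter> B q \<noteq> {}" for p q
  proof -
    have **: "N q" if pq: "B p \<inter> B q \<noteq> {}" and "N p" for p q
    proof -
      have o: "open (B p \<inter> B q)" unfolding B_def by auto
      have "nonvanishing (\<lambda>x. (g p x * h p x) * h q x) (B p \<inter> B q)"
      proof (rule nonvanishing_mult[OF o])
        show "continuous_on (B p \<inter> B q) (\<lambda>x. g p x * h p x)"
          using *(2)[of p] *(3)[of p] unfolding B_def
          by (intro holomorphic_dual_continuous holomorphic_dual_mult)
             (auto intro: holomorphic_dual_subset)
        show "nonvanishing (\<lambda>x. g p x * h p x) (B p \<inter> B q)"
          using gh[OF \<open>N p\<close>] by (rule nonvanishing_subset) auto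
        show "nonvanishing (h q) (B p \<inter> B q)"
          using *(4)[of q] unfolding B_def by (rule nonvanishing_subset) auto
      qed
      then obtain x where "x \<in> B p \<inter> B q" "(g p x * h p x) * h q x \<noteq> 0"
        using o pq unfolding nonvanishing_def by blast
      then have "g q x \<noteq> 0"
        using *(5)[of x p] *(5)[of x q] unfolding B_def by auto
      then show "N q" using notN[of q x] \<open>x \<in> B p \<inter> B q\<close> by blast
    qed
    show ?thesis using **[of p q] **[of q p] that by (auto simp: Int_commute)
  qed
  have pB: "p \<in> B p" and oB: "open (B p)" for p using *(1)[of p] unfolding B_def by auto
  have N_const: "N p \<longleftrightarrow> N q" for p q
  proof -
    have "open (\<Union>p\<in>{p. N p}. B p)" "open (\<Union>p\<in>{p. \<not> N p}. B p)" using oB by auto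
    moreover have "(\<Union>p\<in>{p. N p}. B p) \<inter> (\<Union>p\<in>{p. \<not> N p}. B p) = {}" using NN by blast
    moreover have "(\<Union>p\<in>{p. N p}. B p) \<union> (\<Union>p\<in>{p. \<not> N p}. B p) = UNIV" using pB by blast
    ultimately have "(\<Union>p\<in>{p. N p}. B p) = {} \<or> (\<Union>p\<in>{p. \<not> N p}. B p) = {}"
      using connectedD[OF connected_UNIV] by (metis Int_UNIV_right subset_UNIV order_refl)
    then show ?thesis using pB by blast
  qed
  have dense: "closure (\<Union>p. {x \<in> B p. k p x \<noteq> 0}) = UNIV"
    if "\<And>p. nonvanishing (k p) (B p)" for k :: "'h dual \<Rightarrow> 'h dual \<Rightarrow> complex"
  proof (rule ccontr)
    assume "closure (\<Union>p. {x \<in> B p. k p x \<noteq> 0}) \<noteq> UNIV"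
    then obtain q where q: "q \<notin> closure (\<Union>p. {x \<in> B p. k p x \<noteq> 0})" by blast
    let ?V = "B q \<inter> - closure (\<Union>p. {x \<in> B p. k p x \<noteq> 0})"
    have "open ?V" "?V \<noteq> {}" "?V \<subseteq> B q" using oB q pB by auto
    with that[of q] have "\<exists>x\<in>?V. k q x \<noteq> 0" unfolding nonvanishing_def by blast
    then obtain x where "x \<in> ?V" "k q x \<noteq> 0" by blast
    then have "x \<in> (\<Union>p. {x \<in> B p. k p x \<noteq> 0})" by blast
    then have "x \<in> closure (\<Union>p. {x \<in> B p. k p x \<noteq> 0})" by (rule subsetD[OF closure_subset])
    then show False using \<open>x \<in> ?V\<close> by blast
  qed
  have opn: "open (\<Union>p. {x \<in> B p. k p x \<noteq> 0})"
    if "\<And>p. continuous_on (B p) (k p)" for k :: "'h dual \<Rightarrow> 'h dual \<Rightarrow> complex"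
  proof (rule open_UN, rule ballI)
    fix p
    have "open (B p \<inter> k p -` (- {0}))"
      using that oB by (intro continuous_open_preimage) auto
    moreover have "B p \<inter> k p -` (- {0}) = {x \<in> B p. k p x \<noteq> 0}" by auto
    ultimately show "open {x \<in> B p. k p x \<noteq> 0}" by simp
  qed
  have hc: "continuous_on (B p) (h p)" and gc: "continuous_on (B p) (g p)" for p
    using *(2,3) unfolding B_def by (auto intro: holomorphic_dual_continuous)
  show "generically_equal f (\<lambda>_. 0) \<or> generically_equal (\<lambda>x. inverse (f x) * f x) (\<lambda>_. 1)"
  proof (cases "N 0")
    case True
    then have "nonvanishing (\<lambda>x. g p x * h p x) (B p)" for p using N_const gh by blast
    moreover have "f x \<noteq> 0" if "x \<in> B p" "g p x * h p x \<noteq> 0" for p x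
      using that *(5)[of x p] unfolding B_def by auto
    ultimately have "generically_equal (\<lambda>x. inverse (f x) * f x) (\<lambda>_. 1)"
      unfolding generically_equal_def
      by (intro exI[of _ "\<Union>p. {x \<in> B p. g p x * h p x \<noteq> 0}"] conjI opn dense
          continuous_intros hc gc) auto
    then show ?thesis ..
  next
    case False
    then have "\<not> N p" for p using N_const by blast
    then have "f x = 0" if "x \<in> B p" "h p x \<noteq> 0" for p x
      using that *(5)[of x p] notN[of p x] unfolding B_def by simp
    then have "generically_equal f (\<lambda>_. 0)"
      unfolding generically_equal_def
      by (intro exI[of _ "\<Union>p. {x \<in> B p. h p x \<noteq> 0}"] conjI opn dense hc)
         (use *(4) in \<open>auto simp: B_def\<close>)
    then show ?thesis ..
  qed
qed

instantiation mero :: (fd_commutative_lie_algebra) field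
begin

lift_definition zero_mero :: "'a mero" is "\<lambda>_. 0"
  by (simp add: meromorphic_rep_const generically_equal_refl)
lift_definition one_mero :: "'a mero" is "\<lambda>_. 1"
  by (simp add: meromorphic_rep_const generically_equal_refl)
lift_definition plus_mero :: "'a mero \<Rightarrow> 'a mero \<Rightarrow> 'a mero" is "\<lambda>f g x. f x + g x"
  by (simp add: meromorphic_rep_add generically_equal_map2[where F = "(+)"])
lift_definition times_mero :: "'a mero \<Rightarrow> 'a mero \<Rightarrow> 'a mero" is "\<lambda>f g x. f x * g x"
  by (simp add: meromorphic_rep_mult generically_equal_map2[where F = "(*)"])
lift_definition uminus_mero :: "'a mero \<Rightarrow> 'a mero" is "\<lambda>f x. - f x"
  by (simp add: meromorphic_rep_uminus generically_equal_map[where F = uminus])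
lift_definition inverse_mero :: "'a mero \<Rightarrow> 'a mero" is "\<lambda>f x. inverse (f x)"
  by (simp add: meromorphic_rep_inverse_or_zero(1) generically_equal_map[where F = inverse])
definition minus_mero :: "'a mero \<Rightarrow> 'a mero \<Rightarrow> 'a mero" where
  "minus_mero f g = f + - g"
definition divide_mero :: "'a mero \<Rightarrow> 'a mero \<Rightarrow> 'a mero" where
  "divide_mero f g = f * inverse g"

instance
proof
  fix f g k :: "'a mero"
  show "f * g * k = f * (g * k)"
    by transfer (simp add: mult.assoc meromorphic_rep_mult generically_equal_refl)
  show "f * g = g * f"
    by transfer (simp add: mult.commute meromorphic_rep_mult generically_equal_refl)
  show "1 * f = f" by transfer (simp add: generically_equal_refl)
  show "f + g + k = f + (g + k)"
    by transfer (simp add: add.assoc meromorphic_rep_add generically_equal_refl)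
  show "f + g = g + f"
    by transfer (simp add: add.commute meromorphic_rep_add generically_equal_refl)
  show "0 + f = f" by transfer (simp add: generically_equal_refl)
  show "- f + f = 0"
    by transfer (simp add: meromorphic_rep_const generically_equal_refl)
  show "f - g = f + - g" by (rule minus_mero_def)
  show "(f + g) * k = f * k + g * k"
    by transfer (simp add: distrib_right meromorphic_rep_mult meromorphic_rep_add
        generically_equal_refl)
  show "(0 :: 'a mero) \<noteq> 1"
    by transfer (auto simp: generically_equal_def)
  show "f \<noteq> 0 \<Longrightarrow> inverse f * f = 1"
    by transfer (auto simp: meromorphic_rep_const meromorphic_rep_mult
        meromorphic_rep_inverse_or_zero(1) dest: meromorphic_rep_inverse_or_zero(2))
  show "f div g = f * inverse g" by (rule divide_mero_def)
  show "inverse (0 :: 'a mero) = 0"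
    by transfer (simp add: meromorphic_rep_const generically_equal_refl)
qed

end

section \<open>Complex vector spaces with explicit carriers, quotients and tensor products\<close>

text \<open>Vector spaces are modules over \<open>\<complex>\<close> in the sense of HOL-Algebra.  The record fields
  \<open>mult\<close> and \<open>one\<close>, which modules inherit from rings, play no role.\<close>

abbreviation complex_ring :: "complex ring" where
  "complex_ring \<equiv> ring_of_type_algebra"

definition linear_maps ::
  "(complex, 'a, 'm) module_scheme \<Rightarrow> (complex, 'b, 'n) module_scheme \<Rightarrow> ('a \<Rightarrow> 'b) set" where
  "linear_maps V W = {\<phi>. \<phi> \<in> carrier V \<rightarrow> carrier W \<and>
    (\<forall>x\<in>carrier V. \<forall>y\<in>carrier V. \<phi> (x \<oplus>\<^bsub>V\<^esub> y) = \<phi> x \<oplus>\<^bsub>W\<^esub> \<phi> y) \<and>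
    (\<forall>c. \<forall>x\<in>carrier V. \<phi> (c \<odot>\<^bsub>V\<^esub> x) = c \<odot>\<^bsub>W\<^esub> \<phi> x)}"

definition subspace_span :: "(complex, 'a, 'm) module_scheme \<Rightarrow> 'a set \<Rightarrow> 'a set" where
  "subspace_span V S = \<Inter>{H. submodule H complex_ring V \<and> S \<subseteq> H}"

definition quotient_space ::
  "(complex, 'a, 'm) module_scheme \<Rightarrow> 'a set \<Rightarrow> (complex, 'a set) module" where
  "quotient_space V N = \<lparr>carrier = a_rcosets\<^bsub>V\<^esub> N, mult = undefined, one = undefined, zero = N,
    add = set_add V, smult = (\<lambda>c Y. \<Union>x\<in>Y. a_r_coset V N (c \<odot>\<^bsub>V\<^esub> x))\<rparr>"

definition direct_sum ::
  "('i \<Rightarrow> (complex, 'a, 'm) module_scheme) \<Rightarrow> (complex, 'i \<Rightarrow> 'a) module" where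
  "direct_sum V = \<lparr>
    carrier = {x. (\<forall>i. x i \<in> carrier (V i)) \<and> finite {i. x i \<noteq> \<zero>\<^bsub>V i\<^esub>}},
    mult = undefined, one = undefined,
    zero = (\<lambda>i. \<zero>\<^bsub>V i\<^esub>), add = (\<lambda>x y i. x i \<oplus>\<^bsub>V i\<^esub> y i), smult = (\<lambda>c x i. c \<odot>\<^bsub>V i\<^esub> x i)\<rparr>"

definition direct_sum_inj :: "('i \<Rightarrow> (complex, 'a, 'm) module_scheme) \<Rightarrow> 'i \<Rightarrow> 'a \<Rightarrow> 'i \<Rightarrow> 'a" where
  "direct_sum_inj V i a = (\<lambda>j. if j = i then a else \<zero>\<^bsub>V j\<^esub>)"

definition free_space :: "'x set \<Rightarrow> (complex, 'x \<Rightarrow>\<^sub>0 complex) module" where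
  "free_space Y = \<lparr>carrier = {v. Poly_Mapping.keys v \<subseteq> Y}, mult = undefined, one = undefined,
    zero = 0, add = (+), smult = (\<lambda>c. Poly_Mapping.map ((*) c))\<rparr>"

abbreviation free_gen :: "'x \<Rightarrow> 'x \<Rightarrow>\<^sub>0 complex" where
  "free_gen p \<equiv> Poly_Mapping.single p 1"

definition bilinear_relations ::
  "(complex, 'a, 'm) module_scheme \<Rightarrow> (complex, 'b, 'n) module_scheme \<Rightarrow> ('a \<times> 'b \<Rightarrow>\<^sub>0 complex) set"
  where "bilinear_relations V W =
    {free_gen (a \<oplus>\<^bsub>V\<^esub> a', b) - free_gen (a, b) - free_gen (a', b) | a a' b.
      a \<in> carrier V \<and> a' \<in> carrier V \<and> b \<in> carrier W} \<union>
    {free_gen (a, b \<oplus>\<^bsub>W\<^esub> b') - free_gen (a, b) - free_gen (a, b') | a b b'.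
      a \<in> carrier V \<and> b \<in> carrier W \<and> b' \<in> carrier W} \<union>
    {free_gen (c \<odot>\<^bsub>V\<^esub> a, b) - Poly_Mapping.single (a, b) c | c a b. a \<in> carrier V \<and> b \<in> carrier W} \<union>
    {free_gen (a, c \<odot>\<^bsub>W\<^esub> b) - Poly_Mapping.single (a, b) c | c a b. a \<in> carrier V \<and> b \<in> carrier W}"

text \<open>The tensor product over \<open>\<complex>\<close> of \<open>V\<close> and \<open>W\<close> modulo the relations
  \<open>a \<otimes> b = a' \<otimes> b'\<close> for \<open>((a, b), (a', b')) \<in> R\<close>.\<close>

definition tensor_relations :: "(complex, 'a, 'm) module_scheme \<Rightarrow> (complex, 'b, 'n) module_scheme \<Rightarrow>
    (('a \<times> 'b) \<times> ('a \<times> 'b)) set \<Rightarrow> ('a \<times> 'b \<Rightarrow>\<^sub>0 complex) set" where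
  "tensor_relations V W R = subspace_span (free_space (carrier V \<times> carrier W))
    (bilinear_relations V W \<union> {free_gen p - free_gen q | p q. (p, q) \<in> R})"

definition tensor_mod :: "(complex, 'a, 'm) module_scheme \<Rightarrow> (complex, 'b, 'n) module_scheme \<Rightarrow>
    (('a \<times> 'b) \<times> ('a \<times> 'b)) set \<Rightarrow> (complex, ('a \<times> 'b \<Rightarrow>\<^sub>0 complex) set) module" where
  "tensor_mod V W R =
    quotient_space (free_space (carrier V \<times> carrier W)) (tensor_relations V W R)"

definition tensor_class :: "(complex, 'a, 'm) module_scheme \<Rightarrow> (complex, 'b, 'n) module_scheme \<Rightarrow>
    (('a \<times> 'b) \<times> ('a \<times> 'b)) set \<Rightarrow> ('a \<times> 'b \<Rightarrow>\<^sub>0 complex) \<Rightarrow> ('a \<times> 'b \<Rightarrow>\<^sub>0 complex) set" where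
  "tensor_class V W R v = a_r_coset (free_space (carrier V \<times> carrier W)) (tensor_relations V W R) v"

definition pure_tensor :: "(complex, 'a, 'm) module_scheme \<Rightarrow> (complex, 'b, 'n) module_scheme \<Rightarrow>
    (('a \<times> 'b) \<times> ('a \<times> 'b)) set \<Rightarrow> 'a \<Rightarrow> 'b \<Rightarrow> ('a \<times> 'b \<Rightarrow>\<^sub>0 complex) set" where
  "pure_tensor V W R a b = tensor_class V W R (free_gen (a, b))"

text \<open>The endomorphism \<open>\<phi> \<otimes> \<psi>\<close>, computed on representatives.  It is meaningful when \<open>\<phi>\<close> and
  \<open>\<psi>\<close> are linear and compatible with \<open>R\<close>, in which case all \<open>v \<in> Y\<close> yield the same class.\<close>

definition tensor_map :: "(complex, 'a, 'm) module_scheme \<Rightarrow> (complex, 'b, 'n) module_scheme \<Rightarrow>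
    (('a \<times> 'b) \<times> ('a \<times> 'b)) set \<Rightarrow> ('a \<Rightarrow> 'a) \<Rightarrow> ('b \<Rightarrow> 'b) \<Rightarrow>
    ('a \<times> 'b \<Rightarrow>\<^sub>0 complex) set \<Rightarrow> ('a \<times> 'b \<Rightarrow>\<^sub>0 complex) set" where
  "tensor_map V W R \<phi> \<psi> Y = (\<Union>v\<in>Y. tensor_class V W R
    (\<Sum>(a, b)\<in>Poly_Mapping.keys v. Poly_Mapping.single (\<phi> a, \<psi> b) (Poly_Mapping.lookup v (a, b))))"

section \<open>Prealgebras\<close>

record (overloaded) ('a, 'h) prealg = "(complex, 'a) module" +
  grade :: "'h dual \<Rightarrow> 'h dual \<Rightarrow> 'a set"
  mu_l :: "'h mero \<Rightarrow> 'a \<Rightarrow> 'a"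
  mu_r :: "'h mero \<Rightarrow> 'a \<Rightarrow> 'a"

text \<open>A bigraded decomposition of \<open>a\<close>: a finitely supported family of homogeneous elements
  with sum \<open>a\<close>.\<close>

definition decomposition ::
  "('a, 'h::fd_commutative_lie_algebra, 'm) prealg_scheme \<Rightarrow> 'a \<Rightarrow> ('h dual \<times> 'h dual \<Rightarrow> 'a) \<Rightarrow> bool"
  where "decomposition A a x \<longleftrightarrow> (\<forall>\<alpha> \<beta>. x (\<alpha>, \<beta>) \<in> grade A \<alpha> \<beta>) \<and> finite {p. x p \<noteq> \<zero>\<^bsub>A\<^esub>} \<and>
    a = (\<Oplus>\<^bsub>A\<^esub>p\<in>{p. x p \<noteq> \<zero>\<^bsub>A\<^esub>}. x p)"

definition left_action ::
  "(complex, 'a, 'm) module_scheme \<Rightarrow> ('h::fd_commutative_lie_algebra mero \<Rightarrow> 'a \<Rightarrow> 'a) \<Rightarrow> bool" where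
  "left_action V \<mu> \<longleftrightarrow> (\<forall>f. \<mu> f \<in> linear_maps V V) \<and>
    (\<forall>a\<in>carrier V. \<forall>f g. \<mu> (f + g) a = \<mu> f a \<oplus>\<^bsub>V\<^esub> \<mu> g a) \<and>
    (\<forall>a\<in>carrier V. \<forall>f g. \<mu> (f * g) a = \<mu> f (\<mu> g a)) \<and>
    (\<forall>a\<in>carrier V. \<forall>c. \<mu> (const_mero c) a = c \<odot>\<^bsub>V\<^esub> a)"

definition prealgebra :: "('a, 'h::fd_commutative_lie_algebra, 'm) prealg_scheme \<Rightarrow> bool" where
  "prealgebra A \<longleftrightarrow> module complex_ring A \<and>
    (\<forall>\<alpha> \<beta>. submodule (grade A \<alpha> \<beta>) complex_ring A) \<and>
    (\<forall>a\<in>carrier A. \<exists>!x. decomposition A a x) \<and>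
    left_action A (mu_l A) \<and> left_action A (mu_r A) \<and>
    (\<forall>f \<alpha> \<beta>. \<forall>a\<in>grade A \<alpha> \<beta>. mu_l A f a \<in> grade A \<alpha> \<beta> \<and> mu_r A f a \<in> grade A \<alpha> \<beta>) \<and>
    (\<forall>f g. \<forall>a\<in>carrier A. mu_l A f (mu_r A g a) = mu_r A g (mu_l A f a))"

definition component ::
  "('a, 'h::fd_commutative_lie_algebra, 'm) prealg_scheme \<Rightarrow> 'a \<Rightarrow> 'h dual \<times> 'h dual \<Rightarrow> 'a" where
  "component A a = (THE x. decomposition A a x)"

text \<open>The right actions: \<open>\<mu>\<^sub>l(f) a = a \<mu>\<^sub>l(T\<^sub>\<alpha> f)\<close> for \<open>a\<close> of bidegree \<open>(\<alpha>, \<beta>)\<close> says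
  \<open>a \<mu>\<^sub>l(f) = \<mu>\<^sub>l(T\<^bsub>-\<alpha>\<^esub> f) a\<close>, extended additively, and likewise for \<open>\<mu>\<^sub>r\<close> with \<open>\<beta>\<close>.\<close>

definition mu_l_right ::
  "('a, 'h::fd_commutative_lie_algebra, 'm) prealg_scheme \<Rightarrow> 'a \<Rightarrow> 'h mero \<Rightarrow> 'a" where
  "mu_l_right A a f = (\<Oplus>\<^bsub>A\<^esub>p\<in>{p. component A a p \<noteq> \<zero>\<^bsub>A\<^esub>}.
    mu_l A (shift_mero (- fst p) f) (component A a p))"

definition mu_r_right ::
  "('a, 'h::fd_commutative_lie_algebra, 'm) prealg_scheme \<Rightarrow> 'a \<Rightarrow> 'h mero \<Rightarrow> 'a" where
  "mu_r_right A a f = (\<Oplus>\<^bsub>A\<^esub>p\<in>{p. component A a p \<noteq> \<zero>\<^bsub>A\<^esub>}.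
    mu_r A (shift_mero (- snd p) f) (component A a p))"

definition prealgebra_hom :: "('a, 'h::fd_commutative_lie_algebra, 'm) prealg_scheme \<Rightarrow>
    ('b, 'h, 'n) prealg_scheme \<Rightarrow> ('a \<Rightarrow> 'b) \<Rightarrow> bool" where
  "prealgebra_hom A B \<phi> \<longleftrightarrow> prealgebra A \<and> prealgebra B \<and> \<phi> \<in> linear_maps A B \<and>
    (\<forall>\<alpha> \<beta>. \<phi> ` grade A \<alpha> \<beta> \<subseteq> grade B \<alpha> \<beta>) \<and>
    (\<forall>f. \<forall>a\<in>carrier A. \<phi> (mu_l A f a) = mu_l B f (\<phi> a) \<and> \<phi> (mu_r A f a) = mu_r B f (\<phi> a))"

section \<open>The two tensor products of prealgebras\<close>

abbreviation homogeneous_part :: "('a, 'h::fd_commutative_lie_algebra, 'm) prealg_scheme \<Rightarrow>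
    'h dual \<Rightarrow> 'h dual \<Rightarrow> ('a, 'h, 'm) prealg_scheme" where
  "homogeneous_part A \<alpha> \<beta> \<equiv> A\<lparr>carrier := grade A \<alpha> \<beta>\<rparr>"

definition tilde_relations :: "('a, 'h::fd_commutative_lie_algebra, 'm) prealg_scheme \<Rightarrow>
    ('b, 'h, 'n) prealg_scheme \<Rightarrow> 'h dual \<times> 'h dual \<times> 'h dual \<Rightarrow> (('a \<times> 'b) \<times> ('a \<times> 'b)) set" where
  "tilde_relations A B = (\<lambda>(\<alpha>, \<gamma>, \<beta>).
    {((mu_r A f a, b), (a, mu_l B f b)) | f a b. a \<in> grade A \<alpha> \<gamma> \<and> b \<in> grade B \<gamma> \<beta>})"

text \<open>The summand of index \<open>(\<alpha>, \<gamma>, \<beta>)\<close> is the tensor product of \<open>A\<^bsub>\<alpha>\<gamma>\<^esub>\<close> and \<open>B\<^bsub>\<gamma>\<beta>\<^esub>\<close> over the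
  field of meromorphic functions.\<close>

definition tilde_summand :: "('a, 'h::fd_commutative_lie_algebra, 'm) prealg_scheme \<Rightarrow>
    ('b, 'h, 'n) prealg_scheme \<Rightarrow> 'h dual \<times> 'h dual \<times> 'h dual \<Rightarrow>
    (complex, ('a \<times> 'b \<Rightarrow>\<^sub>0 complex) set) module" where
  "tilde_summand A B = (\<lambda>(\<alpha>, \<gamma>, \<beta>). tensor_mod (homogeneous_part A \<alpha> \<gamma>) (homogeneous_part B \<gamma> \<beta>)
    (tilde_relations A B (\<alpha>, \<gamma>, \<beta>)))"

definition tilde_map :: "('a, 'h::fd_commutative_lie_algebra, 'm) prealg_scheme \<Rightarrow>
    ('b, 'h, 'n) prealg_scheme \<Rightarrow> ('a \<Rightarrow> 'a) \<Rightarrow> ('b \<Rightarrow> 'b) \<Rightarrow> 'h dual \<times> 'h dual \<times> 'h dual \<Rightarrow>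
    ('a \<times> 'b \<Rightarrow>\<^sub>0 complex) set \<Rightarrow> ('a \<times> 'b \<Rightarrow>\<^sub>0 complex) set" where
  "tilde_map A B \<phi> \<psi> = (\<lambda>(\<alpha>, \<gamma>, \<beta>). tensor_map (homogeneous_part A \<alpha> \<gamma>) (homogeneous_part B \<gamma> \<beta>)
    (tilde_relations A B (\<alpha>, \<gamma>, \<beta>)) \<phi> \<psi>)"

definition tilde_tensor :: "('a, 'h::fd_commutative_lie_algebra, 'm) prealg_scheme \<Rightarrow>
    ('b, 'h, 'n) prealg_scheme \<Rightarrow>
    ('h dual \<times> 'h dual \<times> 'h dual \<Rightarrow> ('a \<times> 'b \<Rightarrow>\<^sub>0 complex) set, 'h) prealg"
    (infixl \<open>\<otimes>\<^sub>T\<close> 70) where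
  "A \<otimes>\<^sub>T B = module.extend (direct_sum (tilde_summand A B)) (prealg.fields
    (\<lambda>\<alpha> \<beta>. {x \<in> carrier (direct_sum (tilde_summand A B)).
      \<forall>\<alpha>' \<gamma> \<beta>'. (\<alpha>', \<beta>') \<noteq> (\<alpha>, \<beta>) \<longrightarrow> x (\<alpha>', \<gamma>, \<beta>') = \<zero>\<^bsub>tilde_summand A B (\<alpha>', \<gamma>, \<beta>')\<^esub>})
    (\<lambda>f x i. tilde_map A B (mu_l A f) id i (x i))
    (\<lambda>f x i. tilde_map A B id (mu_r B f) i (x i)))"

text \<open>The element \<open>a \<otimes> b\<close> for \<open>a \<in> A\<^bsub>\<alpha>\<gamma>\<^esub>\<close> and \<open>b \<in> B\<^bsub>\<gamma>\<beta>\<^esub>\<close>.\<close>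

definition tilde_pure :: "('a, 'h::fd_commutative_lie_algebra, 'm) prealg_scheme \<Rightarrow>
    ('b, 'h, 'n) prealg_scheme \<Rightarrow> 'h dual \<Rightarrow> 'h dual \<Rightarrow> 'h dual \<Rightarrow> 'a \<Rightarrow> 'b \<Rightarrow>
    'h dual \<times> 'h dual \<times> 'h dual \<Rightarrow> ('a \<times> 'b \<Rightarrow>\<^sub>0 complex) set" where
  "tilde_pure A B \<alpha> \<gamma> \<beta> a b = direct_sum_inj (tilde_summand A B) (\<alpha>, \<gamma>, \<beta>)
    (pure_tensor (homogeneous_part A \<alpha> \<gamma>) (homogeneous_part B \<gamma> \<beta>)
      (tilde_relations A B (\<alpha>, \<gamma>, \<beta>)) a b)"

definition hat_relations :: "('a, 'h::fd_commutative_lie_algebra, 'm) prealg_scheme \<Rightarrow>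
    ('b, 'h, 'n) prealg_scheme \<Rightarrow> (('a \<times> 'b) \<times> ('a \<times> 'b)) set" where
  "hat_relations A B =
    {((mu_l_right A a f, b), (a, mu_l B f b)) | f a b. a \<in> carrier A \<and> b \<in> carrier B} \<union>
    {((mu_r_right A a f, b), (a, mu_r B f b)) | f a b. a \<in> carrier A \<and> b \<in> carrier B}"

definition hat_pure :: "('a, 'h::fd_commutative_lie_algebra, 'm) prealg_scheme \<Rightarrow>
    ('b, 'h, 'n) prealg_scheme \<Rightarrow> 'a \<Rightarrow> 'b \<Rightarrow> ('a \<times> 'b \<Rightarrow>\<^sub>0 complex) set" where
  "hat_pure A B = pure_tensor A B (hat_relations A B)"

definition hat_tensor :: "('a, 'h::fd_commutative_lie_algebra, 'm) prealg_scheme \<Rightarrow>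
    ('b, 'h, 'n) prealg_scheme \<Rightarrow> (('a \<times> 'b \<Rightarrow>\<^sub>0 complex) set, 'h) prealg"
    (infixl \<open>\<otimes>\<^sub>H\<close> 70) where
  "A \<otimes>\<^sub>H B = module.extend (tensor_mod A B (hat_relations A B)) (prealg.fields
    (\<lambda>\<alpha> \<beta>. subspace_span (tensor_mod A B (hat_relations A B))
      {hat_pure A B a b | a b \<alpha>1 \<beta>1 \<alpha>2 \<beta>2. a \<in> grade A \<alpha>1 \<beta>1 \<and> b \<in> grade B \<alpha>2 \<beta>2 \<and>
        \<alpha>1 + \<alpha>2 = \<alpha> \<and> \<beta>1 + \<beta>2 = \<beta>})
    (\<lambda>f. tensor_map A B (hat_relations A B) (mu_l A f) id)
    (\<lambda>f. tensor_map A B (hat_relations A B) (mu_r A f) id))"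

end

theory Submission
  imports Defs
begin

text \<open>On elements of bidegrees \<open>(\<alpha>, \<gamma>)\<close>, \<open>(\<gamma>, \<beta>)\<close>, \<open>(\<alpha>', \<gamma>')\<close>, \<open>(\<gamma>', \<beta>')\<close> the value
  \<open>(a \<otimes> c) \<otimes> (b \<otimes> d)\<close> is linear in each variable and balanced: the relation in \<open>A \<otimes>\<^sub>T B\<close> is mapped to
  the one in the target, because \<open>\<mu>\<^sub>r\<close> and \<open>\<mu>\<^sub>l\<close> act on \<open>a \<otimes> c\<close> and \<open>b \<otimes> d\<close> through the first factor;
  the relation in \<open>C \<otimes>\<^sub>T D\<close> reduces to it by moving \<open>f\<close> through \<open>a \<otimes> c\<close>, which shifts it by \<open>- \<gamma>\<close>, and
  back through \<open>b \<otimes> d\<close>, which undoes the same shift.  So \<open>\<sigma>\<close> exists on each pair of summands, and the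
  sum over all pairs respects the relations of \<open>\<otimes>\<^sub>H\<close>, the outer actions of \<open>\<otimes>\<^sub>T\<close> being those on
  \<open>a\<close> and \<open>b\<close>.  That \<open>\<otimes>\<^sub>H\<close> is graded rests on projections which are themselves balanced, as
  all actions preserve the bigrading.\<close>

section \<open>Complex vector spaces with explicit carriers\<close>

text \<open>\<open>prealgebra_hom\<close> asserts that source and target are prealgebras, so the
  grading of both tensor products is part of the claim. For \<open>\<otimes>\<^sub>T\<close> it is
  built into the direct sum. The graded parts of \<open>\<otimes>\<^sub>H\<close> are spans inside a
  quotient, and it is not evident that their sum is direct. The formula for \<sigma> makes sense
  only if a and b share a middle degree \<gamma>, and c and d share \<gamma>'; then a \<otimes> c
  and b \<otimes> d share \<gamma> + \<gamma>'. The middle degrees are visible in the direct sum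
  defining \<open>\<otimes>\<^sub>T\<close> but not in its bigrading, so \<sigma> is constructed on
  pairs of summands, not on pairs of bidegrees. Different pairs of index triples can have the same
  sum; therefore the partial maps take values in the whole direct sum and are added there.
  Quotients, lifts and maps on tensor products are defined through representatives. The universal
  property is established once, for an arbitrary set of relations, and everything later is checked
  on pure tensors.\<close>

lemma complex_ring_simps [simp]:
  "carrier complex_ring = UNIV" "add complex_ring = (+)" "mult complex_ring = (*)"
  "one complex_ring = 1" "zero complex_ring = 0"
  by (simp_all add: ring_of_type_algebra_def fun_eq_iff)

text \<open>The module axioms over \<open>complex_ring\<close> with the membership of scalars
  discharged, since every complex number is a scalar; \<open>cspace_iff_module\<close> leads back to
  the notion used in \<open>prealgebra\<close>.\<close>

locale cspace = abelian_group V for V :: "(complex, 'a, 'm) module_scheme" (structure) +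
  assumes smult_closed [simp, intro]: "x \<in> carrier V \<Longrightarrow> c \<odot> x \<in> carrier V"
    and smult_add_left: "x \<in> carrier V \<Longrightarrow> (c + d) \<odot> x = c \<odot> x \<oplus> d \<odot> x"
    and smult_add_right: "\<lbrakk>x \<in> carrier V; y \<in> carrier V\<rbrakk> \<Longrightarrow> c \<odot> (x \<oplus> y) = c \<odot> x \<oplus> c \<odot> y"
    and smult_smult: "x \<in> carrier V \<Longrightarrow> c \<odot> (d \<odot> x) = (c * d) \<odot> x"
    and smult_one [simp]: "x \<in> carrier V \<Longrightarrow> 1 \<odot> x = x"

lemma cspace_iff_module: "cspace V \<longleftrightarrow> module complex_ring V"
proof
  assume "cspace V"
  then interpret cspace V .
  show "module complex_ring V"
    by (rule moduleI)
      (simp_all add: cring_from_type_algebra abelian_group_axioms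
        smult_add_left smult_add_right smult_smult)
next
  assume *: "module complex_ring V"
  then interpret V: abelian_group V by (simp add: module_def)
  show "cspace V"
    using module.smult_closed[OF *] module.smult_l_distr[OF *] module.smult_r_distr[OF *]
      module.smult_assoc1[OF *] module.smult_one[OF *]
    by unfold_locales simp_all
qed

context cspace
begin

lemma smult_zero_left [simp]: "x \<in> carrier V \<Longrightarrow> 0 \<odot> x = \<zero>"
  and smult_zero_right [simp]: "c \<odot> \<zero> = \<zero>"
  using module.smult_l_null[of complex_ring V] module.smult_r_null[of complex_ring V]
    cspace_axioms by (simp_all add: cspace_iff_module)

lemma minus_eq_smult: "x \<in> carrier V \<Longrightarrow> \<ominus> x = (- 1) \<odot> x"
  using smult_add_left[of x "-1" 1] minus_equality[of "(-1) \<odot> x" x] by simp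

text \<open>Negatives are not asked for: they are multiples by -1.\<close>

lemma subspaceI:
  assumes "H \<subseteq> carrier V" "\<zero> \<in> H" "\<And>x y. \<lbrakk>x \<in> H; y \<in> H\<rbrakk> \<Longrightarrow> x \<oplus> y \<in> H"
    "\<And>c x. x \<in> H \<Longrightarrow> c \<odot> x \<in> H"
  shows "submodule H complex_ring V"
  using cspace_axioms assms unfolding cspace_iff_module
  by (intro module.submoduleI) (auto simp: minus_eq_smult subset_iff)

lemma subspaceD:
  assumes "submodule H complex_ring V"
  shows "H \<subseteq> carrier V" "\<zero> \<in> H" "\<And>x y. \<lbrakk>x \<in> H; y \<in> H\<rbrakk> \<Longrightarrow> x \<oplus> y \<in> H"
    "\<And>c x. x \<in> H \<Longrightarrow> c \<odot> x \<in> H"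
proof -
  note * = module.submoduleE[OF cspace_axioms[unfolded cspace_iff_module] assms]
  show "H \<subseteq> carrier V" "\<And>x y. \<lbrakk>x \<in> H; y \<in> H\<rbrakk> \<Longrightarrow> x \<oplus> y \<in> H" "\<And>c x. x \<in> H \<Longrightarrow> c \<odot> x \<in> H"
    using * by auto
  \<comment> \<open>The elimination rule provides only nonemptiness; zero is then 0 times any
    element.\<close>
  obtain x where "x \<in> H" using *(2) by blast
  then have "0 \<odot> x \<in> H" "x \<in> carrier V" using *(1) *(4)[of 0 x] by auto
  then show "\<zero> \<in> H" by simp
qed

lemma cspace_subspace: "submodule H complex_ring V \<Longrightarrow> cspace (V\<lparr>carrier := H\<rparr>)"
  using submodule.submodule_is_module[of H complex_ring V] cspace_axioms
  by (simp add: cspace_iff_module)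

lemma subspace_carrier: "submodule (carrier V) complex_ring V"
  by (rule subspaceI) auto

lemma subspace_zero: "submodule {\<zero>} complex_ring V"
  by (rule subspaceI) auto

lemma subspace_Inter:
  assumes "\<And>H. H \<in> \<H> \<Longrightarrow> submodule H complex_ring V" "\<H> \<noteq> {}"
  shows "submodule (\<Inter>\<H>) complex_ring V"
proof (rule subspaceI)
  show "\<Inter>\<H> \<subseteq> carrier V" using subspaceD(1) assms by blast
qed (use subspaceD(2-4)[OF assms(1)] in blast)+

text \<open>The hypothesis makes the family of subspaces above \<open>S\<close> nonempty, the
  carrier being one of them. An empty intersection would be the whole type.\<close>

lemma subspace_subspace_span:
  assumes "S \<subseteq> carrier V"
  shows "submodule (subspace_span V S) complex_ring V"
  unfolding subspace_span_def using assms subspace_carrier by (intro subspace_Inter) auto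

end

lemma subspace_span_superset: "S \<subseteq> subspace_span V S"
  unfolding subspace_span_def by blast

lemma subspace_span_least:
  "\<lbrakk>submodule H complex_ring V; S \<subseteq> H\<rbrakk> \<Longrightarrow> subspace_span V S \<subseteq> H"
  unfolding subspace_span_def by blast

text \<open>The inverse of x is its multiple by -1, so no inverses have to be exhibited; the rule
  \<open>0 \<odot> x = \<zero>\<close> takes their place.\<close>

lemma cspaceI:
  fixes V (structure)
  assumes "\<zero> \<in> carrier V" "\<And>x y. \<lbrakk>x \<in> carrier V; y \<in> carrier V\<rbrakk> \<Longrightarrow> x \<oplus> y \<in> carrier V"
    "\<And>c x. x \<in> carrier V \<Longrightarrow> c \<odot> x \<in> carrier V"
    "\<And>x y z. \<lbrakk>x \<in> carrier V; y \<in> carrier V; z \<in> carrier V\<rbrakk> \<Longrightarrow> (x \<oplus> y) \<oplus> z = x \<oplus> (y \<oplus> z)"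
    "\<And>x y. \<lbrakk>x \<in> carrier V; y \<in> carrier V\<rbrakk> \<Longrightarrow> x \<oplus> y = y \<oplus> x"
    "\<And>x. x \<in> carrier V \<Longrightarrow> \<zero> \<oplus> x = x"
    "\<And>x. x \<in> carrier V \<Longrightarrow> 0 \<odot> x = \<zero>"
    "\<And>c d x. x \<in> carrier V \<Longrightarrow> (c + d) \<odot> x = c \<odot> x \<oplus> d \<odot> x"
    "\<And>c x y. \<lbrakk>x \<in> carrier V; y \<in> carrier V\<rbrakk> \<Longrightarrow> c \<odot> (x \<oplus> y) = c \<odot> x \<oplus> c \<odot> y"
    "\<And>c d x. x \<in> carrier V \<Longrightarrow> c \<odot> (d \<odot> x) = (c * d) \<odot> x"
    "\<And>x. x \<in> carrier V \<Longrightarrow> 1 \<odot> x = x"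
  shows "cspace V"
proof (intro cspace.intro cspace_axioms.intro)
  show "abelian_group V"
  proof (rule abelian_groupI)
    fix x assume x: "x \<in> carrier V"
    have "(- 1) \<odot> x \<oplus> x = \<zero>" using assms(7,11) assms(8)[of x "-1" 1] x by simp
    then show "\<exists>y\<in>carrier V. y \<oplus> x = \<zero>" using assms(3) x by blast
  qed (use assms in simp_all)
qed (use assms in simp_all)

text \<open>All axioms are identities and hence pass to images. With the coset map for q this gives
  quotients, with the identity it moves the structure to a record extended by further
  fields.\<close>

lemma cspace_surj:
  assumes "cspace V" "carrier W = q ` carrier V"
    "\<And>x y. \<lbrakk>x \<in> carrier V; y \<in> carrier V\<rbrakk> \<Longrightarrow> q x \<oplus>\<^bsub>W\<^esub> q y = q (x \<oplus>\<^bsub>V\<^esub> y)"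
    "\<And>c x. x \<in> carrier V \<Longrightarrow> c \<odot>\<^bsub>W\<^esub> q x = q (c \<odot>\<^bsub>V\<^esub> x)"
    "\<zero>\<^bsub>W\<^esub> = q \<zero>\<^bsub>V\<^esub>"
  shows "cspace W"
proof -
  interpret V: cspace V by fact
  show ?thesis
    by (rule cspaceI)
      (auto simp: assms(2-5) V.a_ac V.smult_add_left V.smult_add_right V.smult_smult)
qed

subsection \<open>Linear maps\<close>

lemma linear_mapsI:
  assumes "\<And>x. x \<in> carrier V \<Longrightarrow> \<phi> x \<in> carrier W"
    "\<And>x y. \<lbrakk>x \<in> carrier V; y \<in> carrier V\<rbrakk> \<Longrightarrow> \<phi> (x \<oplus>\<^bsub>V\<^esub> y) = \<phi> x \<oplus>\<^bsub>W\<^esub> \<phi> y"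
    "\<And>c x. x \<in> carrier V \<Longrightarrow> \<phi> (c \<odot>\<^bsub>V\<^esub> x) = c \<odot>\<^bsub>W\<^esub> \<phi> x"
  shows "\<phi> \<in> linear_maps V W"
  using assms unfolding linear_maps_def by blast

lemma linear_mapsD:
  assumes "\<phi> \<in> linear_maps V W"
  shows "\<And>x. x \<in> carrier V \<Longrightarrow> \<phi> x \<in> carrier W"
    "\<And>x y. \<lbrakk>x \<in> carrier V; y \<in> carrier V\<rbrakk> \<Longrightarrow> \<phi> (x \<oplus>\<^bsub>V\<^esub> y) = \<phi> x \<oplus>\<^bsub>W\<^esub> \<phi> y"
    "\<And>c x. x \<in> carrier V \<Longrightarrow> \<phi> (c \<odot>\<^bsub>V\<^esub> x) = c \<odot>\<^bsub>W\<^esub> \<phi> x"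
  using assms unfolding linear_maps_def by blast+

lemma linear_maps_zero:
  assumes "\<phi> \<in> linear_maps V W" "cspace V" "cspace W"
  shows "\<phi> \<zero>\<^bsub>V\<^esub> = \<zero>\<^bsub>W\<^esub>"
proof -
  interpret V: cspace V by fact
  interpret W: cspace W by fact
  show ?thesis
    using linear_mapsD(1)[OF assms(1), of "\<zero>\<^bsub>V\<^esub>"] linear_mapsD(3)[OF assms(1), of "\<zero>\<^bsub>V\<^esub>" 0]
    by simp
qed

lemma linear_maps_comp:
  "\<lbrakk>\<phi> \<in> linear_maps V W; \<psi> \<in> linear_maps W Z\<rbrakk> \<Longrightarrow> (\<lambda>x. \<psi> (\<phi> x)) \<in> linear_maps V Z"
  by (intro linear_mapsI) (simp_all add: linear_mapsD)

lemma linear_maps_id: "(\<lambda>x. x) \<in> linear_maps V V"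
  by (rule linear_mapsI) simp_all

lemma linear_maps_const_zero:
  assumes "cspace W" shows "(\<lambda>x. \<zero>\<^bsub>W\<^esub>) \<in> linear_maps V W"
proof -
  interpret W: cspace W by fact
  show ?thesis by (rule linear_mapsI) simp_all
qed

lemma linear_maps_add:
  assumes "cspace W" "\<phi> \<in> linear_maps V W" "\<psi> \<in> linear_maps V W"
  shows "(\<lambda>x. \<phi> x \<oplus>\<^bsub>W\<^esub> \<psi> x) \<in> linear_maps V W"
proof -
  interpret W: cspace W by fact
  show ?thesis
    by (rule linear_mapsI)
      (simp_all add: linear_mapsD[OF assms(2)] linear_mapsD[OF assms(3)] W.a_ac W.smult_add_right)
qed

lemma linear_maps_smult:
  assumes "cspace W" "\<phi> \<in> linear_maps V W"
  shows "(\<lambda>x. c \<odot>\<^bsub>W\<^esub> \<phi> x) \<in> linear_maps V W"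
proof -
  interpret W: cspace W by fact
  show ?thesis
    by (rule linear_mapsI)
      (simp_all add: linear_mapsD[OF assms(2)] W.smult_add_right W.smult_smult mult.commute)
qed

lemma linear_maps_cong:
  assumes "\<phi> \<in> linear_maps V W" "cspace V" "\<And>x. x \<in> carrier V \<Longrightarrow> \<psi> x = \<phi> x"
  shows "\<psi> \<in> linear_maps V W"
proof -
  interpret V: cspace V by fact
  show ?thesis
    by (rule linear_mapsI) (simp_all add: assms(3) linear_mapsD[OF assms(1)])
qed

lemma linear_maps_restrict_domain:
  "\<lbrakk>\<phi> \<in> linear_maps V W; H \<subseteq> carrier V\<rbrakk> \<Longrightarrow> \<phi> \<in> linear_maps (V\<lparr>carrier := H\<rparr>) W"
  by (rule linear_mapsI) (auto simp: linear_mapsD subset_iff)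

lemma linear_maps_restrict:
  "\<lbrakk>\<phi> \<in> linear_maps V W; H \<subseteq> carrier V; \<And>x. x \<in> H \<Longrightarrow> \<phi> x \<in> K\<rbrakk> \<Longrightarrow>
    \<phi> \<in> linear_maps (V\<lparr>carrier := H\<rparr>) (W\<lparr>carrier := K\<rparr>)"
  by (rule linear_mapsI) (auto simp: linear_mapsD subset_iff)

lemma subspace_vimage:
  assumes "\<phi> \<in> linear_maps V W" "cspace V" "cspace W" "submodule H complex_ring W"
  shows "submodule {x \<in> carrier V. \<phi> x \<in> H} complex_ring V"
proof -
  interpret V: cspace V by fact
  interpret W: cspace W by fact
  show ?thesis
    using W.subspaceD[OF assms(4)]
    by (intro V.subspaceI) (auto simp: linear_mapsD[OF assms(1)] linear_maps_zero[OF assms(1-3)])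
qed

text \<open>Makes an equation between linear maps a membership in a subspace, which can then be
  proved by induction over spanning elements.\<close>

lemma subspace_equalizer:
  assumes "\<phi> \<in> linear_maps V W" "\<psi> \<in> linear_maps V W" "cspace V" "cspace W"
  shows "submodule {x \<in> carrier V. \<phi> x = \<psi> x} complex_ring V"
proof -
  interpret V: cspace V by fact
  show ?thesis
    by (intro V.subspaceI)
      (auto simp: linear_mapsD[OF assms(1)] linear_mapsD[OF assms(2)]
        linear_maps_zero[OF assms(1,3,4)] linear_maps_zero[OF assms(2,3,4)])
qed

subsection \<open>Sums of finitely supported families\<close>

text \<open>Summing over the support keeps the index set implicit. Over an infinite support
  \<open>finsum\<close> is zero, so closure statements need no finiteness; additivity and linearity
  do.\<close>

definition fsum :: "(complex, 'a, 'm) module_scheme \<Rightarrow> ('i \<Rightarrow> 'a) \<Rightarrow> 'a" where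
  "fsum V g = (\<Oplus>\<^bsub>V\<^esub>i\<in>{i. g i \<noteq> \<zero>\<^bsub>V\<^esub>}. g i)"

context cspace
begin

lemma fsum_eq_finsum:
  assumes "finite K" "\<And>i. g i \<in> carrier V" "\<And>i. i \<notin> K \<Longrightarrow> g i = \<zero>"
  shows "fsum V g = (\<Oplus>i\<in>K. g i)"
  unfolding fsum_def
  by (rule add.finprod_mono_neutral_cong_left) (use assms in auto)

lemma fsum_closed: "(\<And>i. g i \<in> carrier V) \<Longrightarrow> fsum V g \<in> carrier V"
  unfolding fsum_def by (rule finsum_closed) auto

lemma fsum_zero: "fsum V (\<lambda>i. \<zero>) = \<zero>"
  unfolding fsum_def by simp

lemma fsum_single:
  assumes "g k \<in> carrier V" "\<And>i. i \<noteq> k \<Longrightarrow> g i = \<zero>"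
  shows "fsum V g = g k"
proof -
  have "g i \<in> carrier V" for i using assms by (cases "i = k") auto
  then have "fsum V g = (\<Oplus>i\<in>{k}. g i)" using assms(2) by (intro fsum_eq_finsum) auto
  then show ?thesis using assms(1) by simp
qed

lemma fsum_add:
  assumes "finite {i. g i \<noteq> \<zero>}" "finite {i. h i \<noteq> \<zero>}"
    "\<And>i. g i \<in> carrier V" "\<And>i. h i \<in> carrier V"
  shows "fsum V (\<lambda>i. g i \<oplus> h i) = fsum V g \<oplus> fsum V h"
proof -
  let ?K = "{i. g i \<noteq> \<zero>} \<union> {i. h i \<noteq> \<zero>}"
  have "fsum V g = (\<Oplus>i\<in>?K. g i)" "fsum V h = (\<Oplus>i\<in>?K. h i)"
    "fsum V (\<lambda>i. g i \<oplus> h i) = (\<Oplus>i\<in>?K. g i \<oplus> h i)"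
    by (rule fsum_eq_finsum; use assms in auto)+
  then show ?thesis using assms by (simp add: finsum_addf Pi_def)
qed

lemma fsum_in_subspace:
  assumes "submodule H complex_ring V" "\<And>i. g i \<in> H"
  shows "fsum V g \<in> H"
proof -
  have *: "finite K \<Longrightarrow> (\<Oplus>i\<in>K. g i) \<in> H" for K
  proof (induction K rule: finite_induct)
    case empty
    then show ?case using subspaceD[OF assms(1)] by simp
  next
    case (insert k K)
    have g: "g i \<in> carrier V" for i using subspaceD(1)[OF assms(1)] assms(2) by auto
    have "(\<Oplus>i\<in>insert k K. g i) = g k \<oplus> (\<Oplus>i\<in>K. g i)"
      using insert(1,2) g by (intro finsum_insert) auto
    then show ?case using insert(3) assms subspaceD(3) by simp
  qed
  show ?thesis
  proof (cases "finite {i. g i \<noteq> \<zero>}")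
    case False
    then show ?thesis unfolding fsum_def using subspaceD(2)[OF assms(1)] by simp
  qed (simp add: * fsum_def)
qed

end

lemma linear_maps_finsum:
  assumes "\<phi> \<in> linear_maps V W" "cspace V" "cspace W" "finite K" "\<And>i. i \<in> K \<Longrightarrow> g i \<in> carrier V"
  shows "\<phi> (\<Oplus>\<^bsub>V\<^esub>i\<in>K. g i) = (\<Oplus>\<^bsub>W\<^esub>i\<in>K. \<phi> (g i))"
proof -
  interpret V: cspace V by fact
  interpret W: cspace W by fact
  show ?thesis
    using assms(4,5)
  proof (induction K rule: finite_induct)
    case empty
    then show ?case using linear_maps_zero[OF assms(1-3)] by simp
  next
    case (insert k K)
    then have "g \<in> K \<rightarrow> carrier V" "(\<lambda>i. \<phi> (g i)) \<in> K \<rightarrow> carrier W"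
      using linear_mapsD(1)[OF assms(1)] by auto
    then show ?case using insert by (simp add: linear_mapsD[OF assms(1)])
  qed
qed

lemma linear_maps_fsum:
  assumes "\<phi> \<in> linear_maps V W" "cspace V" "cspace W"
    "finite {i. g i \<noteq> \<zero>\<^bsub>V\<^esub>}" "\<And>i. g i \<in> carrier V"
  shows "\<phi> (fsum V g) = fsum W (\<lambda>i. \<phi> (g i))"
proof -
  interpret W: cspace W by fact
  have "fsum W (\<lambda>i. \<phi> (g i)) = (\<Oplus>\<^bsub>W\<^esub>i\<in>{i. g i \<noteq> \<zero>\<^bsub>V\<^esub>}. \<phi> (g i))"
    by (rule W.fsum_eq_finsum)
      (use assms linear_maps_zero[OF assms(1-3)] linear_mapsD(1)[OF assms(1)] in auto)
  then show ?thesis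
    unfolding fsum_def[of V] using assms by (simp add: linear_maps_finsum)
qed

text \<open>One finite \<open>K\<close> serves all arguments. The complementary case, where the
  support varies with the argument, is \<open>linear_maps_direct_sum_lift\<close>;
  \<open>bilinear_direct_sum\<close> needs both.\<close>

lemma linear_maps_family_fsum:
  assumes "cspace W" "finite K" "\<And>i. F i \<in> linear_maps V W"
    "\<And>i x. \<lbrakk>i \<notin> K; x \<in> carrier V\<rbrakk> \<Longrightarrow> F i x = \<zero>\<^bsub>W\<^esub>"
  shows "(\<lambda>x. fsum W (\<lambda>i. F i x)) \<in> linear_maps V W"
proof -
  interpret W: cspace W by fact
  note lin = linear_mapsD[OF assms(3)]
  have fin: "finite {i. F i x \<noteq> \<zero>\<^bsub>W\<^esub>}" if "x \<in> carrier V" for x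
    by (rule finite_subset[OF _ assms(2)]) (use assms(4) that in auto)
  show ?thesis
  proof (rule linear_mapsI)
    fix c x assume x: "x \<in> carrier V"
    have "c \<odot>\<^bsub>W\<^esub> fsum W (\<lambda>i. F i x) = fsum W (\<lambda>i. c \<odot>\<^bsub>W\<^esub> F i x)"
      using x by (intro linear_maps_fsum linear_maps_smult linear_maps_id fin lin(1) assms(1))
    then show "fsum W (\<lambda>i. F i (c \<odot>\<^bsub>V\<^esub> x)) = c \<odot>\<^bsub>W\<^esub> fsum W (\<lambda>i. F i x)" using x by (simp add: lin)
  qed (simp_all add: lin fin W.fsum_closed W.fsum_add)
qed

section \<open>Quotients and tensor products\<close>

context cspace
begin

lemma abelian_subgroup_subspace: "submodule N complex_ring V \<Longrightarrow> abelian_subgroup N V"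
  by (intro abelian_subgroupI3 additive_subgroupI abelian_group_axioms)
    (simp add: submodule_def)

lemma coset_eqI:
  assumes "submodule N complex_ring V" "y \<in> carrier V" "h \<in> N"
  shows "N +> (h \<oplus> y) = N +> y"
proof -
  interpret N: abelian_subgroup N V by (rule abelian_subgroup_subspace) fact
  show ?thesis
    by (rule N.a_repr_independence'[symmetric]) (use assms in \<open>auto simp: a_r_coset_def'\<close>)
qed

lemma coset_elem:
  assumes "submodule N complex_ring V" "x \<in> carrier V" "y \<in> N +> x"
  obtains h where "h \<in> N" "y = h \<oplus> x"
  using assms by (auto simp: a_r_coset_def')

lemma coset_self: "\<lbrakk>submodule N complex_ring V; x \<in> carrier V\<rbrakk> \<Longrightarrow> x \<in> N +> x"
  using abelian_subgroup.a_rcos_self[OF abelian_subgroup_subspace] .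

text \<open>This is what makes the choice of a representative in \<open>tensor_lift\<close>
  harmless.\<close>

lemma linear_maps_coset:
  assumes "submodule N complex_ring V" "\<phi> \<in> linear_maps V Z" "cspace Z"
    "\<And>h. h \<in> N \<Longrightarrow> \<phi> h = \<zero>\<^bsub>Z\<^esub>" "x \<in> carrier V" "y \<in> N +> x"
  shows "\<phi> y = \<phi> x"
proof -
  interpret Z: cspace Z by fact
  obtain h where "h \<in> N" "y = h \<oplus> x" using coset_elem assms by blast
  then show ?thesis
    using assms(4,5) subspaceD(1)[OF assms(1)] linear_mapsD[OF assms(2)] by (auto simp: subset_iff)
qed

lemma quotient_space_ops:
  assumes N: "submodule N complex_ring V"
  shows "carrier (quotient_space V N) = (\<lambda>x. N +> x) ` carrier V"
    and "\<And>x y. \<lbrakk>x \<in> carrier V; y \<in> carrier V\<rbrakk> \<Longrightarrow>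
      (N +> x) \<oplus>\<^bsub>quotient_space V N\<^esub> (N +> y) = N +> (x \<oplus> y)"
    and "\<And>c x. x \<in> carrier V \<Longrightarrow> c \<odot>\<^bsub>quotient_space V N\<^esub> (N +> x) = N +> (c \<odot> x)"
    and "\<zero>\<^bsub>quotient_space V N\<^esub> = N +> \<zero>"
proof -
  interpret N: abelian_subgroup N V by (rule abelian_subgroup_subspace) fact
  note D = subspaceD[OF N]
  show "carrier (quotient_space V N) = (\<lambda>x. N +> x) ` carrier V"
    by (auto simp: quotient_space_def A_RCOSETS_def')
  show "\<zero>\<^bsub>quotient_space V N\<^esub> = N +> \<zero>"
    using D(1) by (simp add: quotient_space_def)
  show "(N +> x) \<oplus>\<^bsub>quotient_space V N\<^esub> (N +> y) = N +> (x \<oplus> y)"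
    if "x \<in> carrier V" "y \<in> carrier V" for x y
    using that by (simp add: quotient_space_def N.a_rcos_sum)
  show "c \<odot>\<^bsub>quotient_space V N\<^esub> (N +> x) = N +> (c \<odot> x)" if x: "x \<in> carrier V" for c x
  proof -
    \<comment> \<open>The scalar multiple of a coset is defined as a union over all its
      representatives. Each contributes the same coset, because c \<odot> y and c \<odot> x differ
      by c \<odot> h in \<open>N\<close>.\<close>
    have "N +> (c \<odot> y) = N +> (c \<odot> x)" if y: "y \<in> N +> x" for y
    proof -
      obtain h where h: "h \<in> N" "y = h \<oplus> x" using coset_elem[OF N x y] by blast
      moreover have "h \<in> carrier V" using h D(1) by blast
      ultimately have "c \<odot> y = c \<odot> h \<oplus> c \<odot> x" using x by (simp add: smult_add_right)
      then show ?thesis using coset_eqI[OF N, of "c \<odot> x" "c \<odot> h"] D(4)[OF h(1)] x by simp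
    qed
    then have "(\<Union>y\<in>N +> x. N +> (c \<odot> y)) = (\<Union>y\<in>N +> x. N +> (c \<odot> x))" by (rule SUP_cong[OF refl])
    \<comment> \<open>A constant union has the expected value only over a nonempty index set; x
      itself belongs to it.\<close>
    also have "\<dots> = N +> (c \<odot> x)" using coset_self[OF N x] by blast
    finally show ?thesis by (simp add: quotient_space_def)
  qed
qed

lemma cspace_quotient: "submodule N complex_ring V \<Longrightarrow> cspace (quotient_space V N)"
  by (rule cspace_surj[OF cspace_axioms, where q = "\<lambda>x. N +> x"])
    (simp_all add: quotient_space_ops)

lemma linear_maps_quotient:
  "submodule N complex_ring V \<Longrightarrow> (\<lambda>x. N +> x) \<in> linear_maps V (quotient_space V N)"
  by (rule linear_mapsI) (simp_all add: quotient_space_ops)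

end

subsection \<open>Free vector spaces\<close>

lemma lookup_map_times [simp]:
  "Poly_Mapping.lookup (Poly_Mapping.map ((*) c) v) k = c * Poly_Mapping.lookup v k"
  for c :: complex
  by (simp add: Poly_Mapping.map.rep_eq when_def)

lemma map_times_single [simp]:
  "Poly_Mapping.map ((*) c) (Poly_Mapping.single p d) = Poly_Mapping.single p (c * d)"
  for c :: complex
  by (rule poly_mapping_eqI) (simp add: lookup_single when_def)

lemma free_space_simps [simp]:
  "carrier (free_space Y) = {v. Poly_Mapping.keys v \<subseteq> Y}" "\<zero>\<^bsub>free_space Y\<^esub> = 0"
  "add (free_space Y) = (+)" "smult (free_space Y) = (\<lambda>c. Poly_Mapping.map ((*) c))"
  by (simp_all add: free_space_def)

lemma cspace_free: "cspace (free_space (Y :: 'x set))"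
proof (rule cspaceI)
  fix x y :: "'x \<Rightarrow>\<^sub>0 complex" and c
  assume x: "x \<in> carrier (free_space Y)"
  show "c \<odot>\<^bsub>free_space Y\<^esub> x \<in> carrier (free_space Y)"
    using x by (auto simp: in_keys_iff subset_iff)
  assume "y \<in> carrier (free_space Y)"
  then show "x \<oplus>\<^bsub>free_space Y\<^esub> y \<in> carrier (free_space Y)"
    using x Poly_Mapping.keys_add[of x y] by auto
qed (auto intro!: poly_mapping_eqI simp: lookup_add algebra_simps)

text \<open>The generators of the relations use the subtraction of the type, whereas linearity over
  the record \<open>free_space\<close> speaks of sums and multiples.\<close>

lemma diff_conv_map: "u - v = u + Poly_Mapping.map ((*) (- 1)) v" for v :: "'x \<Rightarrow>\<^sub>0 complex"
  by (rule poly_mapping_eqI) (simp add: lookup_add lookup_minus)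

lemma keys_diff_subset:
  "\<lbrakk>Poly_Mapping.keys u \<subseteq> Y; Poly_Mapping.keys v \<subseteq> Y\<rbrakk> \<Longrightarrow> Poly_Mapping.keys (u - v) \<subseteq> Y"
  for v :: "'x \<Rightarrow>\<^sub>0 complex"
  using cspace.smult_closed[OF cspace_free, of v Y "-1"]
    abelian_monoid.a_closed[of "free_space Y" u "Poly_Mapping.map ((*) (- 1)) v"]
    cspace.axioms(1)[OF cspace_free, of Y]
  by (simp add: diff_conv_map abelian_group_def)

lemma finsum_free_space:
  assumes "finite K" "\<And>k. k \<in> K \<Longrightarrow> Poly_Mapping.keys (f k) \<subseteq> Y"
  shows "(\<Oplus>\<^bsub>free_space Y\<^esub>k\<in>K. f k) = sum f K"
proof -
  interpret F: cspace "free_space Y" by (rule cspace_free)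
  show ?thesis using assms by (induction K rule: finite_induct) (simp_all add: Pi_def)
qed

definition free_lift :: "(complex, 'a, 'm) module_scheme \<Rightarrow> ('x \<Rightarrow> 'a) \<Rightarrow> ('x \<Rightarrow>\<^sub>0 complex) \<Rightarrow> 'a" where
  "free_lift Z g v = (\<Oplus>\<^bsub>Z\<^esub>p\<in>Poly_Mapping.keys v. Poly_Mapping.lookup v p \<odot>\<^bsub>Z\<^esub> g p)"

context cspace
begin

lemma free_lift_eq:
  assumes "\<And>p. p \<in> K \<Longrightarrow> g p \<in> carrier V" "finite K" "Poly_Mapping.keys v \<subseteq> K"
  shows "free_lift V g v = (\<Oplus>p\<in>K. Poly_Mapping.lookup v p \<odot> g p)"
  unfolding free_lift_def
  by (rule add.finprod_mono_neutral_cong_left) (use assms in \<open>auto simp: in_keys_iff\<close>)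

lemma free_lift_single: "g p \<in> carrier V \<Longrightarrow> free_lift V g (Poly_Mapping.single p c) = c \<odot> g p"
  using free_lift_eq[of "{p}" g "Poly_Mapping.single p c"] by simp

lemma linear_maps_free_lift:
  assumes g: "\<And>p. p \<in> Y \<Longrightarrow> g p \<in> carrier V"
  shows "free_lift V g \<in> linear_maps (free_space Y) V"
proof (rule linear_mapsI)
  interpret F: cspace "free_space Y" by (rule cspace_free)
  fix u assume u: "u \<in> carrier (free_space Y)"
  show "free_lift V g u \<in> carrier V"
    unfolding free_lift_def using u g by (intro finsum_closed) auto
  show "free_lift V g (c \<odot>\<^bsub>free_space Y\<^esub> u) = c \<odot> free_lift V g u" for c
  proof -
    have "free_lift V g (Poly_Mapping.map ((*) c) u) =
        (\<Oplus>p\<in>Poly_Mapping.keys u. Poly_Mapping.lookup (Poly_Mapping.map ((*) c) u) p \<odot> g p)"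
      using u g by (intro free_lift_eq) (auto simp: in_keys_iff)
    also have "\<dots> = (\<Oplus>p\<in>Poly_Mapping.keys u. c \<odot> (Poly_Mapping.lookup u p \<odot> g p))"
      using u g by (intro finsum_cong') (auto simp: smult_smult subset_iff)
    also have "\<dots> = c \<odot> free_lift V g u"
      unfolding free_lift_def using u g
      by (intro linear_maps_finsum[symmetric] linear_maps_smult linear_maps_id cspace_axioms) auto
    finally show ?thesis by simp
  qed
  fix v assume v: "v \<in> carrier (free_space Y)"
  \<comment> \<open>Cancellation can make the keys of u + v smaller than this union, so all three
    sums are taken over the union.\<close>
  let ?K = "Poly_Mapping.keys u \<union> Poly_Mapping.keys v"
  have K: "p \<in> ?K \<Longrightarrow> g p \<in> carrier V" for p using u v g by auto
  have "free_lift V g (u + v) = (\<Oplus>p\<in>?K. Poly_Mapping.lookup (u + v) p \<odot> g p)"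
    using K Poly_Mapping.keys_add[of u v] by (intro free_lift_eq) auto
  also have "\<dots> = (\<Oplus>p\<in>?K. Poly_Mapping.lookup u p \<odot> g p \<oplus> Poly_Mapping.lookup v p \<odot> g p)"
    using K by (intro finsum_cong') (auto simp: smult_add_left lookup_add)
  also have "\<dots> = free_lift V g u \<oplus> free_lift V g v"
    using K by (subst (1 2) free_lift_eq[where K = ?K]) (auto intro!: finsum_addf)
  finally show "free_lift V g (u \<oplus>\<^bsub>free_space Y\<^esub> v) = free_lift V g u \<oplus> free_lift V g v" by simp
qed

end

lemma linear_maps_free_diff:
  assumes "\<phi> \<in> linear_maps (free_space Y) Z" "cspace Z"
    "Poly_Mapping.keys u \<subseteq> Y" "Poly_Mapping.keys v \<subseteq> Y"
  shows "\<phi> (u - v) = \<phi> u \<ominus>\<^bsub>Z\<^esub> \<phi> v"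
proof -
  interpret Z: cspace Z by fact
  interpret F: cspace "free_space Y" by (rule cspace_free)
  have "\<phi> (u \<oplus>\<^bsub>free_space Y\<^esub> (- 1) \<odot>\<^bsub>free_space Y\<^esub> v) = \<phi> u \<ominus>\<^bsub>Z\<^esub> \<phi> v"
    using linear_mapsD[OF assms(1)] F.smult_closed[of v] assms(3,4)
    by (simp add: Z.minus_eq Z.minus_eq_smult del: free_space_simps(3,4))
  then show ?thesis by (simp add: diff_conv_map)
qed

subsection \<open>The universal property of the tensor product\<close>

definition bilinear_map :: "(complex, 'a, 'm) module_scheme \<Rightarrow> (complex, 'b, 'n) module_scheme \<Rightarrow>
    (complex, 'c, 'k) module_scheme \<Rightarrow> ('a \<Rightarrow> 'b \<Rightarrow> 'c) \<Rightarrow> bool" where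
  "bilinear_map V W Z \<beta> \<longleftrightarrow> (\<forall>a\<in>carrier V. (\<lambda>b. \<beta> a b) \<in> linear_maps W Z) \<and>
    (\<forall>b\<in>carrier W. (\<lambda>a. \<beta> a b) \<in> linear_maps V Z)"

lemma bilinear_mapI:
  assumes "\<And>a. a \<in> carrier V \<Longrightarrow> (\<lambda>b. \<beta> a b) \<in> linear_maps W Z"
    "\<And>b. b \<in> carrier W \<Longrightarrow> (\<lambda>a. \<beta> a b) \<in> linear_maps V Z"
  shows "bilinear_map V W Z \<beta>"
  using assms unfolding bilinear_map_def by blast

lemma bilinear_mapD:
  assumes "bilinear_map V W Z \<beta>"
  shows "\<And>a. a \<in> carrier V \<Longrightarrow> (\<lambda>b. \<beta> a b) \<in> linear_maps W Z"
    "\<And>b. b \<in> carrier W \<Longrightarrow> (\<lambda>a. \<beta> a b) \<in> linear_maps V Z"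
    "\<And>a b. \<lbrakk>a \<in> carrier V; b \<in> carrier W\<rbrakk> \<Longrightarrow> \<beta> a b \<in> carrier Z"
  using assms unfolding bilinear_map_def by (blast dest: linear_mapsD(1))+

lemma bilinear_map_comp:
  assumes "bilinear_map V' W' Z' \<beta>" "\<phi> \<in> linear_maps V V'" "\<psi> \<in> linear_maps W W'"
    "\<theta> \<in> linear_maps Z' Z"
  shows "bilinear_map V W Z (\<lambda>a b. \<theta> (\<beta> (\<phi> a) (\<psi> b)))"
proof (rule bilinear_mapI)
  fix a assume "a \<in> carrier V"
  then have "(\<lambda>b. \<beta> (\<phi> a) (\<psi> b)) \<in> linear_maps W Z'"
    by (intro linear_maps_comp[OF assms(3)] bilinear_mapD(1)[OF assms(1)] linear_mapsD(1)[OF assms(2)])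
  then show "(\<lambda>b. \<theta> (\<beta> (\<phi> a) (\<psi> b))) \<in> linear_maps W Z"
    by (rule linear_maps_comp[OF _ assms(4)])
next
  fix b assume "b \<in> carrier W"
  then have "(\<lambda>a. \<beta> (\<phi> a) (\<psi> b)) \<in> linear_maps V Z'"
    by (intro linear_maps_comp[OF assms(2), where \<psi> = "\<lambda>a. \<beta> a (\<psi> b)"]
        bilinear_mapD(2)[OF assms(1)] linear_mapsD(1)[OF assms(3)])
  then show "(\<lambda>a. \<theta> (\<beta> (\<phi> a) (\<psi> b))) \<in> linear_maps V Z"
    by (rule linear_maps_comp[OF _ assms(4)])
qed

text \<open>The linear extension of \<beta> to formal combinations, evaluated at an arbitrary
  representative of the class. For bilinear \<beta> compatible with the relations the choice does
  not matter, by \<open>tensor_lift_class\<close>.\<close>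

definition tensor_lift :: "(complex, 'c, 'k) module_scheme \<Rightarrow> ('a \<Rightarrow> 'b \<Rightarrow> 'c) \<Rightarrow>
    ('a \<times> 'b \<Rightarrow>\<^sub>0 complex) set \<Rightarrow> 'c" where
  "tensor_lift Z \<beta> Y = free_lift Z (\<lambda>(a, b). \<beta> a b) (SOME v. v \<in> Y)"

text \<open>The relations are a parameter, so that balancing over the middle action in a summand of
  \<open>\<otimes>\<^sub>T\<close> and over both actions in \<open>\<otimes>\<^sub>H\<close> become
  two instances of one theory.\<close>

locale tensor_space = V: cspace V + W: cspace W
  for V :: "(complex, 'a, 'm) module_scheme" and W :: "(complex, 'b, 'n) module_scheme" +
  fixes R :: "(('a \<times> 'b) \<times> ('a \<times> 'b)) set"
  assumes relations_closed: "R \<subseteq> (carrier V \<times> carrier W) \<times> (carrier V \<times> carrier W)"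
begin

abbreviation "F \<equiv> free_space (carrier V \<times> carrier W)"
abbreviation "N \<equiv> tensor_relations V W R"
abbreviation "T \<equiv> tensor_mod V W R"
abbreviation "pure \<equiv> pure_tensor V W R"

sublocale F: cspace F by (rule cspace_free)

lemma generators_closed:
  "bilinear_relations V W \<union> {free_gen p - free_gen q | p q. (p, q) \<in> R} \<subseteq> carrier F"
proof
  fix v assume "v \<in> bilinear_relations V W \<union> {free_gen p - free_gen q | p q. (p, q) \<in> R}"
  then show "v \<in> carrier F"
    unfolding bilinear_relations_def free_space_simps mem_Collect_eq using relations_closed
    by (elim UnE CollectE exE conjE; hypsubst; intro keys_diff_subset) auto
qed

lemma subspace_relations: "submodule N complex_ring F"
  unfolding tensor_relations_def by (rule F.subspace_subspace_span[OF generators_closed])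

sublocale T: cspace T
  unfolding tensor_mod_def by (rule F.cspace_quotient[OF subspace_relations])

lemma linear_maps_class: "tensor_class V W R \<in> linear_maps F T"
  using F.linear_maps_quotient[OF subspace_relations]
  by (simp add: tensor_class_def[abs_def] tensor_mod_def)

lemma carrier_tensor: "carrier T = tensor_class V W R ` carrier F"
  using F.quotient_space_ops(1)[OF subspace_relations]
  by (simp add: tensor_class_def[abs_def] tensor_mod_def)

lemma class_eqI:
  assumes "u - v \<in> N" "v \<in> carrier F"
  shows "tensor_class V W R u = tensor_class V W R v"
  using F.coset_eqI[OF subspace_relations assms(2,1)] by (simp add: tensor_class_def)

lemma class_single:
  assumes "a \<in> carrier V" "b \<in> carrier W"
  shows "tensor_class V W R (Poly_Mapping.single (a, b) c) = c \<odot>\<^bsub>T\<^esub> pure a b"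
  using linear_mapsD(3)[OF linear_maps_class, of "free_gen (a, b)" c] assms
  by (simp add: pure_tensor_def)

lemma pure_closed [simp, intro]:
  "\<lbrakk>a \<in> carrier V; b \<in> carrier W\<rbrakk> \<Longrightarrow> pure a b \<in> carrier T"
  unfolding pure_tensor_def by (rule linear_mapsD(1)[OF linear_maps_class]) simp

lemma generators_subset:
  "bilinear_relations V W \<union> {free_gen p - free_gen q | p q. (p, q) \<in> R} \<subseteq> N"
  unfolding tensor_relations_def by (rule subspace_span_superset)

lemma pure_relation:
  assumes "((a, b), (a', b')) \<in> R"
  shows "pure a b = pure a' b'"
  unfolding pure_tensor_def
proof (rule class_eqI)
  show "free_gen (a, b) - free_gen (a', b') \<in> N"
    using assms by (intro subsetD[OF generators_subset]) blast
qed (use assms relations_closed in auto)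

lemma bilinear_pure: "bilinear_map V W T pure"
proof (intro bilinear_mapI linear_mapsI)
  fix a b assume ab: "a \<in> carrier V" "b \<in> carrier W"
  show "pure a b \<in> carrier T" "pure a b \<in> carrier T" using ab by simp_all
  have "free_gen (c \<odot>\<^bsub>V\<^esub> a, b) - Poly_Mapping.single (a, b) c \<in> N"
    "free_gen (a, c \<odot>\<^bsub>W\<^esub> b) - Poly_Mapping.single (a, b) c \<in> N" for c
    by (rule subsetD[OF generators_subset], unfold bilinear_relations_def, use ab in blast)+
  then show "pure (c \<odot>\<^bsub>V\<^esub> a) b = c \<odot>\<^bsub>T\<^esub> pure a b"
    "pure a (c \<odot>\<^bsub>W\<^esub> b) = c \<odot>\<^bsub>T\<^esub> pure a b" for c
    by (subst class_single[OF ab, symmetric], subst pure_tensor_def, intro class_eqI,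
        use ab in simp_all)+
  have sum: "tensor_class V W R (free_gen (a, b) + free_gen (a', b')) = pure a b \<oplus>\<^bsub>T\<^esub> pure a' b'"
    if "a' \<in> carrier V" "b' \<in> carrier W" for a' b'
    using linear_mapsD(2)[OF linear_maps_class, of "free_gen (a, b)" "free_gen (a', b')"] ab that
    by (simp add: pure_tensor_def)
  have closed: "free_gen (a, b) + free_gen (a', b') \<in> carrier F"
    if "a' \<in> carrier V" "b' \<in> carrier W" for a' b'
    using F.a_closed[of "free_gen (a, b)" "free_gen (a', b')"] ab that by simp
  {
    fix a' assume a': "a' \<in> carrier V"
    have "free_gen (a \<oplus>\<^bsub>V\<^esub> a', b) - free_gen (a, b) - free_gen (a', b) \<in> N"
      by (rule subsetD[OF generators_subset], unfold bilinear_relations_def, use ab a' in blast)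
    then have "tensor_class V W R (free_gen (a \<oplus>\<^bsub>V\<^esub> a', b)) =
        tensor_class V W R (free_gen (a, b) + free_gen (a', b))"
      using ab a' by (intro class_eqI closed) (simp_all add: diff_diff_eq)
    then show "pure (a \<oplus>\<^bsub>V\<^esub> a') b = pure a b \<oplus>\<^bsub>T\<^esub> pure a' b"
      using sum[OF a' ab(2)] by (simp add: pure_tensor_def)
  next
    fix b' assume b': "b' \<in> carrier W"
    have "free_gen (a, b \<oplus>\<^bsub>W\<^esub> b') - free_gen (a, b) - free_gen (a, b') \<in> N"
      by (rule subsetD[OF generators_subset], unfold bilinear_relations_def, use ab b' in blast)
    then have "tensor_class V W R (free_gen (a, b \<oplus>\<^bsub>W\<^esub> b')) =
        tensor_class V W R (free_gen (a, b) + free_gen (a, b'))"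
      using ab b' by (intro class_eqI closed) (simp_all add: diff_diff_eq)
    then show "pure a (b \<oplus>\<^bsub>W\<^esub> b') = pure a b \<oplus>\<^bsub>T\<^esub> pure a b'"
      using sum[OF ab(1) b'] by (simp add: pure_tensor_def)
  }
qed

text \<open>A formal combination is the sum of its terms and taking classes is linear. Hence every
  element of \<open>T\<close> is a finite combination of pure tensors, on which
  \<open>tensor_induct\<close> rests.\<close>

lemma class_eq_free_lift:
  assumes "v \<in> carrier F"
  shows "tensor_class V W R v = free_lift T (\<lambda>(a, b). pure a b) v"
proof -
  let ?s = "\<lambda>p. Poly_Mapping.single p (Poly_Mapping.lookup v p)"
  have "tensor_class V W R (\<Oplus>\<^bsub>F\<^esub>p\<in>Poly_Mapping.keys v. ?s p) =
      (\<Oplus>\<^bsub>T\<^esub>p\<in>Poly_Mapping.keys v. tensor_class V W R (?s p))"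
    using assms
    by (intro linear_maps_finsum[OF linear_maps_class] F.cspace_axioms T.cspace_axioms) auto
  also have "(\<Oplus>\<^bsub>F\<^esub>p\<in>Poly_Mapping.keys v. ?s p) = v"
    using assms by (subst finsum_free_space) (auto intro!: poly_mapping_eqI simp: lookup_sum lookup_single when_def sum.delta in_keys_iff)
  also have "(\<Oplus>\<^bsub>T\<^esub>p\<in>Poly_Mapping.keys v. tensor_class V W R (?s p)) =
      free_lift T (\<lambda>(a, b). pure a b) v"
    unfolding free_lift_def using assms
    by (intro T.finsum_cong') (auto simp: class_single Pi_def subset_iff split: prod.splits)
  finally show ?thesis .
qed

lemma tensor_induct:
  assumes H: "submodule H complex_ring T"
    "\<And>a b. \<lbrakk>a \<in> carrier V; b \<in> carrier W\<rbrakk> \<Longrightarrow> pure a b \<in> H"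
    and "t \<in> carrier T"
  shows "t \<in> H"
proof -
  obtain v where v: "v \<in> carrier F" "t = tensor_class V W R v"
    using assms(3) carrier_tensor by blast
  interpret H: cspace "T\<lparr>carrier := H\<rparr>" by (rule T.cspace_subspace) fact
  have "(\<lambda>p. Poly_Mapping.lookup v p \<odot>\<^bsub>T\<^esub> (case p of (a, b) \<Rightarrow> pure a b)) \<in>
    Poly_Mapping.keys v \<rightarrow> H"
    using v H(2) T.subspaceD(4)[OF H(1)] by (auto simp: subset_iff split: prod.splits)
  moreover have "(\<Oplus>\<^bsub>T\<^esub>p\<in>K. g p) \<in> H" if "finite K" "g \<in> K \<rightarrow> H" for K and g :: "'a \<times> 'b \<Rightarrow> _"
    using that
  proof (induction K rule: finite_induct)
    case (insert k K)
    then have "(\<Oplus>\<^bsub>T\<^esub>p\<in>insert k K. g p) = g k \<oplus>\<^bsub>T\<^esub> (\<Oplus>\<^bsub>T\<^esub>p\<in>K. g p)"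
      using T.subspaceD(1)[OF H(1)] by (intro T.finsum_insert) auto
    then show ?case using insert T.subspaceD(3)[OF H(1)] by simp
  qed (use T.subspaceD(2)[OF H(1)] in simp)
  ultimately show ?thesis
    unfolding v(2) class_eq_free_lift[OF v(1)] free_lift_def by simp
qed

lemma linear_maps_eqI:
  assumes "\<phi> \<in> linear_maps T Z" "\<psi> \<in> linear_maps T Z" "cspace Z"
    "\<And>a b. \<lbrakk>a \<in> carrier V; b \<in> carrier W\<rbrakk> \<Longrightarrow> \<phi> (pure a b) = \<psi> (pure a b)"
    "t \<in> carrier T"
  shows "\<phi> t = \<psi> t"
  using tensor_induct[OF subspace_equalizer[OF assms(1,2) T.cspace_axioms assms(3)] _ assms(5)]
    assms(4) by simp

section \<open>Lifting a compatible bilinear map to the tensor product\<close>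

context
  fixes Z :: "(complex, 'c, 'k) module_scheme" and \<beta> :: "'a \<Rightarrow> 'b \<Rightarrow> 'c"
  assumes Z: "cspace Z" and \<beta>: "bilinear_map V W Z \<beta>"
    and compatible: "\<And>a b a' b'. ((a, b), (a', b')) \<in> R \<Longrightarrow> \<beta> a b = \<beta> a' b'"
begin

interpretation Z: cspace Z by (rule Z)

lemma free_lift_linear: "free_lift Z (\<lambda>(a, b). \<beta> a b) \<in> linear_maps F Z"
  by (rule Z.linear_maps_free_lift) (auto intro: bilinear_mapD(3)[OF \<beta>])

text \<open>The kernel of the extension is a subspace, so the generators of \<open>N\<close>
  suffice: bilinearity of \<beta> kills the four bilinear families, compatibility kills the
  differences coming from \<open>R\<close>.\<close>

lemma free_lift_relations:
  assumes "h \<in> N"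
  shows "free_lift Z (\<lambda>(a, b). \<beta> a b) h = \<zero>\<^bsub>Z\<^esub>"
proof -
  let ?l = "free_lift Z (\<lambda>(a, b). \<beta> a b)"
  note diff = linear_maps_free_diff[OF free_lift_linear Z]
  have single: "?l (Poly_Mapping.single (a, b) c) = c \<odot>\<^bsub>Z\<^esub> \<beta> a b"
    if "a \<in> carrier V" "b \<in> carrier W" for a b c
    using that by (subst Z.free_lift_single) (auto intro: bilinear_mapD(3)[OF \<beta>])
  note lin = linear_mapsD[OF bilinear_mapD(1)[OF \<beta>]] linear_mapsD[OF bilinear_mapD(2)[OF \<beta>]]
  have closed: "\<beta> a b \<in> carrier Z" if "a \<in> carrier V" "b \<in> carrier W" for a b
    by (rule bilinear_mapD(3)[OF \<beta> that])
  have cancel: "y \<in> carrier Z \<Longrightarrow> x \<oplus>\<^bsub>Z\<^esub> y \<ominus>\<^bsub>Z\<^esub> x \<ominus>\<^bsub>Z\<^esub> y = \<zero>\<^bsub>Z\<^esub>" "x \<ominus>\<^bsub>Z\<^esub> x = \<zero>\<^bsub>Z\<^esub>"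
    if "x \<in> carrier Z" for x y
  proof -
    show "x \<ominus>\<^bsub>Z\<^esub> x = \<zero>\<^bsub>Z\<^esub>" using that by (simp add: Z.minus_eq Z.r_neg)
    assume y: "y \<in> carrier Z"
    have "x \<oplus>\<^bsub>Z\<^esub> y \<ominus>\<^bsub>Z\<^esub> x \<ominus>\<^bsub>Z\<^esub> y = (x \<oplus>\<^bsub>Z\<^esub> \<ominus>\<^bsub>Z\<^esub> x) \<oplus>\<^bsub>Z\<^esub> (y \<oplus>\<^bsub>Z\<^esub> \<ominus>\<^bsub>Z\<^esub> y)"
      using that y by (simp add: Z.minus_eq Z.a_ac)
    then show "x \<oplus>\<^bsub>Z\<^esub> y \<ominus>\<^bsub>Z\<^esub> x \<ominus>\<^bsub>Z\<^esub> y = \<zero>\<^bsub>Z\<^esub>" using that y by (simp add: Z.r_neg)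
  qed
  have "bilinear_relations V W \<union> {free_gen p - free_gen q | p q. (p, q) \<in> R} \<subseteq>
      {v \<in> carrier F. ?l v \<in> {\<zero>\<^bsub>Z\<^esub>}}"
  proof
    fix v assume v: "v \<in> bilinear_relations V W \<union> {free_gen p - free_gen q | p q. (p, q) \<in> R}"
    then have "v \<in> carrier F" using generators_closed by blast
    moreover have "?l v = \<zero>\<^bsub>Z\<^esub>"
      using v
    proof
      assume "v \<in> bilinear_relations V W"
      then show ?thesis
        unfolding bilinear_relations_def
        by (auto simp: diff single lin cancel closed keys_diff_subset)
    next
      assume "v \<in> {free_gen p - free_gen q | p q. (p, q) \<in> R}"
      then obtain a b a' b' where "v = free_gen (a, b) - free_gen (a', b')" "((a, b), (a', b')) \<in> R"
        by auto
      moreover from this have "a \<in> carrier V" "b \<in> carrier W" "a' \<in> carrier V" "b' \<in> carrier W"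
        using relations_closed by auto
      ultimately show ?thesis using compatible[of a b a' b'] by (simp add: diff single lin cancel closed)
    qed
    ultimately show "v \<in> {v \<in> carrier F. ?l v \<in> {\<zero>\<^bsub>Z\<^esub>}}" by simp
  qed
  then have "N \<subseteq> {v \<in> carrier F. ?l v \<in> {\<zero>\<^bsub>Z\<^esub>}}"
    unfolding tensor_relations_def
    by (intro subspace_span_least subspace_vimage[OF free_lift_linear]
        F.cspace_axioms Z Z.subspace_zero)
  then show ?thesis using assms by blast
qed

lemma free_lift_class:
  assumes "v \<in> carrier F" "u \<in> tensor_class V W R v"
  shows "free_lift Z (\<lambda>(a, b). \<beta> a b) u = free_lift Z (\<lambda>(a, b). \<beta> a b) v"
  by (rule F.linear_maps_coset[OF subspace_relations free_lift_linear Z free_lift_relations assms(1)])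
    (use assms(2) in \<open>simp_all add: tensor_class_def\<close>)

lemma tensor_lift_class:
  assumes "v \<in> carrier F"
  shows "tensor_lift Z \<beta> (tensor_class V W R v) = free_lift Z (\<lambda>(a, b). \<beta> a b) v"
proof -
  have "v \<in> tensor_class V W R v"
    using F.coset_self[OF subspace_relations assms] by (simp add: tensor_class_def)
  then have "(SOME u. u \<in> tensor_class V W R v) \<in> tensor_class V W R v" by (rule someI)
  then show ?thesis unfolding tensor_lift_def using free_lift_class[OF assms] by blast
qed

lemma linear_maps_tensor_lift: "tensor_lift Z \<beta> \<in> linear_maps T Z"
proof (rule linear_mapsI)
  note cl = linear_mapsD[OF linear_maps_class] and fl = linear_mapsD[OF free_lift_linear]
  fix s assume "s \<in> carrier T"
  then obtain u where u: "u \<in> carrier F" "s = tensor_class V W R u" using carrier_tensor by blast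
  show "tensor_lift Z \<beta> s \<in> carrier Z" unfolding u(2) using fl(1) u(1) by (simp add: tensor_lift_class)
  have "c \<odot>\<^bsub>T\<^esub> s = tensor_class V W R (c \<odot>\<^bsub>F\<^esub> u)" for c using cl(3)[OF u(1)] u(2) by simp
  then show "tensor_lift Z \<beta> (c \<odot>\<^bsub>T\<^esub> s) = c \<odot>\<^bsub>Z\<^esub> tensor_lift Z \<beta> s" for c
    using fl(3)[OF u(1)] u F.smult_closed[OF u(1)]
    by (simp add: tensor_lift_class del: free_space_simps)
  fix t assume "t \<in> carrier T"
  then obtain v where v: "v \<in> carrier F" "t = tensor_class V W R v" using carrier_tensor by blast
  have "s \<oplus>\<^bsub>T\<^esub> t = tensor_class V W R (u \<oplus>\<^bsub>F\<^esub> v)" using cl(2)[OF u(1) v(1)] u(2) v(2) by simp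
  then show "tensor_lift Z \<beta> (s \<oplus>\<^bsub>T\<^esub> t) = tensor_lift Z \<beta> s \<oplus>\<^bsub>Z\<^esub> tensor_lift Z \<beta> t"
    using fl(2)[OF u(1) v(1)] u v F.a_closed[OF u(1) v(1)]
    by (simp add: tensor_lift_class del: free_space_simps)
qed

lemma tensor_lift_pure:
  "\<lbrakk>a \<in> carrier V; b \<in> carrier W\<rbrakk> \<Longrightarrow> tensor_lift Z \<beta> (pure a b) = \<beta> a b"
  unfolding pure_tensor_def using bilinear_mapD(3)[OF \<beta>]
  by (simp add: tensor_lift_class Z.free_lift_single)

end

section \<open>The endomorphism \<phi> \<otimes> \<psi>\<close>

context
  fixes \<phi> \<psi>
  assumes \<phi>: "\<phi> \<in> linear_maps V V" and \<psi>: "\<psi> \<in> linear_maps W W"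
    and compatible: "\<And>a b a' b'. ((a, b), (a', b')) \<in> R \<Longrightarrow> pure (\<phi> a) (\<psi> b) = pure (\<phi> a') (\<psi> b')"
begin

lemma bilinear_pure_maps: "bilinear_map V W T (\<lambda>a b. pure (\<phi> a) (\<psi> b))"
  using bilinear_map_comp[OF bilinear_pure \<phi> \<psi> linear_maps_id] .

text \<open>\<open>tensor_map\<close> is a union of classes over all representatives. Each of them
  yields the same class, the value of the lift, so the union can be replaced by the universal
  property once and for all.\<close>

lemma tensor_map_eq_lift:
  assumes "t \<in> carrier T"
  shows "tensor_map V W R \<phi> \<psi> t = tensor_lift T (\<lambda>a b. pure (\<phi> a) (\<psi> b)) t"
proof -
  obtain w where w: "w \<in> carrier F" "t = tensor_class V W R w" using assms carrier_tensor by blast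
  have *: "tensor_class V W R (\<Sum>(a, b)\<in>Poly_Mapping.keys v.
      Poly_Mapping.single (\<phi> a, \<psi> b) (Poly_Mapping.lookup v (a, b))) =
    tensor_lift T (\<lambda>a b. pure (\<phi> a) (\<psi> b)) t" if v: "v \<in> t" for v
  proof -
    \<comment> \<open>Different keys may be mapped to the same pair, so the terms are kept apart and
      only added after passing to classes.\<close>
    let ?s = "\<lambda>(a, b). Poly_Mapping.single (\<phi> a, \<psi> b) (Poly_Mapping.lookup v (a, b))"
    obtain h where "h \<in> N" "v = h \<oplus>\<^bsub>F\<^esub> w"
      using F.coset_elem[OF subspace_relations w(1)] v w(2) by (auto simp: tensor_class_def)
    then have vF: "v \<in> carrier F"
      using F.subspaceD(1)[OF subspace_relations] w(1) F.a_closed by blast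
    have s: "?s p \<in> carrier F" if "p \<in> Poly_Mapping.keys v" for p
      using that vF linear_mapsD(1)[OF \<phi>] linear_mapsD(1)[OF \<psi>]
      by (auto simp: subset_iff split: prod.splits if_splits)
    have "tensor_class V W R (\<Oplus>\<^bsub>F\<^esub>p\<in>Poly_Mapping.keys v. ?s p) =
        (\<Oplus>\<^bsub>T\<^esub>p\<in>Poly_Mapping.keys v. tensor_class V W R (?s p))"
      using s by (intro linear_maps_finsum[OF linear_maps_class] F.cspace_axioms T.cspace_axioms) auto
    also have "(\<Oplus>\<^bsub>F\<^esub>p\<in>Poly_Mapping.keys v. ?s p) = sum ?s (Poly_Mapping.keys v)"
      using s by (intro finsum_free_space) auto
    also have "(\<Oplus>\<^bsub>T\<^esub>p\<in>Poly_Mapping.keys v. tensor_class V W R (?s p)) =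
        free_lift T (\<lambda>(a, b). pure (\<phi> a) (\<psi> b)) v"
      unfolding free_lift_def using vF linear_mapsD(1)[OF \<phi>] linear_mapsD(1)[OF \<psi>]
      by (intro T.finsum_cong') (auto simp: class_single Pi_def subset_iff split: prod.splits)
    also have "\<dots> = tensor_lift T (\<lambda>a b. pure (\<phi> a) (\<psi> b)) t"
      unfolding w(2)
      using free_lift_class[OF T.cspace_axioms bilinear_pure_maps compatible w(1)] v w
        tensor_lift_class[OF T.cspace_axioms bilinear_pure_maps compatible w(1)]
      by metis
    finally show ?thesis .
  qed
  \<comment> \<open>The union over the representatives collapses to its constant value because there
    is at least one of them.\<close>
  moreover have "w \<in> t"
    using F.coset_self[OF subspace_relations w(1)] w(2) by (simp add: tensor_class_def)
  ultimately show ?thesis unfolding tensor_map_def by auto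
qed

lemma linear_maps_tensor_map: "tensor_map V W R \<phi> \<psi> \<in> linear_maps T T"
  by (rule linear_maps_cong[OF linear_maps_tensor_lift[OF T.cspace_axioms bilinear_pure_maps compatible]])
    (simp_all add: T.cspace_axioms tensor_map_eq_lift)

lemma tensor_map_pure:
  "\<lbrakk>a \<in> carrier V; b \<in> carrier W\<rbrakk> \<Longrightarrow> tensor_map V W R \<phi> \<psi> (pure a b) = pure (\<phi> a) (\<psi> b)"
  by (simp add: tensor_map_eq_lift tensor_lift_pure[OF T.cspace_axioms bilinear_pure_maps compatible])

end

end

section \<open>Direct sums\<close>

lemma direct_sum_simps [simp]:
  "carrier (direct_sum V) = {x. (\<forall>i. x i \<in> carrier (V i)) \<and> finite {i. x i \<noteq> \<zero>\<^bsub>V i\<^esub>}}"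
  "\<zero>\<^bsub>direct_sum V\<^esub> = (\<lambda>i. \<zero>\<^bsub>V i\<^esub>)"
  "add (direct_sum V) = (\<lambda>x y i. x i \<oplus>\<^bsub>V i\<^esub> y i)"
  "smult (direct_sum V) = (\<lambda>c x i. c \<odot>\<^bsub>V i\<^esub> x i)"
  by (simp_all add: direct_sum_def)

lemma direct_sumD:
  assumes "x \<in> carrier (direct_sum V)"
  shows "x i \<in> carrier (V i)" "finite {i. x i \<noteq> \<zero>\<^bsub>V i\<^esub>}"
  using assms by simp_all

text \<open>Linear maps send zero to zero, so the support cannot grow.\<close>

lemma direct_sum_map_closed:
  assumes "\<And>i. cspace (V i)" "\<And>i. cspace (W i)" "\<And>i. \<phi> i \<in> linear_maps (V i) (W i)"
    "x \<in> carrier (direct_sum V)"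
  shows "(\<lambda>i. \<phi> i (x i)) \<in> carrier (direct_sum W)"
proof -
  have "{i. \<phi> i (x i) \<noteq> \<zero>\<^bsub>W i\<^esub>} \<subseteq> {i. x i \<noteq> \<zero>\<^bsub>V i\<^esub>}"
    using linear_maps_zero[OF assms(3,1,2)] by auto
  then show ?thesis
    using assms(4) linear_mapsD(1)[OF assms(3)] by (auto intro: finite_subset)
qed

lemma cspace_direct_sum:
  assumes V: "\<And>i. cspace (V i)"
  shows "cspace (direct_sum V)"
proof -
  interpret V: cspace "V i" for i by (rule V)
  show ?thesis
  proof (rule cspaceI)
    fix x assume x: "x \<in> carrier (direct_sum V)"
    show "c \<odot>\<^bsub>direct_sum V\<^esub> x \<in> carrier (direct_sum V)" for c
      using direct_sum_map_closed[of V V "\<lambda>i x. c \<odot>\<^bsub>V i\<^esub> x", OF V V linear_maps_smult x]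
      by (simp add: V linear_maps_id)
    fix y assume "y \<in> carrier (direct_sum V)"
    then have "finite ({i. x i \<noteq> \<zero>\<^bsub>V i\<^esub>} \<union> {i. y i \<noteq> \<zero>\<^bsub>V i\<^esub>})"
      and y: "\<And>i. y i \<in> carrier (V i)" using x by auto
    from this(1) have "finite {i. x i \<oplus>\<^bsub>V i\<^esub> y i \<noteq> \<zero>\<^bsub>V i\<^esub>}"
      by (rule finite_subset[rotated]) auto
    then show "x \<oplus>\<^bsub>direct_sum V\<^esub> y \<in> carrier (direct_sum V)" using x y by simp
  qed (auto simp: V.a_ac V.smult_add_left V.smult_add_right V.smult_smult)
qed

lemma linear_maps_direct_sum_map:
  assumes "\<And>i. cspace (V i)" "\<And>i. cspace (W i)" "\<And>i. \<phi> i \<in> linear_maps (V i) (W i)"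
  shows "(\<lambda>x i. \<phi> i (x i)) \<in> linear_maps (direct_sum V) (direct_sum W)"
  by (rule linear_mapsI, erule direct_sum_map_closed[OF assms])
    (auto simp: linear_mapsD(2,3)[OF assms(3)])

lemma linear_maps_direct_sum_eval: "(\<lambda>x. x i) \<in> linear_maps (direct_sum V) (V i)"
  by (rule linear_mapsI) auto

lemma linear_maps_direct_sum_inj:
  assumes V: "\<And>i. cspace (V i)"
  shows "direct_sum_inj V k \<in> linear_maps (V k) (direct_sum V)"
proof (rule linear_mapsI)
  interpret V: cspace "V i" for i by (rule V)
  fix a assume a: "a \<in> carrier (V k)"
  have "finite {j. direct_sum_inj V k a j \<noteq> \<zero>\<^bsub>V j\<^esub>}"
    by (rule finite_subset[of _ "{k}"]) (auto simp: direct_sum_inj_def)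
  then show "direct_sum_inj V k a \<in> carrier (direct_sum V)"
    using a by (auto simp: direct_sum_inj_def)
  show "direct_sum_inj V k (c \<odot>\<^bsub>V k\<^esub> a) = c \<odot>\<^bsub>direct_sum V\<^esub> direct_sum_inj V k a" for c
    by (auto simp: direct_sum_inj_def)
  show "direct_sum_inj V k (a \<oplus>\<^bsub>V k\<^esub> b) =
      direct_sum_inj V k a \<oplus>\<^bsub>direct_sum V\<^esub> direct_sum_inj V k b" for b
    by (auto simp: direct_sum_inj_def)
qed

text \<open>Compared coordinate by coordinate: evaluation at j is linear, so it passes through the
  finite sum and leaves a single nonzero term at most.\<close>

lemma direct_sum_eq_fsum:
  assumes V: "\<And>i. cspace (V i)" and x: "x \<in> carrier (direct_sum V)"
  shows "x = fsum (direct_sum V) (\<lambda>i. direct_sum_inj V i (x i))"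
proof
  fix j
  note inj = linear_mapsD(1)[OF linear_maps_direct_sum_inj[of V, OF V]]
  have "finite {i. direct_sum_inj V i (x i) \<noteq> \<zero>\<^bsub>direct_sum V\<^esub>}"
    using x by (rule_tac finite_subset[of _ "{i. x i \<noteq> \<zero>\<^bsub>V i\<^esub>}"]) (auto simp: direct_sum_inj_def)
  then have "fsum (direct_sum V) (\<lambda>i. direct_sum_inj V i (x i)) j =
      fsum (V j) (\<lambda>i. direct_sum_inj V i (x i) j)"
    using x inj by (intro linear_maps_fsum[where \<phi> = "\<lambda>x. x j"] linear_maps_direct_sum_eval cspace_direct_sum V) auto
  also have "\<dots> = x j"
    using x by (subst cspace.fsum_single[OF V, where k = j]) (auto simp: direct_sum_inj_def)
  finally show "x j = fsum (direct_sum V) (\<lambda>i. direct_sum_inj V i (x i)) j" ..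
qed

lemma direct_sum_induct:
  assumes "\<And>i. cspace (V i)" "submodule H complex_ring (direct_sum V)"
    "\<And>i a. a \<in> carrier (V i) \<Longrightarrow> direct_sum_inj V i a \<in> H" "x \<in> carrier (direct_sum V)"
  shows "x \<in> H"
  by (subst direct_sum_eq_fsum[OF assms(1,4)],
      rule cspace.fsum_in_subspace[OF cspace_direct_sum[OF assms(1)] assms(2)], rule assms(3))
    (use assms(4) in simp)

lemma linear_maps_direct_sum_lift:
  assumes V: "\<And>i. cspace (V i)" and Z: "cspace Z" and F: "\<And>i. F i \<in> linear_maps (V i) Z"
  shows "(\<lambda>x. fsum Z (\<lambda>i. F i (x i))) \<in> linear_maps (direct_sum V) Z"
proof -
  interpret Z: cspace Z by fact
  note lin = linear_mapsD[OF F]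
  have fin: "finite {i. F i (x i) \<noteq> \<zero>\<^bsub>Z\<^esub>}" if "x \<in> carrier (direct_sum V)" for x
    using that linear_maps_zero[OF F V Z]
    by (rule_tac finite_subset[of _ "{i. x i \<noteq> \<zero>\<^bsub>V i\<^esub>}"]) auto
  show ?thesis
  proof (rule linear_mapsI)
    fix x y c assume x: "x \<in> carrier (direct_sum V)"
    show "fsum Z (\<lambda>i. F i (x i)) \<in> carrier Z" using x lin(1) by (intro Z.fsum_closed) auto
    have "c \<odot>\<^bsub>Z\<^esub> fsum Z (\<lambda>i. F i (x i)) = fsum Z (\<lambda>i. c \<odot>\<^bsub>Z\<^esub> F i (x i))"
      using x lin(1) by (intro linear_maps_fsum linear_maps_smult linear_maps_id fin Z) auto
    then show "fsum Z (\<lambda>i. F i ((c \<odot>\<^bsub>direct_sum V\<^esub> x) i)) = c \<odot>\<^bsub>Z\<^esub> fsum Z (\<lambda>i. F i (x i))"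
      using x lin(3) by simp
    assume y: "y \<in> carrier (direct_sum V)"
    show "fsum Z (\<lambda>i. F i ((x \<oplus>\<^bsub>direct_sum V\<^esub> y) i)) =
        fsum Z (\<lambda>i. F i (x i)) \<oplus>\<^bsub>Z\<^esub> fsum Z (\<lambda>i. F i (y i))"
      using x y lin(1,2) by (subst Z.fsum_add[symmetric, OF fin[OF x] fin[OF y]]) auto
  qed
qed

section \<open>Bilinear maps on direct sums\<close>

definition direct_sum_bilinear :: "(complex, 'c, 'k) module_scheme \<Rightarrow>
    ('i \<Rightarrow> 'j \<Rightarrow> 'a \<Rightarrow> 'b \<Rightarrow> 'c) \<Rightarrow> ('i \<Rightarrow> 'a) \<Rightarrow> ('j \<Rightarrow> 'b) \<Rightarrow> 'c" where
  "direct_sum_bilinear Z B x y = fsum Z (\<lambda>i. fsum Z (\<lambda>j. B i j (x i) (y j)))"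

context
  fixes V :: "'i \<Rightarrow> (complex, 'a, 'm) module_scheme" and W :: "'j \<Rightarrow> (complex, 'b, 'n) module_scheme"
    and Z :: "(complex, 'c, 'k) module_scheme" and B :: "'i \<Rightarrow> 'j \<Rightarrow> 'a \<Rightarrow> 'b \<Rightarrow> 'c"
  assumes V: "\<And>i. cspace (V i)" and W: "\<And>j. cspace (W j)" and Z: "cspace Z"
    and B: "\<And>i j. bilinear_map (V i) (W j) Z (B i j)"
begin

interpretation Z: cspace Z by (rule Z)
interpretation V: cspace "V i" for i by (rule V)
interpretation W: cspace "W j" for j by (rule W)

lemma bilinear_family_zero:
  "b \<in> carrier (W j) \<Longrightarrow> B i j \<zero>\<^bsub>V i\<^esub> b = \<zero>\<^bsub>Z\<^esub>"
  "a \<in> carrier (V i) \<Longrightarrow> B i j a \<zero>\<^bsub>W j\<^esub> = \<zero>\<^bsub>Z\<^esub>"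
  using linear_maps_zero[OF bilinear_mapD(1)[OF B] W Z]
    linear_maps_zero[OF bilinear_mapD(2)[OF B] V Z] by blast+

text \<open>For fixed x the outer sum is confined to the finite support of x. For fixed y the inner
  sums are confined to the support of y, and the outer sum is the universal map out of the direct
  sum.\<close>

lemma bilinear_direct_sum: "bilinear_map (direct_sum V) (direct_sum W) Z (direct_sum_bilinear Z B)"
  unfolding direct_sum_bilinear_def
proof (rule bilinear_mapI)
  fix x assume x: "x \<in> carrier (direct_sum V)"
  show "(\<lambda>y. fsum Z (\<lambda>i. fsum Z (\<lambda>j. B i j (x i) (y j)))) \<in> linear_maps (direct_sum W) Z"
  proof (rule linear_maps_family_fsum[OF Z, of "{i. x i \<noteq> \<zero>\<^bsub>V i\<^esub>}"])
    show "finite {i. x i \<noteq> \<zero>\<^bsub>V i\<^esub>}" using x by simp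
    show "(\<lambda>y. fsum Z (\<lambda>j. B i j (x i) (y j))) \<in> linear_maps (direct_sum W) Z" for i
      using x by (intro linear_maps_direct_sum_lift W Z bilinear_mapD(1)[OF B]) auto
  qed (auto simp: bilinear_family_zero Z.fsum_zero)
next
  fix y assume y: "y \<in> carrier (direct_sum W)"
  show "(\<lambda>x. fsum Z (\<lambda>i. fsum Z (\<lambda>j. B i j (x i) (y j)))) \<in> linear_maps (direct_sum V) Z"
  proof (rule linear_maps_direct_sum_lift[OF V Z])
    show "(\<lambda>a. fsum Z (\<lambda>j. B i j a (y j))) \<in> linear_maps (V i) Z" for i
      using y by (intro linear_maps_family_fsum[OF Z, of "{j. y j \<noteq> \<zero>\<^bsub>W j\<^esub>}"] bilinear_mapD(2)[OF B])
        (auto simp: bilinear_family_zero)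
  qed
qed

lemma direct_sum_bilinear_inj:
  assumes "a \<in> carrier (V i)" "b \<in> carrier (W j)"
  shows "direct_sum_bilinear Z B (direct_sum_inj V i a) (direct_sum_inj W j b) = B i j a b"
proof -
  let ?x = "direct_sum_inj V i a" and ?y = "direct_sum_inj W j b"
  have x: "?x i' \<in> carrier (V i')" and y: "?y j' \<in> carrier (W j')" for i' j'
    using assms by (auto simp: direct_sum_inj_def)
  have "fsum Z (\<lambda>j'. B i' j' (?x i') (?y j')) = B i' j (?x i') (?y j)" for i'
    by (intro Z.fsum_single bilinear_mapD(3)[OF B x y]) (simp add: direct_sum_inj_def[of W] bilinear_family_zero x)
  then have "direct_sum_bilinear Z B ?x ?y = fsum Z (\<lambda>i'. B i' j (?x i') (?y j))"
    by (simp add: direct_sum_bilinear_def)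
  also have "\<dots> = B i j (?x i) (?y j)"
    by (intro Z.fsum_single bilinear_mapD(3)[OF B x y]) (simp add: direct_sum_inj_def[of V] bilinear_family_zero y)
  finally show ?thesis by (simp add: direct_sum_inj_def)
qed

lemma linear_maps_direct_sum_bilinear:
  assumes "\<phi> \<in> linear_maps Z Z'" "cspace Z'" "x \<in> carrier (direct_sum V)" "y \<in> carrier (direct_sum W)"
  shows "\<phi> (direct_sum_bilinear Z B x y) = direct_sum_bilinear Z' (\<lambda>i j a b. \<phi> (B i j a b)) x y"
proof -
  have xy: "B i j (x i) (y j) \<in> carrier Z" for i j
    using bilinear_mapD(3)[OF B] assms(3,4) by simp
  have "finite {j. B i j (x i) (y j) \<noteq> \<zero>\<^bsub>Z\<^esub>}" for i
    using assms(3,4) by (rule_tac finite_subset[of _ "{j. y j \<noteq> \<zero>\<^bsub>W j\<^esub>}"]) (auto simp: bilinear_family_zero)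
  then have *: "\<phi> (fsum Z (\<lambda>j. B i j (x i) (y j))) = fsum Z' (\<lambda>j. \<phi> (B i j (x i) (y j)))" for i
    by (intro linear_maps_fsum assms Z xy)
  have "finite {i. fsum Z (\<lambda>j. B i j (x i) (y j)) \<noteq> \<zero>\<^bsub>Z\<^esub>}"
    using assms(3,4) by (rule_tac finite_subset[of _ "{i. x i \<noteq> \<zero>\<^bsub>V i\<^esub>}"]) (auto simp: bilinear_family_zero Z.fsum_zero)
  then have "\<phi> (direct_sum_bilinear Z B x y) = fsum Z' (\<lambda>i. \<phi> (fsum Z (\<lambda>j. B i j (x i) (y j))))"
    unfolding direct_sum_bilinear_def by (intro linear_maps_fsum assms Z Z.fsum_closed xy)
  then show ?thesis by (simp add: direct_sum_bilinear_def *)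
qed

end

section \<open>Actions of the field of meromorphic functions\<close>

lemma left_actionI:
  assumes "\<And>f. \<mu> f \<in> linear_maps V V"
    "\<And>f g a. a \<in> carrier V \<Longrightarrow> \<mu> (f + g) a = \<mu> f a \<oplus>\<^bsub>V\<^esub> \<mu> g a"
    "\<And>f g a. a \<in> carrier V \<Longrightarrow> \<mu> (f * g) a = \<mu> f (\<mu> g a)"
    "\<And>c a. a \<in> carrier V \<Longrightarrow> \<mu> (const_mero c) a = c \<odot>\<^bsub>V\<^esub> a"
  shows "left_action V \<mu>"
  using assms unfolding left_action_def by blast

lemma left_actionD:
  assumes "left_action V \<mu>"
  shows "\<And>f. \<mu> f \<in> linear_maps V V"
    "\<And>f g a. a \<in> carrier V \<Longrightarrow> \<mu> (f + g) a = \<mu> f a \<oplus>\<^bsub>V\<^esub> \<mu> g a"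
    "\<And>f g a. a \<in> carrier V \<Longrightarrow> \<mu> (f * g) a = \<mu> f (\<mu> g a)"
    "\<And>c a. a \<in> carrier V \<Longrightarrow> \<mu> (const_mero c) a = c \<odot>\<^bsub>V\<^esub> a"
  using assms unfolding left_action_def by blast+

lemma left_action_subspace:
  assumes "left_action V \<mu>" "H \<subseteq> carrier V" "\<And>f a. a \<in> H \<Longrightarrow> \<mu> f a \<in> H"
  shows "left_action (V\<lparr>carrier := H\<rparr>) \<mu>"
  by (intro left_actionI linear_maps_restrict)
    (use assms left_actionD[OF assms(1)] in \<open>auto simp: subset_iff\<close>)

lemma left_action_direct_sum:
  assumes "\<And>i. cspace (V i)" "\<And>i. left_action (V i) (\<mu> i)"
  shows "left_action (direct_sum V) (\<lambda>f x i. \<mu> i f (x i))"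
  by (intro left_actionI linear_maps_direct_sum_map assms(1) left_actionD(1)[OF assms(2)])
    (auto simp: left_actionD[OF assms(2)])

context tensor_space
begin

lemma tensor_map_left:
  assumes "\<phi> \<in> linear_maps V V"
    and "\<And>a b a' b'. ((a, b), (a', b')) \<in> R \<Longrightarrow> pure (\<phi> a) b = pure (\<phi> a') b'"
  shows "tensor_map V W R \<phi> id \<in> linear_maps T T"
    and "\<And>a b. \<lbrakk>a \<in> carrier V; b \<in> carrier W\<rbrakk> \<Longrightarrow> tensor_map V W R \<phi> id (pure a b) = pure (\<phi> a) b"
proof -
  have id: "id \<in> linear_maps W W" by (rule linear_mapsI) simp_all
  have compat: "pure (\<phi> a) (id b) = pure (\<phi> a') (id b')" if "((a, b), (a', b')) \<in> R" for a b a' b'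
    using assms(2) that by simp
  show "tensor_map V W R \<phi> id \<in> linear_maps T T"
    by (rule linear_maps_tensor_map[OF assms(1) id compat])
  show "tensor_map V W R \<phi> id (pure a b) = pure (\<phi> a) b"
    if "a \<in> carrier V" "b \<in> carrier W" for a b
    by (subst tensor_map_pure[OF assms(1) id compat that]) simp_all
qed

lemma tensor_map_right:
  assumes "\<psi> \<in> linear_maps W W"
    and "\<And>a b a' b'. ((a, b), (a', b')) \<in> R \<Longrightarrow> pure a (\<psi> b) = pure a' (\<psi> b')"
  shows "tensor_map V W R id \<psi> \<in> linear_maps T T"
    and "\<And>a b. \<lbrakk>a \<in> carrier V; b \<in> carrier W\<rbrakk> \<Longrightarrow> tensor_map V W R id \<psi> (pure a b) = pure a (\<psi> b)"
proof -
  have id: "id \<in> linear_maps V V" by (rule linear_mapsI) simp_all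
  have compat: "pure (id a) (\<psi> b) = pure (id a') (\<psi> b')" if "((a, b), (a', b')) \<in> R" for a b a' b'
    using assms(2) that by simp
  show "tensor_map V W R id \<psi> \<in> linear_maps T T"
    by (rule linear_maps_tensor_map[OF id assms(1) compat])
  show "tensor_map V W R id \<psi> (pure a b) = pure a (\<psi> b)"
    if "a \<in> carrier V" "b \<in> carrier W" for a b
    by (subst tensor_map_pure[OF id assms(1) compat that]) simp_all
qed

text \<open>Every axiom of an action equates two linear maps on \<open>T\<close>, so it is read off
  on pure tensors from the axiom for \<mu>.\<close>

lemma left_action_tensor_left:
  assumes \<mu>: "left_action V \<mu>"
    and "\<And>f a b a' b'. ((a, b), (a', b')) \<in> R \<Longrightarrow> pure (\<mu> f a) b = pure (\<mu> f a') b'"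
  shows "left_action T (\<lambda>f. tensor_map V W R (\<mu> f) id)"
proof -
  have lin: "tensor_map V W R (\<mu> f) id \<in> linear_maps T T" for f
    by (rule tensor_map_left(1)[OF left_actionD(1)[OF \<mu>] assms(2)])
  have [simp]: "tensor_map V W R (\<mu> f) id (pure a b) = pure (\<mu> f a) b"
    if "a \<in> carrier V" "b \<in> carrier W" for f a b
    by (rule tensor_map_left(2)[OF left_actionD(1)[OF \<mu>] assms(2) that])
  note [simp] = linear_mapsD(1)[OF left_actionD(1)[OF \<mu>]] linear_mapsD[OF bilinear_mapD(2)[OF bilinear_pure]]
    left_actionD[OF \<mu>]
  show ?thesis
  proof (rule left_actionI)
    show "tensor_map V W R (\<mu> f) id \<in> linear_maps T T" for f by (rule lin)
    fix f g c t assume t: "t \<in> carrier T"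
    show "tensor_map V W R (\<mu> (f + g)) id t =
        tensor_map V W R (\<mu> f) id t \<oplus>\<^bsub>T\<^esub> tensor_map V W R (\<mu> g) id t"
      by (rule linear_maps_eqI[OF lin linear_maps_add[OF T.cspace_axioms lin lin] T.cspace_axioms _ t])
        simp
    show "tensor_map V W R (\<mu> (f * g)) id t =
        tensor_map V W R (\<mu> f) id (tensor_map V W R (\<mu> g) id t)"
      by (rule linear_maps_eqI[OF lin linear_maps_comp[OF lin lin] T.cspace_axioms _ t]) simp
    show "tensor_map V W R (\<mu> (const_mero c)) id t = c \<odot>\<^bsub>T\<^esub> t"
      by (rule linear_maps_eqI[OF lin linear_maps_smult[OF T.cspace_axioms linear_maps_id]
          T.cspace_axioms _ t]) simp
  qed
qed

lemma left_action_tensor_right: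
  assumes \<mu>: "left_action W \<mu>"
    and "\<And>f a b a' b'. ((a, b), (a', b')) \<in> R \<Longrightarrow> pure a (\<mu> f b) = pure a' (\<mu> f b')"
  shows "left_action T (\<lambda>f. tensor_map V W R id (\<mu> f))"
proof -
  have lin: "tensor_map V W R id (\<mu> f) \<in> linear_maps T T" for f
    by (rule tensor_map_right(1)[OF left_actionD(1)[OF \<mu>] assms(2)])
  have [simp]: "tensor_map V W R id (\<mu> f) (pure a b) = pure a (\<mu> f b)"
    if "a \<in> carrier V" "b \<in> carrier W" for f a b
    by (rule tensor_map_right(2)[OF left_actionD(1)[OF \<mu>] assms(2) that])
  note [simp] = linear_mapsD(1)[OF left_actionD(1)[OF \<mu>]] linear_mapsD[OF bilinear_mapD(1)[OF bilinear_pure]]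
    left_actionD[OF \<mu>]
  show ?thesis
  proof (rule left_actionI)
    show "tensor_map V W R id (\<mu> f) \<in> linear_maps T T" for f by (rule lin)
    fix f g c t assume t: "t \<in> carrier T"
    show "tensor_map V W R id (\<mu> (f + g)) t =
        tensor_map V W R id (\<mu> f) t \<oplus>\<^bsub>T\<^esub> tensor_map V W R id (\<mu> g) t"
      by (rule linear_maps_eqI[OF lin linear_maps_add[OF T.cspace_axioms lin lin] T.cspace_axioms _ t])
        simp
    show "tensor_map V W R id (\<mu> (f * g)) t =
        tensor_map V W R id (\<mu> f) (tensor_map V W R id (\<mu> g) t)"
      by (rule linear_maps_eqI[OF lin linear_maps_comp[OF lin lin] T.cspace_axioms _ t]) simp
    show "tensor_map V W R id (\<mu> (const_mero c)) t = c \<odot>\<^bsub>T\<^esub> t"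
      by (rule linear_maps_eqI[OF lin linear_maps_smult[OF T.cspace_axioms linear_maps_id]
          T.cspace_axioms _ t]) simp
  qed
qed

end

section \<open>Prealgebras and their homogeneous components\<close>

text \<open>Decompositions become elements of the direct sum of the graded parts, so that the theory
  of direct sums applies to components.\<close>

lemma decomposition_iff: "decomposition A a x \<longleftrightarrow>
    x \<in> carrier (direct_sum (\<lambda>p. homogeneous_part A (fst p) (snd p))) \<and> a = fsum A x"
  by (simp add: decomposition_def fsum_def split_paired_All)

locale prealg_space =
  fixes A :: "('a, 'h::fd_commutative_lie_algebra, 'm) prealg_scheme" (structure)
  assumes prealgebra: "prealgebra A"
begin

sublocale cspace A
  using prealgebra by (simp add: prealgebra_def cspace_iff_module)

lemma subspace_grade: "submodule (grade A \<alpha> \<beta>) complex_ring A"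
  and ex1_decomposition: "a \<in> carrier A \<Longrightarrow> \<exists>!x. decomposition A a x"
  and left_action_mu_l: "left_action A (mu_l A)"
  and left_action_mu_r: "left_action A (mu_r A)"
  and mu_l_grade: "a \<in> grade A \<alpha> \<beta> \<Longrightarrow> mu_l A f a \<in> grade A \<alpha> \<beta>"
  and mu_r_grade: "a \<in> grade A \<alpha> \<beta> \<Longrightarrow> mu_r A f a \<in> grade A \<alpha> \<beta>"
  and mu_l_mu_r: "a \<in> carrier A \<Longrightarrow> mu_l A f (mu_r A g a) = mu_r A g (mu_l A f a)"
  using prealgebra by (simp_all add: prealgebra_def)

lemmas linear_mu_l = left_actionD(1)[OF left_action_mu_l]
  and linear_mu_r = left_actionD(1)[OF left_action_mu_r]

lemmas mu_l_closed [simp] = linear_mapsD(1)[OF linear_mu_l]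
  and mu_r_closed [simp] = linear_mapsD(1)[OF linear_mu_r]

text \<open>The field is commutative. This is needed when a left action on the first factor has to
  respect a relation of \<open>\<otimes>\<^sub>H\<close> that involves the same action.\<close>

lemma mu_l_mu_l: "a \<in> carrier A \<Longrightarrow> mu_l A f (mu_l A g a) = mu_l A g (mu_l A f a)"
  and mu_r_mu_r: "a \<in> carrier A \<Longrightarrow> mu_r A f (mu_r A g a) = mu_r A g (mu_r A f a)"
  by (metis left_action_mu_l left_actionD(3) mult.commute)
    (metis left_action_mu_r left_actionD(3) mult.commute)

lemma grade_closed [intro]: "a \<in> grade A \<alpha> \<beta> \<Longrightarrow> a \<in> carrier A"
  using subspaceD(1)[OF subspace_grade] by blast

lemma cspace_grade: "cspace (homogeneous_part A \<alpha> \<beta>)"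
  by (rule cspace_subspace[OF subspace_grade])

lemma zero_grade: "\<zero> \<in> grade A \<alpha> \<beta>"
  by (rule subspaceD(2)[OF subspace_grade])

section \<open>Homogeneous components and the right actions\<close>

lemma component_eqI: "\<lbrakk>decomposition A a x; a \<in> carrier A\<rbrakk> \<Longrightarrow> component A a = x"
  unfolding component_def using ex1_decomposition by (blast intro: the1_equality)

lemma decomposition_component: "a \<in> carrier A \<Longrightarrow> decomposition A a (component A a)"
  unfolding component_def using ex1_decomposition by (rule theI')

abbreviation "homogeneous_parts \<equiv> \<lambda>p. homogeneous_part A (fst p) (snd p)"

lemma component_closed: "a \<in> carrier A \<Longrightarrow> component A a \<in> carrier (direct_sum homogeneous_parts)"
  by (erule decomposition_component[unfolded decomposition_iff, THEN conjunct1])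

lemma component_sum: "a \<in> carrier A \<Longrightarrow> fsum A (component A a) = a"
  by (erule decomposition_component[unfolded decomposition_iff, THEN conjunct2, symmetric])

lemma component_grade: "a \<in> carrier A \<Longrightarrow> component A a p \<in> grade A (fst p) (snd p)"
  and finite_component: "a \<in> carrier A \<Longrightarrow> finite {p. component A a p \<noteq> \<zero>}"
  using direct_sumD[OF component_closed] by simp_all

lemma component_in_carrier [simp]: "a \<in> carrier A \<Longrightarrow> component A a p \<in> carrier A"
  using component_grade by blast

lemma component_fsum:
  assumes "x \<in> carrier (direct_sum homogeneous_parts)"
  shows "component A (fsum A x) = x"
  using assms by (intro component_eqI) (auto simp: decomposition_iff intro!: fsum_closed)

text \<open>Summation is a linear map from the direct sum of the graded parts, and
  \<open>component\<close> inverts it by the uniqueness of decompositions.\<close>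

lemma linear_component: "component A \<in> linear_maps A (direct_sum homogeneous_parts)"
proof (rule linear_mapsI)
  note D = cspace_direct_sum[of homogeneous_parts, OF cspace_grade]
  interpret D: cspace "direct_sum homogeneous_parts" by (rule D)
  have incl: "(\<lambda>x. fsum A (\<lambda>p. x p)) \<in> linear_maps (direct_sum homogeneous_parts) A"
    by (intro linear_maps_direct_sum_lift cspace_grade cspace_axioms
        linear_maps_restrict_domain[OF linear_maps_id] subspaceD(1)[OF subspace_grade])
  note incl = linear_mapsD[OF incl]
  fix a assume a: "a \<in> carrier A"
  show "component A a \<in> carrier (direct_sum homogeneous_parts)" using a by (rule component_closed)
  show "component A (c \<odot> a) = c \<odot>\<^bsub>direct_sum homogeneous_parts\<^esub> component A a" for c
    using component_fsum[OF D.smult_closed[OF component_closed[OF a]], of c]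
      incl(3)[OF component_closed[OF a], of c] component_sum[OF a] by simp
  fix b assume b: "b \<in> carrier A"
  show "component A (a \<oplus> b) = component A a \<oplus>\<^bsub>direct_sum homogeneous_parts\<^esub> component A b"
    using component_fsum[OF D.a_closed[OF component_closed[OF a] component_closed[OF b]]]
      incl(2)[OF component_closed[OF a] component_closed[OF b]] component_sum[OF a] component_sum[OF b]
    by simp
qed

lemma component_homogeneous:
  assumes "a \<in> grade A \<alpha> \<beta>"
  shows "component A a = direct_sum_inj homogeneous_parts (\<alpha>, \<beta>) a"
proof -
  let ?x = "direct_sum_inj homogeneous_parts (\<alpha>, \<beta>) a"
  have "?x \<in> carrier (direct_sum homogeneous_parts)"
    by (rule linear_mapsD(1)[OF linear_maps_direct_sum_inj]) (use assms cspace_grade in auto)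
  moreover have "fsum A ?x = a"
    using assms by (subst fsum_single[where k = "(\<alpha>, \<beta>)"]) (auto simp: direct_sum_inj_def)
  ultimately show ?thesis using component_fsum[of ?x] by simp
qed

context
  fixes \<phi> assumes \<phi>: "\<And>p. \<phi> p \<in> linear_maps A A"
    and \<phi>_grade: "\<And>p a. a \<in> grade A (fst p) (snd p) \<Longrightarrow> \<phi> p a \<in> grade A (fst p) (snd p)"
begin

text \<open>The maps may depend on the bidegree, as they do in the right actions, where the shift is
  determined by the degree.\<close>

lemma map_component_closed:
  "a \<in> carrier A \<Longrightarrow> (\<lambda>p. \<phi> p (component A a p)) \<in> carrier (direct_sum homogeneous_parts)"
  by (intro direct_sum_map_closed[OF cspace_grade cspace_grade _ component_closed]
      linear_maps_restrict[OF \<phi>] subspaceD(1)[OF subspace_grade] \<phi>_grade)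

text \<open>The right actions sum over the support of \<open>component A a\<close>, which can exceed
  the support of the summands, for instance when the function is zero.\<close>

lemma map_component_eq_fsum:
  assumes "a \<in> carrier A"
  shows "(\<Oplus>p\<in>{p. component A a p \<noteq> \<zero>}. \<phi> p (component A a p)) = fsum A (\<lambda>p. \<phi> p (component A a p))"
  using finite_component[OF assms] linear_maps_zero[OF \<phi> cspace_axioms cspace_axioms] assms
  by (intro fsum_eq_finsum[symmetric]) (simp_all add: linear_mapsD(1)[OF \<phi>])

lemmas component_map = component_fsum[OF map_component_closed]

end

text \<open>Applying \<phi> termwise to the decomposition of a gives a decomposition of \<phi> a,
  and there is only one.\<close>

lemma component_linear_map:
  assumes "\<phi> \<in> linear_maps A A" "\<And>\<alpha> \<beta> a. a \<in> grade A \<alpha> \<beta> \<Longrightarrow> \<phi> a \<in> grade A \<alpha> \<beta>" "a \<in> carrier A"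
  shows "component A (\<phi> a) = (\<lambda>p. \<phi> (component A a p))"
proof -
  have "\<phi> a = \<phi> (fsum A (component A a))" using component_sum[OF assms(3)] by simp
  also have "\<dots> = fsum A (\<lambda>p. \<phi> (component A a p))"
    using component_grade[OF assms(3)]
    by (intro linear_maps_fsum assms(1) cspace_axioms finite_component[OF assms(3)]) auto
  finally show ?thesis using component_map[of "\<lambda>_. \<phi>", OF assms(1) assms(2) assms(3)] by simp
qed

lemma component_mu_l: "a \<in> carrier A \<Longrightarrow> component A (mu_l A f a) p = mu_l A f (component A a p)"
  by (rule fun_cong[OF component_linear_map[OF linear_mu_l mu_l_grade]])

lemma component_mu_r: "a \<in> carrier A \<Longrightarrow> component A (mu_r A f a) p = mu_r A f (component A a p)"
  by (rule fun_cong[OF component_linear_map[OF linear_mu_r mu_r_grade]])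

lemma mu_l_right_eq_fsum:
  "a \<in> carrier A \<Longrightarrow> mu_l_right A a f = fsum A (\<lambda>p. mu_l A (shift_mero (- fst p) f) (component A a p))"
  and component_mu_l_right:
  "a \<in> carrier A \<Longrightarrow> component A (mu_l_right A a f) p = mu_l A (shift_mero (- fst p) f) (component A a p)"
  using map_component_eq_fsum[of "\<lambda>p. mu_l A (shift_mero (- fst p) f)", OF linear_mu_l mu_l_grade]
    component_map[of "\<lambda>p. mu_l A (shift_mero (- fst p) f)", OF linear_mu_l mu_l_grade]
  by (simp_all add: mu_l_right_def)

lemma mu_r_right_eq_fsum:
  "a \<in> carrier A \<Longrightarrow> mu_r_right A a f = fsum A (\<lambda>p. mu_r A (shift_mero (- snd p) f) (component A a p))"
  and component_mu_r_right:
  "a \<in> carrier A \<Longrightarrow> component A (mu_r_right A a f) p = mu_r A (shift_mero (- snd p) f) (component A a p)"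
  using map_component_eq_fsum[of "\<lambda>p. mu_r A (shift_mero (- snd p) f)", OF linear_mu_r mu_r_grade]
    component_map[of "\<lambda>p. mu_r A (shift_mero (- snd p) f)", OF linear_mu_r mu_r_grade]
  by (simp_all add: mu_r_right_def)

lemma mu_l_right_closed [simp]: "a \<in> carrier A \<Longrightarrow> mu_l_right A a f \<in> carrier A"
  and mu_r_right_closed [simp]: "a \<in> carrier A \<Longrightarrow> mu_r_right A a f \<in> carrier A"
  by (simp_all add: mu_l_right_eq_fsum mu_r_right_eq_fsum fsum_closed)

lemma mu_l_right_homogeneous:
  assumes "a \<in> grade A \<alpha> \<beta>"
  shows "mu_l_right A a f = mu_l A (shift_mero (- \<alpha>) f) a"
    "mu_r_right A a f = mu_r A (shift_mero (- \<beta>) f) a"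
proof -
  have a: "a \<in> carrier A" using assms by blast
  show "mu_l_right A a f = mu_l A (shift_mero (- \<alpha>) f) a"
    using a linear_maps_zero[OF linear_mu_l cspace_axioms cspace_axioms]
    by (subst mu_l_right_eq_fsum, simp, subst fsum_single[where k = "(\<alpha>, \<beta>)"])
      (auto simp: component_homogeneous[OF assms] direct_sum_inj_def)
  show "mu_r_right A a f = mu_r A (shift_mero (- \<beta>) f) a"
    using a linear_maps_zero[OF linear_mu_r cspace_axioms cspace_axioms]
    by (subst mu_r_right_eq_fsum, simp, subst fsum_single[where k = "(\<alpha>, \<beta>)"])
      (auto simp: component_homogeneous[OF assms] direct_sum_inj_def)
qed

text \<open>On each component the right actions are left actions of a shifted function, and \<phi>
  leaves the degree that determines the shift unchanged.\<close>

lemma commute_right: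
  assumes "\<phi> \<in> linear_maps A A" "\<And>\<alpha> \<beta> a. a \<in> grade A \<alpha> \<beta> \<Longrightarrow> \<phi> a \<in> grade A \<alpha> \<beta>" "a \<in> carrier A"
  shows "(\<And>f a. a \<in> carrier A \<Longrightarrow> \<phi> (mu_l A f a) = mu_l A f (\<phi> a)) \<Longrightarrow>
      \<phi> (mu_l_right A a f) = mu_l_right A (\<phi> a) f"
    "(\<And>f a. a \<in> carrier A \<Longrightarrow> \<phi> (mu_r A f a) = mu_r A f (\<phi> a)) \<Longrightarrow>
      \<phi> (mu_r_right A a f) = mu_r_right A (\<phi> a) f"
proof -
  note a = assms(3)
  have \<phi>a: "\<phi> a \<in> carrier A" by (rule linear_mapsD(1)[OF assms(1) a])
  have fin: "finite {p. mu p (component A a p) \<noteq> \<zero>}" if "\<And>p. mu p \<in> linear_maps A A" for mu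
    by (rule finite_subset[OF _ finite_component[OF a]])
      (use linear_maps_zero[OF that cspace_axioms cspace_axioms] in auto)
  {
    assume "\<And>f a. a \<in> carrier A \<Longrightarrow> \<phi> (mu_l A f a) = mu_l A f (\<phi> a)"
    then show "\<phi> (mu_l_right A a f) = mu_l_right A (\<phi> a) f"
      using linear_maps_fsum[OF assms(1) cspace_axioms cspace_axioms fin[OF linear_mu_l]]
      by (simp add: mu_l_right_eq_fsum a \<phi>a component_linear_map[OF assms])
  next
    assume "\<And>f a. a \<in> carrier A \<Longrightarrow> \<phi> (mu_r A f a) = mu_r A f (\<phi> a)"
    then show "\<phi> (mu_r_right A a f) = mu_r_right A (\<phi> a) f"
      using linear_maps_fsum[OF assms(1) cspace_axioms cspace_axioms fin[OF linear_mu_r]]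
      by (simp add: mu_r_right_eq_fsum a \<phi>a component_linear_map[OF assms])
  }
qed

end

text \<open>Projections onto the summands turn the existence of unique decompositions into an
  induction over the homogeneous elements.\<close>

context
  fixes A :: "('a, 'h::fd_commutative_lie_algebra, 'm) prealg_scheme" and \<pi>
  assumes A: "cspace A" and grade: "\<And>\<alpha> \<beta>. submodule (grade A \<alpha> \<beta>) complex_ring A"
    and span: "\<And>H. \<lbrakk>submodule H complex_ring A; \<And>\<alpha> \<beta>. grade A \<alpha> \<beta> \<subseteq> H\<rbrakk> \<Longrightarrow> carrier A \<subseteq> H"
    and \<pi>: "\<And>p. \<pi> p \<in> linear_maps A A"
    and \<pi>_same: "\<And>\<alpha> \<beta> x. x \<in> grade A \<alpha> \<beta> \<Longrightarrow> \<pi> (\<alpha>, \<beta>) x = x"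
    and \<pi>_other: "\<And>\<alpha> \<beta> p x. \<lbrakk>x \<in> grade A \<alpha> \<beta>; p \<noteq> (\<alpha>, \<beta>)\<rbrakk> \<Longrightarrow> \<pi> p x = \<zero>\<^bsub>A\<^esub>"
begin

interpretation A: cspace A by (rule A)

abbreviation (input) "parts \<equiv> \<lambda>p. homogeneous_part A (fst p) (snd p)"

text \<open>Applying \<pi> p to the sum annihilates every term except the one of bidegree p.\<close>

lemma decomposition_unique:
  assumes "decomposition A a x"
  shows "x p = \<pi> p a"
proof -
  have x: "x q \<in> grade A (fst q) (snd q)" "finite {q. x q \<noteq> \<zero>\<^bsub>A\<^esub>}" "a = fsum A x" for q
    using assms direct_sumD[of x "parts"] unfolding decomposition_iff by simp_all
  have xc: "x q \<in> carrier A" for q using x(1)[of q] A.subspaceD(1)[OF grade] by blast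
  have "\<pi> p a = fsum A (\<lambda>q. \<pi> p (x q))"
    unfolding x(3) by (rule linear_maps_fsum[OF \<pi> A A x(2) xc])
  also have "\<dots> = \<pi> p (x p)"
    by (intro A.fsum_single linear_mapsD(1)[OF \<pi> xc] \<pi>_other[OF x(1)]) simp
  also have "\<dots> = x p" using \<pi>_same[OF x(1), of p] by simp
  finally show ?thesis ..
qed

lemma decomposition_exists:
  assumes "a \<in> carrier A"
  shows "\<exists>!x. decomposition A a x" "component A a = (\<lambda>p. \<pi> p a)"
proof -
  have parts: "cspace (parts p)" for p by (rule A.cspace_subspace[OF grade])
  interpret D: cspace "direct_sum parts" by (rule cspace_direct_sum[OF parts])
  have sum: "(\<lambda>x. fsum A (\<lambda>p. x p)) \<in> linear_maps (direct_sum parts) A"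
    by (intro linear_maps_direct_sum_lift parts A linear_maps_restrict_domain[OF linear_maps_id]
        A.subspaceD(1)[OF grade])
  \<comment> \<open>The set of all sums of finitely supported homogeneous families. It is a subspace
    containing the graded parts, hence everything by \<open>span\<close>.\<close>
  let ?H = "(\<lambda>x. fsum A (\<lambda>p. x p)) ` carrier (direct_sum parts)"
  have "carrier A \<subseteq> ?H"
  proof (rule span)
    show "submodule ?H complex_ring A"
    proof (rule A.subspaceI)
      show "\<zero>\<^bsub>A\<^esub> \<in> ?H"
        by (rule image_eqI[OF _ D.zero_closed]) (use linear_maps_zero[OF sum D.cspace_axioms A] in simp)
    next
      fix a b assume "a \<in> ?H" "b \<in> ?H"
      then obtain x y where "x \<in> carrier (direct_sum parts)" "a = fsum A (\<lambda>p. x p)"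
        "y \<in> carrier (direct_sum parts)" "b = fsum A (\<lambda>p. y p)" by blast
      then show "a \<oplus>\<^bsub>A\<^esub> b \<in> ?H"
        by (intro image_eqI[OF _ D.a_closed[of x y]]) (simp_all only: linear_mapsD(2)[OF sum])
    next
      fix c a assume "a \<in> ?H"
      then obtain x where "x \<in> carrier (direct_sum parts)" "a = fsum A (\<lambda>p. x p)" by blast
      then show "c \<odot>\<^bsub>A\<^esub> a \<in> ?H"
        by (intro image_eqI[OF _ D.smult_closed[of x c]]) (simp_all only: linear_mapsD(3)[OF sum])
    qed (use linear_mapsD(1)[OF sum] in blast)
    show "grade A \<alpha> \<beta> \<subseteq> ?H" for \<alpha> \<beta>
    proof
      fix a assume a: "a \<in> grade A \<alpha> \<beta>"
      have "direct_sum_inj parts (\<alpha>, \<beta>) a \<in> carrier (direct_sum parts)"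
        by (rule linear_mapsD(1)[OF linear_maps_direct_sum_inj[OF parts]]) (use a in simp)
      moreover have "fsum A (\<lambda>p. direct_sum_inj parts (\<alpha>, \<beta>) a p) = a"
        using a A.subspaceD(1)[OF grade]
        by (subst A.fsum_single[where k = "(\<alpha>, \<beta>)"]) (auto simp: direct_sum_inj_def)
      ultimately show "a \<in> ?H" by (intro image_eqI) simp_all
    qed
  qed
  then obtain x where x: "x \<in> carrier (direct_sum parts)" "a = fsum A x" using assms by blast
  then have dec: "decomposition A a x" unfolding decomposition_iff by blast
  have unique: "y = (\<lambda>p. \<pi> p a)" if "decomposition A a y" for y
    using decomposition_unique[OF that] by (rule ext)
  show ex1: "\<exists>!x. decomposition A a x"
    by (rule ex1I, rule dec) (rule trans[OF unique unique[OF dec, symmetric]])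
  show "component A a = (\<lambda>p. \<pi> p a)"
    unfolding component_def unique[OF dec, symmetric] by (rule the1_equality, rule ex1, rule dec)
qed

end

section \<open>The tensor products are prealgebras\<close>

lemma prealgebraI:
  fixes A :: "('a, 'h::fd_commutative_lie_algebra, 'm) prealg_scheme"
  assumes "cspace A" "\<And>\<alpha> \<beta>. submodule (grade A \<alpha> \<beta>) complex_ring A"
    "\<And>a. a \<in> carrier A \<Longrightarrow> \<exists>!x. decomposition A a x"
    "left_action A (mu_l A)" "left_action A (mu_r A)"
    "\<And>f \<alpha> \<beta> a. a \<in> grade A \<alpha> \<beta> \<Longrightarrow> mu_l A f a \<in> grade A \<alpha> \<beta>"
    "\<And>f \<alpha> \<beta> a. a \<in> grade A \<alpha> \<beta> \<Longrightarrow> mu_r A f a \<in> grade A \<alpha> \<beta>"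
    "\<And>f g a. a \<in> carrier A \<Longrightarrow> mu_l A f (mu_r A g a) = mu_r A g (mu_l A f a)"
  shows "prealgebra A"
  using assms unfolding prealgebra_def cspace_iff_module by blast

text \<open>The tensor products are records that extend a module by a grading and two actions;
  subspaces have to be moved between the record and the underlying module.\<close>

lemma submodule_transfer:
  assumes "submodule H complex_ring V" "cspace V" "cspace W" "carrier W = carrier V"
    "add W = add V" "\<zero>\<^bsub>W\<^esub> = \<zero>\<^bsub>V\<^esub>" "smult W = smult V"
  shows "submodule H complex_ring W"
  using cspace.subspaceD[OF assms(2,1)] assms(4-7) by (intro cspace.subspaceI[OF assms(3)]) auto

lemma tilde_tensor_simps:
  fixes A :: "('a, 'h::fd_commutative_lie_algebra, 'm) prealg_scheme" and B :: "('b, 'h, 'n) prealg_scheme"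
  shows "carrier (A \<otimes>\<^sub>T B) = carrier (direct_sum (tilde_summand A B))"
    "add (A \<otimes>\<^sub>T B) = add (direct_sum (tilde_summand A B))"
    "\<zero>\<^bsub>A \<otimes>\<^sub>T B\<^esub> = \<zero>\<^bsub>direct_sum (tilde_summand A B)\<^esub>"
    "smult (A \<otimes>\<^sub>T B) = smult (direct_sum (tilde_summand A B))"
    "grade (A \<otimes>\<^sub>T B) = (\<lambda>\<alpha> \<beta>. {x \<in> carrier (direct_sum (tilde_summand A B)).
      \<forall>\<alpha>' \<gamma> \<beta>'. (\<alpha>', \<beta>') \<noteq> (\<alpha>, \<beta>) \<longrightarrow> x (\<alpha>', \<gamma>, \<beta>') = \<zero>\<^bsub>tilde_summand A B (\<alpha>', \<gamma>, \<beta>')\<^esub>})"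
    "mu_l (A \<otimes>\<^sub>T B) = (\<lambda>f x i. tilde_map A B (mu_l A f) id i (x i))"
    "mu_r (A \<otimes>\<^sub>T B) = (\<lambda>f x i. tilde_map A B id (mu_r B f) i (x i))"
  by (simp_all add: tilde_tensor_def module.defs prealg.defs del: direct_sum_simps)

lemma hat_tensor_simps:
  fixes A :: "('a, 'h::fd_commutative_lie_algebra, 'm) prealg_scheme" and B :: "('b, 'h, 'n) prealg_scheme"
  shows "carrier (A \<otimes>\<^sub>H B) = carrier (tensor_mod A B (hat_relations A B))"
    "add (A \<otimes>\<^sub>H B) = add (tensor_mod A B (hat_relations A B))"
    "\<zero>\<^bsub>A \<otimes>\<^sub>H B\<^esub> = \<zero>\<^bsub>tensor_mod A B (hat_relations A B)\<^esub>"
    "smult (A \<otimes>\<^sub>H B) = smult (tensor_mod A B (hat_relations A B))"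
    "grade (A \<otimes>\<^sub>H B) = (\<lambda>\<alpha> \<beta>. subspace_span (tensor_mod A B (hat_relations A B))
      {hat_pure A B a b | a b \<alpha>1 \<beta>1 \<alpha>2 \<beta>2. a \<in> grade A \<alpha>1 \<beta>1 \<and> b \<in> grade B \<alpha>2 \<beta>2 \<and>
        \<alpha>1 + \<alpha>2 = \<alpha> \<and> \<beta>1 + \<beta>2 = \<beta>})"
    "mu_l (A \<otimes>\<^sub>H B) = (\<lambda>f. tensor_map A B (hat_relations A B) (mu_l A f) id)"
    "mu_r (A \<otimes>\<^sub>H B) = (\<lambda>f. tensor_map A B (hat_relations A B) (mu_r A f) id)"
  by (simp_all add: hat_tensor_def module.defs prealg.defs)

locale prealg_pair = A: prealg_space A + B: prealg_space B
  for A :: "('a, 'h::fd_commutative_lie_algebra, 'm) prealg_scheme"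
    and B :: "('b, 'h, 'n) prealg_scheme"
begin

subsection \<open>The tensor product over the meromorphic functions\<close>

abbreviation "S \<equiv> tilde_summand A B"

abbreviation "tpure \<alpha> \<gamma> \<beta> \<equiv> pure_tensor (homogeneous_part A \<alpha> \<gamma>) (homogeneous_part B \<gamma> \<beta>)
  (tilde_relations A B (\<alpha>, \<gamma>, \<beta>))"

lemma tensor_space_summand:
  "tensor_space (homogeneous_part A \<alpha> \<gamma>) (homogeneous_part B \<gamma> \<beta>) (tilde_relations A B (\<alpha>, \<gamma>, \<beta>))"
  by (intro tensor_space.intro tensor_space_axioms.intro A.cspace_grade B.cspace_grade)
    (auto simp: tilde_relations_def A.mu_r_grade B.mu_l_grade)

lemma summand_eq: "S (\<alpha>, \<gamma>, \<beta>) = tensor_mod (homogeneous_part A \<alpha> \<gamma>) (homogeneous_part B \<gamma> \<beta>)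
    (tilde_relations A B (\<alpha>, \<gamma>, \<beta>))"
  and summand_map_eq: "tilde_map A B \<phi> \<psi> (\<alpha>, \<gamma>, \<beta>) = tensor_map (homogeneous_part A \<alpha> \<gamma>)
    (homogeneous_part B \<gamma> \<beta>) (tilde_relations A B (\<alpha>, \<gamma>, \<beta>)) \<phi> \<psi>"
  by (simp_all add: tilde_summand_def tilde_map_def)

lemma cspace_summand: "cspace (S i)"
proof (cases i)
  case (fields \<alpha> \<gamma> \<beta>)
  interpret t: tensor_space "homogeneous_part A \<alpha> \<gamma>" "homogeneous_part B \<gamma> \<beta>"
    "tilde_relations A B (\<alpha>, \<gamma>, \<beta>)" by (rule tensor_space_summand)
  show ?thesis using t.T.cspace_axioms by (simp add: fields summand_eq)
qed

lemma tpure_relation: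
  assumes "a \<in> grade A \<alpha> \<gamma>" "b \<in> grade B \<gamma> \<beta>"
  shows "tpure \<alpha> \<gamma> \<beta> (mu_r A f a) b = tpure \<alpha> \<gamma> \<beta> a (mu_l B f b)"
  by (rule tensor_space.pure_relation[OF tensor_space_summand])
    (use assms in \<open>auto simp: tilde_relations_def\<close>)

lemma tpure_closed: "\<lbrakk>a \<in> grade A \<alpha> \<gamma>; b \<in> grade B \<gamma> \<beta>\<rbrakk> \<Longrightarrow> tpure \<alpha> \<gamma> \<beta> a b \<in> carrier (S (\<alpha>, \<gamma>, \<beta>))"
  unfolding summand_eq by (rule tensor_space.pure_closed[OF tensor_space_summand]) simp_all

lemma tilde_pure_eq: "tilde_pure A B \<alpha> \<gamma> \<beta> a b = direct_sum_inj S (\<alpha>, \<gamma>, \<beta>) (tpure \<alpha> \<gamma> \<beta> a b)"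
  by (simp add: tilde_pure_def)

lemma tilde_relations_elim:
  assumes "((a, b), (a', b')) \<in> tilde_relations A B (\<alpha>, \<gamma>, \<beta>)"
  obtains f where "a = mu_r A f a'" "b' = mu_l B f b" "a' \<in> grade A \<alpha> \<gamma>" "b \<in> grade B \<gamma> \<beta>"
  using assms by (auto simp: tilde_relations_def)

lemma left_action_homogeneous:
  "left_action (homogeneous_part A \<alpha> \<gamma>) (mu_l A)" "left_action (homogeneous_part B \<gamma> \<beta>) (mu_r B)"
proof -
  show "left_action (homogeneous_part A \<alpha> \<gamma>) (mu_l A)"
    by (intro left_action_subspace A.left_action_mu_l A.subspaceD(1)[OF A.subspace_grade] A.mu_l_grade)
  show "left_action (homogeneous_part B \<gamma> \<beta>) (mu_r B)"
    by (intro left_action_subspace B.left_action_mu_r B.subspaceD(1)[OF B.subspace_grade] B.mu_r_grade)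
qed

text \<open>The action in question commutes with the one over which the tensor product is balanced,
  so it carries a relation to a relation. The same reason, in the second factor, gives
  \<open>compatible_mu_r\<close>.\<close>

lemma compatible_mu_l:
  assumes "((a, b), (a', b')) \<in> tilde_relations A B (\<alpha>, \<gamma>, \<beta>)"
  shows "tpure \<alpha> \<gamma> \<beta> (mu_l A f a) b = tpure \<alpha> \<gamma> \<beta> (mu_l A f a') b'"
proof -
  obtain g where g: "a = mu_r A g a'" "b' = mu_l B g b" "a' \<in> grade A \<alpha> \<gamma>" "b \<in> grade B \<gamma> \<beta>"
    using assms by (rule tilde_relations_elim)
  have "mu_l A f a = mu_r A g (mu_l A f a')"
    unfolding g(1) by (rule A.mu_l_mu_r) (use g(3) in blast)
  then show ?thesis using tpure_relation[OF A.mu_l_grade[OF g(3)] g(4)] g(2) by simp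
qed

lemma compatible_mu_r:
  assumes "((a, b), (a', b')) \<in> tilde_relations A B (\<alpha>, \<gamma>, \<beta>)"
  shows "tpure \<alpha> \<gamma> \<beta> a (mu_r B f b) = tpure \<alpha> \<gamma> \<beta> a' (mu_r B f b')"
proof -
  obtain g where g: "a = mu_r A g a'" "b' = mu_l B g b" "a' \<in> grade A \<alpha> \<gamma>" "b \<in> grade B \<gamma> \<beta>"
    using assms by (rule tilde_relations_elim)
  have "mu_r B f b' = mu_l B g (mu_r B f b)"
    unfolding g(2) by (rule B.mu_l_mu_r[symmetric]) (use g(4) in blast)
  then show ?thesis using tpure_relation[OF g(3) B.mu_r_grade[OF g(4)]] g(1) by simp
qed

lemma left_action_summand:
  "left_action (S i) (\<lambda>f. tilde_map A B (mu_l A f) id i)"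
  "left_action (S i) (\<lambda>f. tilde_map A B id (mu_r B f) i)"
proof -
  obtain \<alpha> \<gamma> \<beta> where i: "i = (\<alpha>, \<gamma>, \<beta>)" by (rule prod_cases3)
  show "left_action (S i) (\<lambda>f. tilde_map A B (mu_l A f) id i)"
    unfolding i summand_eq summand_map_eq
    by (rule tensor_space.left_action_tensor_left[OF tensor_space_summand left_action_homogeneous(1)
          compatible_mu_l])
  show "left_action (S i) (\<lambda>f. tilde_map A B id (mu_r B f) i)"
    unfolding i summand_eq summand_map_eq
    by (rule tensor_space.left_action_tensor_right[OF tensor_space_summand left_action_homogeneous(2)
          compatible_mu_r])
qed

lemmas linear_tilde_map = left_actionD(1)[OF left_action_summand(1)]
  left_actionD(1)[OF left_action_summand(2)]

lemma tilde_map_tpure: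
  assumes "a \<in> grade A \<alpha> \<gamma>" "b \<in> grade B \<gamma> \<beta>"
  shows "tilde_map A B (mu_l A f) id (\<alpha>, \<gamma>, \<beta>) (tpure \<alpha> \<gamma> \<beta> a b) = tpure \<alpha> \<gamma> \<beta> (mu_l A f a) b"
    "tilde_map A B id (mu_r B f) (\<alpha>, \<gamma>, \<beta>) (tpure \<alpha> \<gamma> \<beta> a b) = tpure \<alpha> \<gamma> \<beta> a (mu_r B f b)"
proof -
  show "tilde_map A B (mu_l A f) id (\<alpha>, \<gamma>, \<beta>) (tpure \<alpha> \<gamma> \<beta> a b) = tpure \<alpha> \<gamma> \<beta> (mu_l A f a) b"
    unfolding summand_map_eq
    by (rule tensor_space.tensor_map_left(2)[OF tensor_space_summand
          left_actionD(1)[OF left_action_homogeneous(1)] compatible_mu_l]) (use assms in simp_all)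
  show "tilde_map A B id (mu_r B f) (\<alpha>, \<gamma>, \<beta>) (tpure \<alpha> \<gamma> \<beta> a b) = tpure \<alpha> \<gamma> \<beta> a (mu_r B f b)"
    unfolding summand_map_eq
    by (rule tensor_space.tensor_map_right(2)[OF tensor_space_summand
          left_actionD(1)[OF left_action_homogeneous(2)] compatible_mu_r]) (use assms in simp_all)
qed

lemma summand_linear_eqI:
  assumes "\<phi> \<in> linear_maps (S (\<alpha>, \<gamma>, \<beta>)) Z" "\<psi> \<in> linear_maps (S (\<alpha>, \<gamma>, \<beta>)) Z" "cspace Z"
    "\<And>a b. \<lbrakk>a \<in> grade A \<alpha> \<gamma>; b \<in> grade B \<gamma> \<beta>\<rbrakk> \<Longrightarrow> \<phi> (tpure \<alpha> \<gamma> \<beta> a b) = \<psi> (tpure \<alpha> \<gamma> \<beta> a b)"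
    "t \<in> carrier (S (\<alpha>, \<gamma>, \<beta>))"
  shows "\<phi> t = \<psi> t"
  by (rule tensor_space.linear_maps_eqI[OF tensor_space_summand assms(1,2)[unfolded summand_eq] assms(3)])
    (use assms(4,5) in \<open>simp_all add: summand_eq\<close>)

lemma tilde_map_commute:
  assumes "t \<in> carrier (S i)"
  shows "tilde_map A B (mu_l A f) id i (tilde_map A B id (mu_r B g) i t) =
    tilde_map A B id (mu_r B g) i (tilde_map A B (mu_l A f) id i t)"
proof -
  obtain \<alpha> \<gamma> \<beta> where i: "i = (\<alpha>, \<gamma>, \<beta>)" by (rule prod_cases3)
  show ?thesis
    unfolding i
    by (rule summand_linear_eqI[OF linear_maps_comp[OF linear_tilde_map(2) linear_tilde_map(1)]
          linear_maps_comp[OF linear_tilde_map(1) linear_tilde_map(2)] cspace_summand])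
      (use assms i in \<open>simp_all add: tilde_map_tpure A.mu_l_grade B.mu_r_grade\<close>)
qed

lemma cspace_tilde: "cspace (A \<otimes>\<^sub>T B)"
  by (rule cspace_surj[OF cspace_direct_sum[of S, OF cspace_summand], where q = "\<lambda>x. x"])
    (simp_all add: tilde_tensor_simps)

lemma linear_maps_tilde:
  "linear_maps (A \<otimes>\<^sub>T B) = linear_maps (direct_sum S)" "linear_maps Z (A \<otimes>\<^sub>T B) = linear_maps Z (direct_sum S)"
  by (simp_all add: linear_maps_def tilde_tensor_simps fun_eq_iff del: direct_sum_simps)

lemma tilde_grade_iff: "x \<in> grade (A \<otimes>\<^sub>T B) \<alpha> \<beta> \<longleftrightarrow> x \<in> carrier (direct_sum S) \<and>
    (\<forall>i. (fst i, snd (snd i)) \<noteq> (\<alpha>, \<beta>) \<longrightarrow> x i = \<zero>\<^bsub>S i\<^esub>)"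
  by (simp add: tilde_tensor_simps split_paired_All del: direct_sum_simps)

lemma tilde_inj_grade:
  assumes "a \<in> carrier (S i)"
  shows "direct_sum_inj S i a \<in> grade (A \<otimes>\<^sub>T B) (fst i) (snd (snd i))"
  unfolding tilde_grade_iff
  using linear_mapsD(1)[OF linear_maps_direct_sum_inj[of S, OF cspace_summand] assms]
  by (auto simp: direct_sum_inj_def simp del: direct_sum_simps)

text \<open>The bigrading forgets the middle degree: a graded part comprises all summands that
  differ only in \<gamma>.\<close>

definition tilde_proj :: "'h dual \<times> 'h dual \<Rightarrow> ('h dual \<times> 'h dual \<times> 'h dual \<Rightarrow> ('a \<times> 'b \<Rightarrow>\<^sub>0 complex) set) \<Rightarrow>
    'h dual \<times> 'h dual \<times> 'h dual \<Rightarrow> ('a \<times> 'b \<Rightarrow>\<^sub>0 complex) set" where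
  "tilde_proj p x = (\<lambda>i. if (fst i, snd (snd i)) = p then x i else \<zero>\<^bsub>S i\<^esub>)"

lemma linear_tilde_proj: "tilde_proj p \<in> linear_maps (direct_sum S) (direct_sum S)"
proof -
  have "(\<lambda>x i. (if (fst i, snd (snd i)) = p then (\<lambda>y. y) else (\<lambda>y. \<zero>\<^bsub>S i\<^esub>)) (x i)) \<in>
      linear_maps (direct_sum S) (direct_sum S)"
    by (intro linear_maps_direct_sum_map cspace_summand)
      (simp add: linear_maps_id linear_maps_const_zero cspace_summand)
  moreover have "(\<lambda>x i. (if (fst i, snd (snd i)) = p then (\<lambda>y. y) else (\<lambda>y. \<zero>\<^bsub>S i\<^esub>)) (x i)) =
      tilde_proj p"
    by (intro ext) (simp add: tilde_proj_def)
  ultimately show ?thesis by simp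
qed

lemma subspace_tilde_grade: "submodule (grade (A \<otimes>\<^sub>T B) \<alpha> \<beta>) complex_ring (A \<otimes>\<^sub>T B)"
proof (rule cspace.subspaceI[OF cspace_tilde])
  interpret D: cspace "direct_sum S" by (rule cspace_direct_sum[of S, OF cspace_summand])
  interpret S: cspace "S i" for i by (rule cspace_summand)
  show "grade (A \<otimes>\<^sub>T B) \<alpha> \<beta> \<subseteq> carrier (A \<otimes>\<^sub>T B)"
    unfolding tilde_grade_iff tilde_tensor_simps(1) using tilde_grade_iff by blast
  show "\<zero>\<^bsub>A \<otimes>\<^sub>T B\<^esub> \<in> grade (A \<otimes>\<^sub>T B) \<alpha> \<beta>"
    unfolding tilde_grade_iff tilde_tensor_simps(3) using D.zero_closed by simp
  fix x assume x: "x \<in> grade (A \<otimes>\<^sub>T B) \<alpha> \<beta>"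
  then have x': "x \<in> carrier (direct_sum S)" unfolding tilde_grade_iff by blast
  show "c \<odot>\<^bsub>A \<otimes>\<^sub>T B\<^esub> x \<in> grade (A \<otimes>\<^sub>T B) \<alpha> \<beta>" for c
    unfolding tilde_grade_iff tilde_tensor_simps(2,4)
  proof (intro conjI D.smult_closed x' allI impI)
    fix i :: "'h dual \<times> 'h dual \<times> 'h dual" assume "(fst i, snd (snd i)) \<noteq> (\<alpha>, \<beta>)"
    then have "x i = \<zero>\<^bsub>S i\<^esub>" using x unfolding tilde_grade_iff by blast
    then show "(c \<odot>\<^bsub>direct_sum S\<^esub> x) i = \<zero>\<^bsub>S i\<^esub>" by simp
  qed
  fix y assume y: "y \<in> grade (A \<otimes>\<^sub>T B) \<alpha> \<beta>"
  then have y': "y \<in> carrier (direct_sum S)" unfolding tilde_grade_iff by blast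
  show "x \<oplus>\<^bsub>A \<otimes>\<^sub>T B\<^esub> y \<in> grade (A \<otimes>\<^sub>T B) \<alpha> \<beta>"
    unfolding tilde_grade_iff tilde_tensor_simps(2,4)
  proof (intro conjI D.a_closed x' y' allI impI)
    fix i :: "'h dual \<times> 'h dual \<times> 'h dual" assume "(fst i, snd (snd i)) \<noteq> (\<alpha>, \<beta>)"
    then have "x i = \<zero>\<^bsub>S i\<^esub>" "y i = \<zero>\<^bsub>S i\<^esub>" using x y unfolding tilde_grade_iff by blast+
    then show "(x \<oplus>\<^bsub>direct_sum S\<^esub> y) i = \<zero>\<^bsub>S i\<^esub>" by simp
  qed
qed

text \<open>The explicit formula for \<open>component\<close> is what later evaluates the right
  actions of \<open>A \<otimes>\<^sub>T B\<close> on each summand.\<close>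

lemma tilde_decomposition:
  assumes "x \<in> carrier (A \<otimes>\<^sub>T B)"
  shows "\<exists>!y. decomposition (A \<otimes>\<^sub>T B) x y" "component (A \<otimes>\<^sub>T B) x = (\<lambda>p. tilde_proj p x)"
proof -
  have D: "cspace (direct_sum S)" by (rule cspace_direct_sum[of S, OF cspace_summand])
  have span: "carrier (A \<otimes>\<^sub>T B) \<subseteq> H"
    if H: "submodule H complex_ring (A \<otimes>\<^sub>T B)" "\<And>\<alpha> \<beta>. grade (A \<otimes>\<^sub>T B) \<alpha> \<beta> \<subseteq> H" for H
  proof
    fix x assume x: "x \<in> carrier (A \<otimes>\<^sub>T B)"
    have "submodule H complex_ring (direct_sum S)"
      by (rule submodule_transfer[OF H(1) cspace_tilde D]) (simp_all add: tilde_tensor_simps)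
    then show "x \<in> H"
      by (rule direct_sum_induct[of S, OF cspace_summand])
        (use H(2) tilde_inj_grade x[unfolded tilde_tensor_simps] in blast)+
  qed
  have proj: "tilde_proj p \<in> linear_maps (A \<otimes>\<^sub>T B) (A \<otimes>\<^sub>T B)" for p
    unfolding linear_maps_tilde by (rule linear_tilde_proj)
  have same: "tilde_proj (\<alpha>, \<beta>) x = x" if "x \<in> grade (A \<otimes>\<^sub>T B) \<alpha> \<beta>" for \<alpha> \<beta> x
  proof
    fix i show "tilde_proj (\<alpha>, \<beta>) x i = x i"
      using that unfolding tilde_grade_iff tilde_proj_def by presburger
  qed
  have other: "tilde_proj p x = \<zero>\<^bsub>A \<otimes>\<^sub>T B\<^esub>" if "x \<in> grade (A \<otimes>\<^sub>T B) \<alpha> \<beta>" "p \<noteq> (\<alpha>, \<beta>)" for \<alpha> \<beta> p x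
  proof
    fix i show "tilde_proj p x i = \<zero>\<^bsub>A \<otimes>\<^sub>T B\<^esub> i"
      using that unfolding tilde_grade_iff tilde_proj_def tilde_tensor_simps(3) direct_sum_simps(2)
      by presburger
  qed
  show "\<exists>!y. decomposition (A \<otimes>\<^sub>T B) x y" "component (A \<otimes>\<^sub>T B) x = (\<lambda>p. tilde_proj p x)"
    by (rule decomposition_exists[where \<pi> = tilde_proj,
          OF cspace_tilde subspace_tilde_grade span proj same other assms]; assumption)+
qed

theorem prealgebra_tilde: "prealgebra (A \<otimes>\<^sub>T B)"
proof (rule prealgebraI)
  have left_action_tilde: "left_action (A \<otimes>\<^sub>T B) \<mu>" if "left_action (direct_sum S) \<mu>" for \<mu> :: "'h mero \<Rightarrow> _"
    using that by (simp add: left_action_def linear_maps_tilde tilde_tensor_simps del: direct_sum_simps)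
  show mu: "left_action (A \<otimes>\<^sub>T B) (mu_l (A \<otimes>\<^sub>T B))" "left_action (A \<otimes>\<^sub>T B) (mu_r (A \<otimes>\<^sub>T B))"
    unfolding tilde_tensor_simps(6,7)
    by (intro left_action_tilde left_action_direct_sum cspace_summand left_action_summand)+
  note closed = linear_mapsD(1)[OF left_actionD(1)[OF mu(1)]] linear_mapsD(1)[OF left_actionD(1)[OF mu(2)]]
  fix f g \<alpha> \<beta> x
  {
    assume x: "x \<in> grade (A \<otimes>\<^sub>T B) \<alpha> \<beta>"
    then have xc: "x \<in> carrier (A \<otimes>\<^sub>T B)" unfolding tilde_grade_iff tilde_tensor_simps(1) by blast
    have zero: "x i = \<zero>\<^bsub>S i\<^esub>" if "(fst i, snd (snd i)) \<noteq> (\<alpha>, \<beta>)" for i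
      using x that unfolding tilde_grade_iff by blast
    show "mu_l (A \<otimes>\<^sub>T B) f x \<in> grade (A \<otimes>\<^sub>T B) \<alpha> \<beta>"
      unfolding tilde_grade_iff tilde_tensor_simps(1)[symmetric]
    proof (intro conjI allI impI closed xc)
      fix i :: "'h dual \<times> 'h dual \<times> 'h dual" assume "(fst i, snd (snd i)) \<noteq> (\<alpha>, \<beta>)"
      then show "mu_l (A \<otimes>\<^sub>T B) f x i = \<zero>\<^bsub>S i\<^esub>"
        using linear_maps_zero[OF linear_tilde_map(1) cspace_summand cspace_summand] zero
        unfolding tilde_tensor_simps(6) by metis
    qed
    show "mu_r (A \<otimes>\<^sub>T B) f x \<in> grade (A \<otimes>\<^sub>T B) \<alpha> \<beta>"
      unfolding tilde_grade_iff tilde_tensor_simps(1)[symmetric]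
    proof (intro conjI allI impI closed xc)
      fix i :: "'h dual \<times> 'h dual \<times> 'h dual" assume "(fst i, snd (snd i)) \<noteq> (\<alpha>, \<beta>)"
      then show "mu_r (A \<otimes>\<^sub>T B) f x i = \<zero>\<^bsub>S i\<^esub>"
        using linear_maps_zero[OF linear_tilde_map(2) cspace_summand cspace_summand] zero
        unfolding tilde_tensor_simps(7) by metis
    qed
  next
    assume "x \<in> carrier (A \<otimes>\<^sub>T B)"
    then have "x i \<in> carrier (S i)" for i unfolding tilde_tensor_simps by (rule direct_sumD(1))
    then show "mu_l (A \<otimes>\<^sub>T B) f (mu_r (A \<otimes>\<^sub>T B) g x) = mu_r (A \<otimes>\<^sub>T B) g (mu_l (A \<otimes>\<^sub>T B) f x)"
      unfolding tilde_tensor_simps(6,7) by (simp only: tilde_map_commute)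
  }
qed (use cspace_tilde subspace_tilde_grade tilde_decomposition(1) in blast)+

subsection \<open>The tensor product over both actions\<close>

abbreviation "R \<equiv> hat_relations A B"
abbreviation "Q \<equiv> tensor_mod A B R"

sublocale H: tensor_space A B R
  by (intro tensor_space.intro tensor_space_axioms.intro A.cspace_axioms B.cspace_axioms)
    (auto simp: hat_relations_def)

lemma hat_pure_relation:
  assumes "a \<in> carrier A" "b \<in> carrier B"
  shows "hat_pure A B (mu_l_right A a f) b = hat_pure A B a (mu_l B f b)"
    "hat_pure A B (mu_r_right A a f) b = hat_pure A B a (mu_r B f b)"
proof -
  have "((mu_l_right A a f, b), (a, mu_l B f b)) \<in> R" "((mu_r_right A a f, b), (a, mu_r B f b)) \<in> R"
    using assms unfolding hat_relations_def by blast+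
  from this[THEN H.pure_relation] show "hat_pure A B (mu_l_right A a f) b = hat_pure A B a (mu_l B f b)"
    "hat_pure A B (mu_r_right A a f) b = hat_pure A B a (mu_r B f b)"
    by (simp_all only: hat_pure_def)
qed

lemma hat_relations_cases:
  assumes "((a, b), (a', b')) \<in> R"
  obtains (l) f where "a = mu_l_right A a' f" "b' = mu_l B f b" "a' \<in> carrier A" "b \<in> carrier B"
    | (r) f where "a = mu_r_right A a' f" "b' = mu_r B f b" "a' \<in> carrier A" "b \<in> carrier B"
  using assms by (auto simp: hat_relations_def)

text \<open>By \<open>commute_right\<close> such a \<phi> also commutes with the right actions of
  the first factor, so it maps both kinds of relations to relations with the second factor
  untouched.\<close>

lemma hat_compatible:
  assumes "\<phi> \<in> linear_maps A A" "\<And>\<alpha> \<beta> a. a \<in> grade A \<alpha> \<beta> \<Longrightarrow> \<phi> a \<in> grade A \<alpha> \<beta>"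
    "\<And>f a. a \<in> carrier A \<Longrightarrow> \<phi> (mu_l A f a) = mu_l A f (\<phi> a)"
    "\<And>f a. a \<in> carrier A \<Longrightarrow> \<phi> (mu_r A f a) = mu_r A f (\<phi> a)"
    "((a, b), (a', b')) \<in> R"
  shows "hat_pure A B (\<phi> a) b = hat_pure A B (\<phi> a') b'"
  using assms(5)
proof (cases rule: hat_relations_cases)
  case (l f)
  have "\<phi> a = mu_l_right A (\<phi> a') f"
    unfolding l(1) by (rule A.commute_right(1)[OF assms(1,2) l(3) assms(3)])
  then show ?thesis using l linear_mapsD(1)[OF assms(1)] by (simp add: hat_pure_relation)
next
  case (r f)
  have "\<phi> a = mu_r_right A (\<phi> a') f"
    unfolding r(1) by (rule A.commute_right(2)[OF assms(1,2) r(3) assms(4)])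
  then show ?thesis using r linear_mapsD(1)[OF assms(1)] by (simp add: hat_pure_relation)
qed

lemma hat_compatible_mu:
  assumes "((a, b), (a', b')) \<in> R"
  shows "hat_pure A B (mu_l A f a) b = hat_pure A B (mu_l A f a') b'"
    "hat_pure A B (mu_r A f a) b = hat_pure A B (mu_r A f a') b'"
proof -
  show "hat_pure A B (mu_l A f a) b = hat_pure A B (mu_l A f a') b'"
    by (rule hat_compatible[OF A.linear_mu_l A.mu_l_grade A.mu_l_mu_l A.mu_l_mu_r assms])
  show "hat_pure A B (mu_r A f a) b = hat_pure A B (mu_r A f a') b'"
    by (rule hat_compatible[OF A.linear_mu_r A.mu_r_grade A.mu_l_mu_r[symmetric] A.mu_r_mu_r assms])
qed

lemma left_action_Q: "left_action Q (mu_l (A \<otimes>\<^sub>H B))" "left_action Q (mu_r (A \<otimes>\<^sub>H B))"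
proof -
  show "left_action Q (mu_l (A \<otimes>\<^sub>H B))"
    unfolding hat_tensor_simps
    by (rule H.left_action_tensor_left[OF A.left_action_mu_l hat_compatible_mu(1)[unfolded hat_pure_def]])
  show "left_action Q (mu_r (A \<otimes>\<^sub>H B))"
    unfolding hat_tensor_simps
    by (rule H.left_action_tensor_left[OF A.left_action_mu_r hat_compatible_mu(2)[unfolded hat_pure_def]])
qed

lemmas linear_hat_mu = left_actionD(1)[OF left_action_Q(1)] left_actionD(1)[OF left_action_Q(2)]

lemma hat_mu_pure:
  assumes "a \<in> carrier A" "b \<in> carrier B"
  shows "mu_l (A \<otimes>\<^sub>H B) f (hat_pure A B a b) = hat_pure A B (mu_l A f a) b"
    "mu_r (A \<otimes>\<^sub>H B) f (hat_pure A B a b) = hat_pure A B (mu_r A f a) b"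
proof -
  show "mu_l (A \<otimes>\<^sub>H B) f (hat_pure A B a b) = hat_pure A B (mu_l A f a) b"
    unfolding hat_tensor_simps hat_pure_def
    by (rule H.tensor_map_left(2)[OF A.linear_mu_l hat_compatible_mu(1)[unfolded hat_pure_def] assms])
  show "mu_r (A \<otimes>\<^sub>H B) f (hat_pure A B a b) = hat_pure A B (mu_r A f a) b"
    unfolding hat_tensor_simps hat_pure_def
    by (rule H.tensor_map_left(2)[OF A.linear_mu_r hat_compatible_mu(2)[unfolded hat_pure_def] assms])
qed

lemma bilinear_hat_pure: "bilinear_map A B Q (hat_pure A B)"
  using H.bilinear_pure by (simp add: hat_pure_def[abs_def])

lemma hat_linear_eqI:
  assumes "\<phi> \<in> linear_maps Q Z" "\<psi> \<in> linear_maps Q Z" "cspace Z"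
    "\<And>a b. \<lbrakk>a \<in> carrier A; b \<in> carrier B\<rbrakk> \<Longrightarrow> \<phi> (hat_pure A B a b) = \<psi> (hat_pure A B a b)"
    "t \<in> carrier Q"
  shows "\<phi> t = \<psi> t"
  using H.linear_maps_eqI[OF assms(1-3) _ assms(5)] assms(4) by (simp add: hat_pure_def)

lemma cspace_hat: "cspace (A \<otimes>\<^sub>H B)"
  by (rule cspace_surj[OF H.T.cspace_axioms, where q = "\<lambda>x. x"]) (simp_all add: hat_tensor_simps)

lemma linear_maps_hat:
  "linear_maps (A \<otimes>\<^sub>H B) = linear_maps Q" "linear_maps Z (A \<otimes>\<^sub>H B) = linear_maps Z Q"
  by (simp_all add: linear_maps_def hat_tensor_simps fun_eq_iff)

lemma submodule_hat_iff: "submodule K complex_ring (A \<otimes>\<^sub>H B) \<longleftrightarrow> submodule K complex_ring Q"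
  using submodule_transfer[of K "A \<otimes>\<^sub>H B" Q] submodule_transfer[of K Q "A \<otimes>\<^sub>H B"] cspace_hat
    H.T.cspace_axioms by (auto simp: hat_tensor_simps)

abbreviation "hat_generators \<alpha> \<beta> \<equiv>
  {hat_pure A B a b | a b \<alpha>1 \<beta>1 \<alpha>2 \<beta>2. a \<in> grade A \<alpha>1 \<beta>1 \<and> b \<in> grade B \<alpha>2 \<beta>2 \<and>
    \<alpha>1 + \<alpha>2 = \<alpha> \<and> \<beta>1 + \<beta>2 = \<beta>}"

lemma hat_pure_closed: "\<lbrakk>a \<in> carrier A; b \<in> carrier B\<rbrakk> \<Longrightarrow> hat_pure A B a b \<in> carrier Q"
  by (rule bilinear_mapD(3)[OF bilinear_hat_pure])

lemma subspace_hat_grade: "submodule (grade (A \<otimes>\<^sub>H B) \<alpha> \<beta>) complex_ring Q"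
  unfolding hat_tensor_simps
  by (rule H.T.subspace_subspace_span) (auto intro: hat_pure_closed)

lemma hat_pure_grade:
  "\<lbrakk>a \<in> grade A \<alpha> \<beta>; b \<in> grade B \<alpha>' \<beta>'\<rbrakk> \<Longrightarrow> hat_pure A B a b \<in> grade (A \<otimes>\<^sub>H B) (\<alpha> + \<alpha>') (\<beta> + \<beta>')"
  unfolding hat_tensor_simps by (rule subsetD[OF subspace_span_superset]) blast

lemma hat_grade_induct:
  assumes "submodule K complex_ring Q"
    "\<And>a b \<alpha>1 \<beta>1 \<alpha>2 \<beta>2. \<lbrakk>a \<in> grade A \<alpha>1 \<beta>1; b \<in> grade B \<alpha>2 \<beta>2; \<alpha>1 + \<alpha>2 = \<alpha>; \<beta>1 + \<beta>2 = \<beta>\<rbrakk> \<Longrightarrow>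
      hat_pure A B a b \<in> K"
    "t \<in> grade (A \<otimes>\<^sub>H B) \<alpha> \<beta>"
  shows "t \<in> K"
  using subspace_span_least[OF assms(1), of "hat_generators \<alpha> \<beta>"] assms(2,3)
  unfolding hat_tensor_simps by blast

section \<open>Projections onto the bidegrees of \<open>\<otimes>\<^sub>H\<close>\<close>

abbreviation "hat_part s \<equiv> \<lambda>p q a b. if p + q = s then hat_pure A B a b else \<zero>\<^bsub>Q\<^esub>"

text \<open>On a \<otimes> b this collects the products of components whose bidegrees add up to s.
  The condition sits inside \<open>hat_part\<close>, so the two indices stay independent and
  \<open>direct_sum_bilinear\<close> applies.\<close>

definition hat_proj :: "'h dual \<times> 'h dual \<Rightarrow> ('a \<times> 'b \<Rightarrow>\<^sub>0 complex) set \<Rightarrow> ('a \<times> 'b \<Rightarrow>\<^sub>0 complex) set" where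
  "hat_proj s = tensor_lift Q (\<lambda>a b.
    direct_sum_bilinear Q (hat_part s) (component A a) (component B b))"

lemma bilinear_hat_part:
  "bilinear_map (homogeneous_part A (fst p) (snd p)) (homogeneous_part B (fst q) (snd q)) Q (hat_part s p q)"
proof (cases "p + q = s")
  case True
  have "bilinear_map (homogeneous_part A (fst p) (snd p)) (homogeneous_part B (fst q) (snd q)) Q
      (hat_pure A B)"
    by (intro bilinear_map_comp[OF bilinear_hat_pure _ _ linear_maps_id]
        linear_maps_restrict_domain[OF linear_maps_id] A.subspaceD(1)[OF A.subspace_grade]
        B.subspaceD(1)[OF B.subspace_grade])
  then show ?thesis using True by simp
next
  case False
  then show ?thesis
    by (intro bilinear_mapI) (simp_all add: linear_maps_const_zero H.T.cspace_axioms)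
qed

text \<open>On homogeneous a the right action is a shifted left action. Both sides have the same
  cut-off p + q = s, and below it this is a relation of \<open>R\<close>.\<close>

lemma hat_part_relation:
  assumes "a \<in> grade A (fst p) (snd p)" "b \<in> carrier B"
  shows "hat_part s p q (mu_l A (shift_mero (- fst p) f) a) b = hat_part s p q a (mu_l B f b)"
    "hat_part s p q (mu_r A (shift_mero (- snd p) f) a) b = hat_part s p q a (mu_r B f b)"
  using hat_pure_relation[OF A.grade_closed[OF assms(1)] assms(2)]
  by (simp_all add: A.mu_l_right_homogeneous[OF assms(1)])

lemma
  shows linear_hat_proj: "hat_proj s \<in> linear_maps Q Q"
    and hat_proj_pure: "\<And>a b. \<lbrakk>a \<in> carrier A; b \<in> carrier B\<rbrakk> \<Longrightarrow> hat_proj s (hat_pure A B a b) =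
      direct_sum_bilinear Q (hat_part s) (component A a) (component B b)"
proof -
  let ?\<beta> = "\<lambda>a b. direct_sum_bilinear Q (hat_part s) (component A a) (component B b)"
  have bil: "bilinear_map A B Q ?\<beta>"
    by (rule bilinear_map_comp[OF bilinear_direct_sum[OF A.cspace_grade B.cspace_grade H.T.cspace_axioms
          bilinear_hat_part] A.linear_component B.linear_component linear_maps_id])
  \<comment> \<open>The components of both sides of a relation satisfy that relation pair by pair,
    with the shift belonging to p, so the double sums agree term by term.\<close>
  have compat: "?\<beta> a b = ?\<beta> a' b'" if "((a, b), (a', b')) \<in> R" for a b a' b'
    using that
  proof (cases rule: hat_relations_cases)
    case (l f)
    have "hat_part s p q (component A a p) (component B b q) =
        hat_part s p q (component A a' p) (component B b' q)" for p q
      unfolding l(1,2) A.component_mu_l_right[OF l(3)] B.component_mu_l[OF l(4)]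
      by (rule hat_part_relation(1)[OF A.component_grade[OF l(3)] B.component_in_carrier[OF l(4)]])
    then show ?thesis by (simp only: direct_sum_bilinear_def)
  next
    case (r f)
    have "hat_part s p q (component A a p) (component B b q) =
        hat_part s p q (component A a' p) (component B b' q)" for p q
      unfolding r(1,2) A.component_mu_r_right[OF r(3)] B.component_mu_r[OF r(4)]
      by (rule hat_part_relation(2)[OF A.component_grade[OF r(3)] B.component_in_carrier[OF r(4)]])
    then show ?thesis by (simp only: direct_sum_bilinear_def)
  qed
  show "hat_proj s \<in> linear_maps Q Q"
    unfolding hat_proj_def by (rule H.linear_maps_tensor_lift[OF H.T.cspace_axioms bil compat])
  show "hat_proj s (hat_pure A B a b) = ?\<beta> a b" if "a \<in> carrier A" "b \<in> carrier B" for a b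
    using H.tensor_lift_pure[OF H.T.cspace_axioms bil compat that] by (simp only: hat_proj_def hat_pure_def)
qed

lemma hat_proj_homogeneous:
  assumes "a \<in> grade A \<alpha> \<beta>" "b \<in> grade B \<alpha>' \<beta>'"
  shows "hat_proj s (hat_pure A B a b) = (if (\<alpha> + \<alpha>', \<beta> + \<beta>') = s then hat_pure A B a b else \<zero>\<^bsub>Q\<^esub>)"
proof -
  have "hat_proj s (hat_pure A B a b) = direct_sum_bilinear Q (hat_part s)
      (direct_sum_inj A.homogeneous_parts (\<alpha>, \<beta>) a) (direct_sum_inj B.homogeneous_parts (\<alpha>', \<beta>') b)"
    using assms by (simp add: hat_proj_pure A.grade_closed B.grade_closed
        A.component_homogeneous B.component_homogeneous)
  also have "\<dots> = hat_part s (\<alpha>, \<beta>) (\<alpha>', \<beta>') a b"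
    by (rule direct_sum_bilinear_inj[OF A.cspace_grade B.cspace_grade H.T.cspace_axioms bilinear_hat_part])
      (use assms in simp_all)
  finally show ?thesis by simp
qed

text \<open>Pure tensors are decomposed one factor at a time: first a for homogeneous b, then b.
  Each step uses that the other factor acts linearly.\<close>

lemma hat_homogeneous_induct:
  assumes K: "submodule K complex_ring Q"
    and hom: "\<And>a b \<alpha> \<beta> \<alpha>' \<beta>'. \<lbrakk>a \<in> grade A \<alpha> \<beta>; b \<in> grade B \<alpha>' \<beta>'\<rbrakk> \<Longrightarrow> hat_pure A B a b \<in> K"
    and t: "t \<in> carrier Q"
  shows "t \<in> K"
proof (rule H.tensor_induct[OF K _ t])
  have left: "hat_pure A B a b \<in> K" if a: "a \<in> carrier A" and b: "b \<in> grade B \<alpha> \<beta>" for a b \<alpha> \<beta>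
  proof -
    have "fsum A (component A a) \<in> {a \<in> carrier A. hat_pure A B a b \<in> K}"
      by (intro A.fsum_in_subspace subspace_vimage[OF bilinear_mapD(2)[OF bilinear_hat_pure]]
          B.grade_closed[OF b] A.cspace_axioms H.T.cspace_axioms K)
        (simp add: hom[OF A.component_grade[OF a] b] a)
    then show ?thesis using A.component_sum[OF a] by simp
  qed
  fix a b assume a: "a \<in> carrier A" and b: "b \<in> carrier B"
  have "fsum B (component B b) \<in> {b \<in> carrier B. hat_pure A B a b \<in> K}"
    by (intro B.fsum_in_subspace subspace_vimage[OF bilinear_mapD(1)[OF bilinear_hat_pure]]
        a B.cspace_axioms H.T.cspace_axioms K)
      (simp add: left[OF a B.component_grade[OF b]] b)
  then show "H.pure a b \<in> K" using B.component_sum[OF b] by (simp add: hat_pure_def)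
qed

lemma hat_decomposition:
  assumes "t \<in> carrier (A \<otimes>\<^sub>H B)"
  shows "\<exists>!y. decomposition (A \<otimes>\<^sub>H B) t y"
proof (rule decomposition_exists(1)[OF cspace_hat _ _ _ _ _ assms])
  show "submodule (grade (A \<otimes>\<^sub>H B) \<alpha> \<beta>) complex_ring (A \<otimes>\<^sub>H B)" for \<alpha> \<beta>
    unfolding submodule_hat_iff by (rule subspace_hat_grade)
  show "carrier (A \<otimes>\<^sub>H B) \<subseteq> K"
    if K: "submodule K complex_ring (A \<otimes>\<^sub>H B)" "\<And>\<alpha> \<beta>. grade (A \<otimes>\<^sub>H B) \<alpha> \<beta> \<subseteq> K" for K
  proof
    fix t assume "t \<in> carrier (A \<otimes>\<^sub>H B)"
    then show "t \<in> K"
      unfolding hat_tensor_simps(1)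
      by (rule hat_homogeneous_induct[OF K(1)[unfolded submodule_hat_iff] subsetD[OF K(2)], rotated])
        (rule hat_pure_grade)
  qed
  show "hat_proj p \<in> linear_maps (A \<otimes>\<^sub>H B) (A \<otimes>\<^sub>H B)" for p
    unfolding linear_maps_hat by (rule linear_hat_proj)
  show "hat_proj (\<alpha>, \<beta>) t = t" if "t \<in> grade (A \<otimes>\<^sub>H B) \<alpha> \<beta>" for \<alpha> \<beta> t
  proof -
    have "t \<in> {t \<in> carrier Q. hat_proj (\<alpha>, \<beta>) t = t}"
      by (rule hat_grade_induct[OF subspace_equalizer[OF linear_hat_proj linear_maps_id
              H.T.cspace_axioms H.T.cspace_axioms] _ that])
        (auto simp: hat_proj_homogeneous hat_pure_closed A.grade_closed B.grade_closed)
    then show ?thesis by simp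
  qed
  show "hat_proj p t = \<zero>\<^bsub>A \<otimes>\<^sub>H B\<^esub>" if "t \<in> grade (A \<otimes>\<^sub>H B) \<alpha> \<beta>" "p \<noteq> (\<alpha>, \<beta>)" for \<alpha> \<beta> p t
  proof -
    have "t \<in> {t \<in> carrier Q. hat_proj p t = \<zero>\<^bsub>Q\<^esub>}"
      by (rule hat_grade_induct[OF subspace_equalizer[OF linear_hat_proj linear_maps_const_zero
              H.T.cspace_axioms H.T.cspace_axioms] _ that(1)])
        (use that(2) in \<open>auto simp: H.T.cspace_axioms hat_proj_homogeneous hat_pure_closed
          A.grade_closed B.grade_closed\<close>)
    then show ?thesis by (simp add: hat_tensor_simps)
  qed
qed

theorem prealgebra_hat: "prealgebra (A \<otimes>\<^sub>H B)"
proof (rule prealgebraI)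
  show "cspace (A \<otimes>\<^sub>H B)" by (rule cspace_hat)
  show "submodule (grade (A \<otimes>\<^sub>H B) \<alpha> \<beta>) complex_ring (A \<otimes>\<^sub>H B)" for \<alpha> \<beta>
    unfolding submodule_hat_iff by (rule subspace_hat_grade)
  have left_action_hat: "left_action (A \<otimes>\<^sub>H B) \<mu>" if "left_action Q \<mu>" for \<mu> :: "'h mero \<Rightarrow> _"
    using that by (simp add: left_action_def linear_maps_hat hat_tensor_simps)
  show "left_action (A \<otimes>\<^sub>H B) (mu_l (A \<otimes>\<^sub>H B))" "left_action (A \<otimes>\<^sub>H B) (mu_r (A \<otimes>\<^sub>H B))"
    by (rule left_action_hat, rule left_action_Q)+
  show "\<exists>!y. decomposition (A \<otimes>\<^sub>H B) t y" if "t \<in> carrier (A \<otimes>\<^sub>H B)" for t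
    using that by (rule hat_decomposition)
  \<comment> \<open>The graded parts are spans, so their invariance is tested on generators: the
    preimage of a graded part under an action is a subspace.\<close>
  note vimage = subspace_vimage[OF _ H.T.cspace_axioms H.T.cspace_axioms subspace_hat_grade]
  fix f g \<alpha> \<beta> t
  {
    assume t: "t \<in> grade (A \<otimes>\<^sub>H B) \<alpha> \<beta>"
    have "t \<in> {t \<in> carrier Q. mu_l (A \<otimes>\<^sub>H B) f t \<in> grade (A \<otimes>\<^sub>H B) \<alpha> \<beta>}"
      by (rule hat_grade_induct[OF vimage[OF linear_hat_mu(1)] _ t])
        (auto simp: hat_mu_pure hat_pure_closed A.grade_closed B.grade_closed
          intro!: hat_pure_grade A.mu_l_grade)
    then show "mu_l (A \<otimes>\<^sub>H B) f t \<in> grade (A \<otimes>\<^sub>H B) \<alpha> \<beta>" by simp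
    have "t \<in> {t \<in> carrier Q. mu_r (A \<otimes>\<^sub>H B) f t \<in> grade (A \<otimes>\<^sub>H B) \<alpha> \<beta>}"
      by (rule hat_grade_induct[OF vimage[OF linear_hat_mu(2)] _ t])
        (auto simp: hat_mu_pure hat_pure_closed A.grade_closed B.grade_closed
          intro!: hat_pure_grade A.mu_r_grade)
    then show "mu_r (A \<otimes>\<^sub>H B) f t \<in> grade (A \<otimes>\<^sub>H B) \<alpha> \<beta>" by simp
  next
    assume "t \<in> carrier (A \<otimes>\<^sub>H B)"
    then show "mu_l (A \<otimes>\<^sub>H B) f (mu_r (A \<otimes>\<^sub>H B) g t) = mu_r (A \<otimes>\<^sub>H B) g (mu_l (A \<otimes>\<^sub>H B) f t)"
      unfolding hat_tensor_simps(1)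
      by (rule hat_linear_eqI[OF linear_maps_comp[OF linear_hat_mu(2) linear_hat_mu(1)]
            linear_maps_comp[OF linear_hat_mu(1) linear_hat_mu(2)] H.T.cspace_axioms, rotated])
        (simp add: hat_mu_pure A.mu_l_mu_r)
  }
qed

end

section \<open>The exchange of the middle factors\<close>

context tensor_space
begin

text \<open>For fixed parameters both sides of each linearity law are linear in t, so they agree
  everywhere once they agree on pure tensors. This gives the second linearity of an iterated
  lift.\<close>

lemma linear_maps_parameter:
  assumes U: "cspace U" and Z: "cspace Z" and L: "\<And>x. x \<in> carrier U \<Longrightarrow> L x \<in> linear_maps T Z"
    and pure: "\<And>a b. \<lbrakk>a \<in> carrier V; b \<in> carrier W\<rbrakk> \<Longrightarrow> (\<lambda>x. L x (pure a b)) \<in> linear_maps U Z"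
    and t: "t \<in> carrier T"
  shows "(\<lambda>x. L x t) \<in> linear_maps U Z"
proof (rule linear_mapsI)
  interpret U: cspace U by (rule U)
  fix x assume x: "x \<in> carrier U"
  show "L x t \<in> carrier Z" using linear_mapsD(1)[OF L[OF x] t] .
  show "L (c \<odot>\<^bsub>U\<^esub> x) t = c \<odot>\<^bsub>Z\<^esub> L x t" for c
    by (rule linear_maps_eqI[OF L[OF U.smult_closed[OF x]] linear_maps_smult[OF Z L[OF x]] Z _ t])
      (rule linear_mapsD(3)[OF pure x])
  fix y assume y: "y \<in> carrier U"
  show "L (x \<oplus>\<^bsub>U\<^esub> y) t = L x t \<oplus>\<^bsub>Z\<^esub> L y t"
    by (rule linear_maps_eqI[OF L[OF U.a_closed[OF x y]] linear_maps_add[OF Z L[OF x] L[OF y]] Z _ t])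
      (rule linear_mapsD(2)[OF pure x y])
qed

end

lemma tensor_bilinear_eqI:
  assumes "tensor_space V W R" "tensor_space V' W' R'" "cspace Z"
    "bilinear_map (tensor_mod V W R) (tensor_mod V' W' R') Z \<beta>"
    "bilinear_map (tensor_mod V W R) (tensor_mod V' W' R') Z \<beta>'"
    "\<And>a b c d. \<lbrakk>a \<in> carrier V; b \<in> carrier W; c \<in> carrier V'; d \<in> carrier W'\<rbrakk> \<Longrightarrow>
      \<beta> (pure_tensor V W R a b) (pure_tensor V' W' R' c d) =
      \<beta>' (pure_tensor V W R a b) (pure_tensor V' W' R' c d)"
    "s \<in> carrier (tensor_mod V W R)" "t \<in> carrier (tensor_mod V' W' R')"
  shows "\<beta> s t = \<beta>' s t"
proof -
  interpret T1: tensor_space V W R by fact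
  interpret T2: tensor_space V' W' R' by fact
  have *: "\<beta> (T1.pure a b) t = \<beta>' (T1.pure a b) t" if "a \<in> carrier V" "b \<in> carrier W" for a b
    by (rule T2.linear_maps_eqI[OF bilinear_mapD(1)[OF assms(4)] bilinear_mapD(1)[OF assms(5)]
          assms(3) assms(6)[OF that] assms(8)]) (use that in simp_all)
  show ?thesis
    by (rule T1.linear_maps_eqI[OF bilinear_mapD(2)[OF assms(4,8)] bilinear_mapD(2)[OF assms(5,8)]
          assms(3) * assms(7)])
qed

text \<open>The universal property used twice, first in the second tensor product with a and b
  fixed, then in the first one.\<close>

definition tensor_lift4 :: "(complex, 'z, 'k) module_scheme \<Rightarrow> ('a \<Rightarrow> 'b \<Rightarrow> 'c \<Rightarrow> 'd \<Rightarrow> 'z) \<Rightarrow>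
    ('a \<times> 'b \<Rightarrow>\<^sub>0 complex) set \<Rightarrow> ('c \<times> 'd \<Rightarrow>\<^sub>0 complex) set \<Rightarrow> 'z" where
  "tensor_lift4 Z q s t = tensor_lift Z (\<lambda>a b. tensor_lift Z (q a b) t) s"

text \<open>The hypotheses group the variables as in the source, (a, b) and (c, d), although the
  exchanged value pairs a with c and b with d. The inner lift is balanced in (a, b) because it is so
  on pure tensors of the second product.\<close>

lemma
  fixes q :: "'a \<Rightarrow> 'b \<Rightarrow> 'c \<Rightarrow> 'd \<Rightarrow> 'z"
  assumes T1: "tensor_space V W R" and T2: "tensor_space V' W' R'" and Z: "cspace Z"
    and q1: "\<And>c d. \<lbrakk>c \<in> carrier V'; d \<in> carrier W'\<rbrakk> \<Longrightarrow> bilinear_map V W Z (\<lambda>a b. q a b c d)"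
    and q2: "\<And>a b. \<lbrakk>a \<in> carrier V; b \<in> carrier W\<rbrakk> \<Longrightarrow> bilinear_map V' W' Z (q a b)"
    and r1: "\<And>a b a' b' c d. \<lbrakk>((a, b), (a', b')) \<in> R; c \<in> carrier V'; d \<in> carrier W'\<rbrakk> \<Longrightarrow>
      q a b c d = q a' b' c d"
    and r2: "\<And>c d c' d' a b. \<lbrakk>((c, d), (c', d')) \<in> R'; a \<in> carrier V; b \<in> carrier W\<rbrakk> \<Longrightarrow>
      q a b c d = q a b c' d'"
  shows bilinear_tensor_lift4: "bilinear_map (tensor_mod V W R) (tensor_mod V' W' R') Z (tensor_lift4 Z q)"
    and tensor_lift4_pure: "\<And>a b c d. \<lbrakk>a \<in> carrier V; b \<in> carrier W; c \<in> carrier V'; d \<in> carrier W'\<rbrakk> \<Longrightarrow>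
      tensor_lift4 Z q (pure_tensor V W R a b) (pure_tensor V' W' R' c d) = q a b c d"
proof -
  interpret T1: tensor_space V W R by fact
  interpret T2: tensor_space V' W' R' by fact
  have inner: "tensor_lift Z (q a b) \<in> linear_maps T2.T Z" if "a \<in> carrier V" "b \<in> carrier W" for a b
    by (rule T2.linear_maps_tensor_lift[OF Z q2[OF that] r2[OF _ that]])
  have inner_pure: "tensor_lift Z (q a b) (T2.pure c d) = q a b c d"
    if "a \<in> carrier V" "b \<in> carrier W" "c \<in> carrier V'" "d \<in> carrier W'" for a b c d
    by (rule T2.tensor_lift_pure[OF Z q2[OF that(1,2)] r2[OF _ that(1,2)] that(3,4)])
  have bil: "bilinear_map V W Z (\<lambda>a b. tensor_lift Z (q a b) t)" if t: "t \<in> carrier T2.T" for t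
  proof (rule bilinear_mapI)
    fix a assume a: "a \<in> carrier V"
    show "(\<lambda>b. tensor_lift Z (q a b) t) \<in> linear_maps W Z"
    proof (rule T2.linear_maps_parameter[OF T1.W.cspace_axioms Z inner[OF a] _ t])
      fix c d assume cd: "c \<in> carrier V'" "d \<in> carrier W'"
      show "(\<lambda>b. tensor_lift Z (q a b) (T2.pure c d)) \<in> linear_maps W Z"
        by (rule linear_maps_cong[OF bilinear_mapD(1)[OF q1[OF cd] a] T1.W.cspace_axioms
              inner_pure[OF a _ cd]])
    qed
  next
    fix b assume b: "b \<in> carrier W"
    show "(\<lambda>a. tensor_lift Z (q a b) t) \<in> linear_maps V Z"
    proof (rule T2.linear_maps_parameter[OF T1.V.cspace_axioms Z inner[OF _ b] _ t])
      fix c d assume cd: "c \<in> carrier V'" "d \<in> carrier W'"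
      show "(\<lambda>a. tensor_lift Z (q a b) (T2.pure c d)) \<in> linear_maps V Z"
        by (rule linear_maps_cong[OF bilinear_mapD(2)[OF q1[OF cd] b] T1.V.cspace_axioms
              inner_pure[OF _ b cd]])
    qed
  qed
  have compat: "tensor_lift Z (q a b) t = tensor_lift Z (q a' b') t"
    if "((a, b), (a', b')) \<in> R" "t \<in> carrier T2.T" for a b a' b' t
  proof -
    have ab: "a \<in> carrier V" "b \<in> carrier W" "a' \<in> carrier V" "b' \<in> carrier W"
      using T1.relations_closed that(1) by auto
    show ?thesis
      by (rule T2.linear_maps_eqI[OF inner[OF ab(1,2)] inner[OF ab(3,4)] Z _ that(2)])
        (simp add: inner_pure ab r1[OF that(1)])
  qed
  have outer: "(\<lambda>s. tensor_lift4 Z q s t) \<in> linear_maps T1.T Z" if t: "t \<in> carrier T2.T" for t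
    unfolding tensor_lift4_def by (rule T1.linear_maps_tensor_lift[OF Z bil[OF t] compat[OF _ t]])
  have outer_pure: "tensor_lift4 Z q (T1.pure a b) t = tensor_lift Z (q a b) t"
    if "a \<in> carrier V" "b \<in> carrier W" "t \<in> carrier T2.T" for a b t
    unfolding tensor_lift4_def
    by (rule T1.tensor_lift_pure[OF Z bil[OF that(3)] compat[OF _ that(3)] that(1,2)])
  show "bilinear_map T1.T T2.T Z (tensor_lift4 Z q)"
  proof (rule bilinear_mapI)
    fix s assume s: "s \<in> carrier T1.T"
    show "(\<lambda>t. tensor_lift4 Z q s t) \<in> linear_maps T2.T Z"
    proof (rule T1.linear_maps_parameter[OF T2.T.cspace_axioms Z outer _ s])
      fix a b assume ab: "a \<in> carrier V" "b \<in> carrier W"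
      show "(\<lambda>t. tensor_lift4 Z q (T1.pure a b) t) \<in> linear_maps T2.T Z"
        by (rule linear_maps_cong[OF inner[OF ab] T2.T.cspace_axioms outer_pure[OF ab]])
    qed
  qed (rule outer)
  show "tensor_lift4 Z q (T1.pure a b) (T2.pure c d) = q a b c d"
    if "a \<in> carrier V" "b \<in> carrier W" "c \<in> carrier V'" "d \<in> carrier W'" for a b c d
    using that by (simp add: outer_pure inner_pure)
qed

context prealg_pair
begin

sublocale tilde: prealg_space "A \<otimes>\<^sub>T B"
  by unfold_locales (rule prealgebra_tilde)

sublocale hat: prealg_space "A \<otimes>\<^sub>H B"
  by unfold_locales (rule prealgebra_hat)

text \<open>The coordinate i belongs to a single bidegree, so the right actions, defined by a sum
  over components, act on each summand with one fixed shift.\<close>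

lemma
  assumes x: "x \<in> carrier (A \<otimes>\<^sub>T B)"
  shows tilde_mu_l_right:
    "mu_l_right (A \<otimes>\<^sub>T B) x f i = tilde_map A B (mu_l A (shift_mero (- fst i) f)) id i (x i)"
    and tilde_mu_r_right:
    "mu_r_right (A \<otimes>\<^sub>T B) x f i = tilde_map A B id (mu_r B (shift_mero (- snd (snd i)) f)) i (x i)"
proof -
  let ?p = "(fst i, snd (snd i))"
  \<comment> \<open>Projecting to the bidegree of the summand i leaves the coordinate i
    unchanged.\<close>
  have comp: "component (A \<otimes>\<^sub>T B) y ?p i = y i" if "y \<in> carrier (A \<otimes>\<^sub>T B)" for y
    using tilde_decomposition(2)[OF that] by (simp add: tilde_proj_def)
  have "mu_l_right (A \<otimes>\<^sub>T B) x f i = component (A \<otimes>\<^sub>T B) (mu_l_right (A \<otimes>\<^sub>T B) x f) ?p i"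
    by (rule comp[symmetric]) (rule tilde.mu_l_right_closed[OF x])
  then show "mu_l_right (A \<otimes>\<^sub>T B) x f i = tilde_map A B (mu_l A (shift_mero (- fst i) f)) id i (x i)"
    unfolding tilde.component_mu_l_right[OF x] unfolding tilde_tensor_simps(6) comp[OF x] by simp
  have "mu_r_right (A \<otimes>\<^sub>T B) x f i = component (A \<otimes>\<^sub>T B) (mu_r_right (A \<otimes>\<^sub>T B) x f) ?p i"
    by (rule comp[symmetric]) (rule tilde.mu_r_right_closed[OF x])
  then show "mu_r_right (A \<otimes>\<^sub>T B) x f i =
      tilde_map A B id (mu_r B (shift_mero (- snd (snd i)) f)) i (x i)"
    unfolding tilde.component_mu_r_right[OF x] unfolding tilde_tensor_simps(7) comp[OF x] by simp
qed

lemma linear_tilde_inj: "direct_sum_inj S i \<in> linear_maps (S i) (A \<otimes>\<^sub>T B)"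
  unfolding linear_maps_tilde by (rule linear_maps_direct_sum_inj[OF cspace_summand])

lemma tilde_mu_inj:
  "mu_l (A \<otimes>\<^sub>T B) f (direct_sum_inj S i s) = direct_sum_inj S i (tilde_map A B (mu_l A f) id i s)"
  "mu_r (A \<otimes>\<^sub>T B) f (direct_sum_inj S i s) = direct_sum_inj S i (tilde_map A B id (mu_r B f) i s)"
  using linear_maps_zero[OF linear_tilde_map(1) cspace_summand cspace_summand]
    linear_maps_zero[OF linear_tilde_map(2) cspace_summand cspace_summand]
  by (simp_all add: tilde_tensor_simps(6,7) direct_sum_inj_def fun_eq_iff del: split_paired_All)

text \<open>The summands of the target are tensor products of graded parts of
  \<open>\<otimes>\<^sub>H\<close>, so its pure tensors have to be regarded as bilinear into those
  parts and not just into the whole space.\<close>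

lemma linear_hat_pure_homogeneous:
  "a \<in> grade A \<alpha> \<beta> \<Longrightarrow> (\<lambda>b. hat_pure A B a b) \<in>
    linear_maps (homogeneous_part B \<alpha>' \<beta>') (homogeneous_part (A \<otimes>\<^sub>H B) (\<alpha> + \<alpha>') (\<beta> + \<beta>'))"
  "b \<in> grade B \<alpha>' \<beta>' \<Longrightarrow> (\<lambda>a. hat_pure A B a b) \<in>
    linear_maps (homogeneous_part A \<alpha> \<beta>) (homogeneous_part (A \<otimes>\<^sub>H B) (\<alpha> + \<alpha>') (\<beta> + \<beta>'))"
proof -
  assume a: "a \<in> grade A \<alpha> \<beta>"
  show "(\<lambda>b. hat_pure A B a b) \<in>
      linear_maps (homogeneous_part B \<alpha>' \<beta>') (homogeneous_part (A \<otimes>\<^sub>H B) (\<alpha> + \<alpha>') (\<beta> + \<beta>'))"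
    by (intro linear_maps_restrict B.subspaceD(1)[OF B.subspace_grade] hat_pure_grade[OF a])
      (simp_all add: linear_maps_hat bilinear_mapD(1)[OF bilinear_hat_pure] A.grade_closed[OF a])
next
  assume b: "b \<in> grade B \<alpha>' \<beta>'"
  show "(\<lambda>a. hat_pure A B a b) \<in>
      linear_maps (homogeneous_part A \<alpha> \<beta>) (homogeneous_part (A \<otimes>\<^sub>H B) (\<alpha> + \<alpha>') (\<beta> + \<beta>'))"
    by (intro linear_maps_restrict A.subspaceD(1)[OF A.subspace_grade] hat_pure_grade[OF _ b])
      (simp_all add: linear_maps_hat bilinear_mapD(2)[OF bilinear_hat_pure] B.grade_closed[OF b])
qed

lemma hat_pure_shift:
  assumes "a \<in> grade A \<alpha> \<beta>" "b \<in> carrier B"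
  shows "hat_pure A B (mu_l A (shift_mero (- \<alpha>) f) a) b = hat_pure A B a (mu_l B f b)"
    "hat_pure A B (mu_r A (shift_mero (- \<beta>) f) a) b = hat_pure A B a (mu_r B f b)"
  using hat_pure_relation[OF A.grade_closed[OF assms(1)] assms(2)]
  by (simp_all add: A.mu_l_right_homogeneous[OF assms(1)])

end

section \<open>The exchange on a pair of summands\<close>

locale prealg_quadruple = A: prealg_space A + B: prealg_space B + C: prealg_space C + D: prealg_space D
  for A :: "('a, 'h::fd_commutative_lie_algebra) prealg" and B :: "('b, 'h) prealg"
    and C :: "('c, 'h) prealg" and D :: "('d, 'h) prealg"
begin

sublocale AB: prealg_pair A B ..
sublocale CD: prealg_pair C D ..
sublocale AC: prealg_pair A C ..
sublocale BD: prealg_pair B D ..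
text \<open>Each pair provides both tensor products: \<open>X\<close> is used for its
  \<open>\<otimes>\<^sub>H\<close>, the source of \<sigma>, and \<open>Y\<close> for its
  \<open>\<otimes>\<^sub>T\<close>, the target.\<close>

sublocale X: prealg_pair "A \<otimes>\<^sub>T B" "C \<otimes>\<^sub>T D" ..
sublocale Y: prealg_pair "A \<otimes>\<^sub>H C" "B \<otimes>\<^sub>H D" ..

text \<open>The middle indices add as well: \<gamma> + \<gamma>' is the right degree of a \<otimes>
  c and the left degree of b \<otimes> d, so their tensor lies in a summand.\<close>

definition sigma_part where
  "sigma_part = (\<lambda>(\<alpha>, \<gamma>, \<beta>) (\<alpha>', \<gamma>', \<beta>').
    tensor_lift4 (Y.S (\<alpha> + \<alpha>', \<gamma> + \<gamma>', \<beta> + \<beta>'))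
      (\<lambda>a b c d. Y.tpure (\<alpha> + \<alpha>') (\<gamma> + \<gamma>') (\<beta> + \<beta>') (hat_pure A C a c) (hat_pure B D b d)))"

context
  fixes \<alpha> \<gamma> \<beta> \<alpha>' \<gamma>' \<beta>' :: "'h dual"
begin

abbreviation (input) "target \<equiv> Y.S (\<alpha> + \<alpha>', \<gamma> + \<gamma>', \<beta> + \<beta>')"

abbreviation (input) "exchanged \<equiv> \<lambda>a b c d.
  Y.tpure (\<alpha> + \<alpha>') (\<gamma> + \<gamma>') (\<beta> + \<beta>') (hat_pure A C a c) (hat_pure B D b d)"

lemma bilinear_tpure_Y: "bilinear_map (homogeneous_part (A \<otimes>\<^sub>H C) (\<alpha> + \<alpha>') (\<gamma> + \<gamma>'))
    (homogeneous_part (B \<otimes>\<^sub>H D) (\<gamma> + \<gamma>') (\<beta> + \<beta>')) target (Y.tpure (\<alpha> + \<alpha>') (\<gamma> + \<gamma>') (\<beta> + \<beta>'))"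
  unfolding Y.summand_eq by (rule tensor_space.bilinear_pure[OF Y.tensor_space_summand])

lemma q_bilinear_left:
  assumes "c \<in> grade C \<alpha>' \<gamma>'" "d \<in> grade D \<gamma>' \<beta>'"
  shows "bilinear_map (homogeneous_part A \<alpha> \<gamma>) (homogeneous_part B \<gamma> \<beta>) target (\<lambda>a b. exchanged a b c d)"
  by (rule bilinear_map_comp[OF bilinear_tpure_Y AC.linear_hat_pure_homogeneous(2)
        BD.linear_hat_pure_homogeneous(2) linear_maps_id]) (use assms in simp_all)

lemma q_bilinear_right:
  assumes "a \<in> grade A \<alpha> \<gamma>" "b \<in> grade B \<gamma> \<beta>"
  shows "bilinear_map (homogeneous_part C \<alpha>' \<gamma>') (homogeneous_part D \<gamma>' \<beta>') target (exchanged a b)"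
  by (rule bilinear_map_comp[OF bilinear_tpure_Y AC.linear_hat_pure_homogeneous(1)
        BD.linear_hat_pure_homogeneous(1) linear_maps_id]) (use assms in simp_all)

lemma q_mu:
  assumes "a \<in> grade A \<alpha> \<gamma>" "b \<in> grade B \<gamma> \<beta>" "c \<in> grade C \<alpha>' \<gamma>'" "d \<in> grade D \<gamma>' \<beta>'"
  shows "exchanged (mu_r A f a) b c d = exchanged a (mu_l B f b) c d" "exchanged a b (mu_r C f c) d = exchanged a b c (mu_l D f d)"
proof -
  have middle: "exchanged (mu_r A f a) b c d = exchanged a (mu_l B f b) c d" for f
    using Y.tpure_relation[OF AC.hat_pure_grade[OF assms(1,3)] BD.hat_pure_grade[OF assms(2,4)]] assms
    by (simp add: AC.hat_mu_pure BD.hat_mu_pure A.grade_closed B.grade_closed C.grade_closed D.grade_closed)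
  then show "exchanged (mu_r A f a) b c d = exchanged a (mu_l B f b) c d" .
  have "exchanged a b (mu_r C f c) d = exchanged (mu_r A (shift_mero (- \<gamma>) f) a) b c d"
    using AC.hat_pure_shift(2)[OF assms(1) C.grade_closed[OF assms(3)]] by simp
  \<comment> \<open>The index \<gamma> is both the right degree of a and the left degree of b. Hence
    the shift made on entering A is the one undone on leaving B.\<close>
  also have "\<dots> = exchanged a (mu_l B (shift_mero (- \<gamma>) f) b) c d" by (rule middle)
  also have "\<dots> = exchanged a b c (mu_l D f d)"
    using BD.hat_pure_shift(1)[OF assms(2) D.grade_closed[OF assms(4)]] by simp
  finally show "exchanged a b (mu_r C f c) d = exchanged a b c (mu_l D f d)" .
qed

lemma q_relation_left:
  assumes "((a, b), (a', b')) \<in> tilde_relations A B (\<alpha>, \<gamma>, \<beta>)" "c \<in> grade C \<alpha>' \<gamma>'" "d \<in> grade D \<gamma>' \<beta>'"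
  shows "exchanged a b c d = exchanged a' b' c d"
  using assms(1) by (rule AB.tilde_relations_elim) (use q_mu(1) assms(2,3) in simp)

lemma q_relation_right:
  assumes "((c, d), (c', d')) \<in> tilde_relations C D (\<alpha>', \<gamma>', \<beta>')" "a \<in> grade A \<alpha> \<gamma>" "b \<in> grade B \<gamma> \<beta>"
  shows "exchanged a b c d = exchanged a b c' d'"
  using assms(1) by (rule CD.tilde_relations_elim) (use q_mu(2) assms(2,3) in simp)

lemma
  shows bilinear_sigma_part_triple:
    "bilinear_map (AB.S (\<alpha>, \<gamma>, \<beta>)) (CD.S (\<alpha>', \<gamma>', \<beta>')) target (sigma_part (\<alpha>, \<gamma>, \<beta>) (\<alpha>', \<gamma>', \<beta>'))"
    and sigma_part_pure: "\<And>a b c d. \<lbrakk>a \<in> grade A \<alpha> \<gamma>; b \<in> grade B \<gamma> \<beta>; c \<in> grade C \<alpha>' \<gamma>'; d \<in> grade D \<gamma>' \<beta>'\<rbrakk>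
      \<Longrightarrow> sigma_part (\<alpha>, \<gamma>, \<beta>) (\<alpha>', \<gamma>', \<beta>') (AB.tpure \<alpha> \<gamma> \<beta> a b) (CD.tpure \<alpha>' \<gamma>' \<beta>' c d) = exchanged a b c d"
  using bilinear_tensor_lift4[OF AB.tensor_space_summand[of \<alpha> \<gamma> \<beta>]
      CD.tensor_space_summand[of \<alpha>' \<gamma>' \<beta>'] Y.cspace_summand[of "(\<alpha> + \<alpha>', \<gamma> + \<gamma>', \<beta> + \<beta>')"], of exchanged]
    tensor_lift4_pure[OF AB.tensor_space_summand[of \<alpha> \<gamma> \<beta>]
      CD.tensor_space_summand[of \<alpha>' \<gamma>' \<beta>'] Y.cspace_summand[of "(\<alpha> + \<alpha>', \<gamma> + \<gamma>', \<beta> + \<beta>')"], of exchanged]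
    q_bilinear_left q_bilinear_right q_relation_left q_relation_right
  by (simp_all add: sigma_part_def AB.summand_eq CD.summand_eq)

end

text \<open>Addition of triples is componentwise, so the target of the pair of summands is simply
  indexed by i + j.\<close>

lemma bilinear_sigma_part: "bilinear_map (AB.S i) (CD.S j) (Y.S (i + j)) (sigma_part i j)"
  using bilinear_sigma_part_triple by (cases i; cases j) simp

lemma summand_bilinear_eqI:
  assumes "cspace U" "bilinear_map (AB.S (\<alpha>, \<gamma>, \<beta>)) (CD.S (\<alpha>', \<gamma>', \<beta>')) U \<eta>"
    "bilinear_map (AB.S (\<alpha>, \<gamma>, \<beta>)) (CD.S (\<alpha>', \<gamma>', \<beta>')) U \<theta>"
    "\<And>a b c d. \<lbrakk>a \<in> grade A \<alpha> \<gamma>; b \<in> grade B \<gamma> \<beta>; c \<in> grade C \<alpha>' \<gamma>'; d \<in> grade D \<gamma>' \<beta>'\<rbrakk> \<Longrightarrow>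
      \<eta> (AB.tpure \<alpha> \<gamma> \<beta> a b) (CD.tpure \<alpha>' \<gamma>' \<beta>' c d) = \<theta> (AB.tpure \<alpha> \<gamma> \<beta> a b) (CD.tpure \<alpha>' \<gamma>' \<beta>' c d)"
    "s \<in> carrier (AB.S (\<alpha>, \<gamma>, \<beta>))" "t \<in> carrier (CD.S (\<alpha>', \<gamma>', \<beta>'))"
  shows "\<eta> s t = \<theta> s t"
  by (rule tensor_bilinear_eqI[OF AB.tensor_space_summand CD.tensor_space_summand assms(1)
        assms(2,3)[unfolded AB.summand_eq CD.summand_eq]])
    (use assms(4-6) in \<open>simp_all add: AB.summand_eq CD.summand_eq\<close>)

context
  fixes i j s t
  assumes s: "s \<in> carrier (AB.S i)" and t: "t \<in> carrier (CD.S j)"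
begin

text \<open>Both sides are bilinear in s and t. On pure tensors each puts the function on a, since
  the left action of \<open>A \<otimes>\<^sub>H C\<close> is that of its first factor; for
  \<open>sigma_part_mu_r\<close> it is b in the same way.\<close>

lemma sigma_part_mu_l:
  "sigma_part i j (tilde_map A B (mu_l A f) id i s) t =
    tilde_map (A \<otimes>\<^sub>H C) (B \<otimes>\<^sub>H D) (mu_l (A \<otimes>\<^sub>H C) f) id (i + j) (sigma_part i j s t)"
proof -
  obtain \<alpha> \<gamma> \<beta> \<alpha>' \<gamma>' \<beta>' where ij: "i = (\<alpha>, \<gamma>, \<beta>)" "j = (\<alpha>', \<gamma>', \<beta>')" by (metis prod_cases3)
  show ?thesis
    unfolding ij
    by (rule summand_bilinear_eqI[OF Y.cspace_summand
          bilinear_map_comp[OF bilinear_sigma_part AB.linear_tilde_map(1) linear_maps_id linear_maps_id]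
          bilinear_map_comp[OF bilinear_sigma_part linear_maps_id linear_maps_id Y.linear_tilde_map(1)]])
      (use s t ij in \<open>simp_all add: AB.tilde_map_tpure Y.tilde_map_tpure sigma_part_pure A.mu_l_grade
        AC.hat_pure_grade BD.hat_pure_grade AC.hat_mu_pure A.grade_closed C.grade_closed\<close>)
qed

lemma sigma_part_mu_r:
  "sigma_part i j (tilde_map A B id (mu_r B f) i s) t =
    tilde_map (A \<otimes>\<^sub>H C) (B \<otimes>\<^sub>H D) id (mu_r (B \<otimes>\<^sub>H D) f) (i + j) (sigma_part i j s t)"
proof -
  obtain \<alpha> \<gamma> \<beta> \<alpha>' \<gamma>' \<beta>' where ij: "i = (\<alpha>, \<gamma>, \<beta>)" "j = (\<alpha>', \<gamma>', \<beta>')" by (metis prod_cases3)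
  show ?thesis
    unfolding ij
    by (rule summand_bilinear_eqI[OF Y.cspace_summand
          bilinear_map_comp[OF bilinear_sigma_part AB.linear_tilde_map(2) linear_maps_id linear_maps_id]
          bilinear_map_comp[OF bilinear_sigma_part linear_maps_id linear_maps_id Y.linear_tilde_map(2)]])
      (use s t ij in \<open>simp_all add: AB.tilde_map_tpure Y.tilde_map_tpure sigma_part_pure B.mu_r_grade
        AC.hat_pure_grade BD.hat_pure_grade BD.hat_mu_pure B.grade_closed D.grade_closed\<close>)
qed

text \<open>On pure tensors this is the first relation of \<open>A \<otimes>\<^sub>H C\<close>: the
  left degree of a \<otimes> b is that of a, so both relations use the same shift. The right-hand
  version is the second relation of \<open>B \<otimes>\<^sub>H D\<close>, with the right degree of
  b.\<close>

lemma sigma_part_balanced_l: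
  "sigma_part i j (tilde_map A B (mu_l A (shift_mero (- fst i) f)) id i s) t =
    sigma_part i j s (tilde_map C D (mu_l C f) id j t)"
proof -
  obtain \<alpha> \<gamma> \<beta> \<alpha>' \<gamma>' \<beta>' where ij: "i = (\<alpha>, \<gamma>, \<beta>)" "j = (\<alpha>', \<gamma>', \<beta>')" by (metis prod_cases3)
  show ?thesis
    unfolding ij
    by (rule summand_bilinear_eqI[OF Y.cspace_summand
          bilinear_map_comp[OF bilinear_sigma_part AB.linear_tilde_map(1) linear_maps_id linear_maps_id]
          bilinear_map_comp[OF bilinear_sigma_part linear_maps_id CD.linear_tilde_map(1) linear_maps_id]])
      (use s t ij in \<open>simp_all add: AB.tilde_map_tpure CD.tilde_map_tpure sigma_part_pure A.mu_l_grade
        C.mu_l_grade AC.hat_pure_shift C.grade_closed\<close>)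
qed

lemma sigma_part_balanced_r:
  "sigma_part i j (tilde_map A B id (mu_r B (shift_mero (- snd (snd i)) f)) i s) t =
    sigma_part i j s (tilde_map C D id (mu_r D f) j t)"
proof -
  obtain \<alpha> \<gamma> \<beta> \<alpha>' \<gamma>' \<beta>' where ij: "i = (\<alpha>, \<gamma>, \<beta>)" "j = (\<alpha>', \<gamma>', \<beta>')" by (metis prod_cases3)
  show ?thesis
    unfolding ij
    by (rule summand_bilinear_eqI[OF Y.cspace_summand
          bilinear_map_comp[OF bilinear_sigma_part AB.linear_tilde_map(2) linear_maps_id linear_maps_id]
          bilinear_map_comp[OF bilinear_sigma_part linear_maps_id CD.linear_tilde_map(2) linear_maps_id]])
      (use s t ij in \<open>simp_all add: AB.tilde_map_tpure CD.tilde_map_tpure sigma_part_pure B.mu_r_grade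
        D.mu_r_grade BD.hat_pure_shift D.grade_closed\<close>)
qed

end

section \<open>The exchange map on the full tensor product\<close>

abbreviation "ABCD \<equiv> (A \<otimes>\<^sub>T B) \<otimes>\<^sub>H (C \<otimes>\<^sub>T D)"
abbreviation "ACBD \<equiv> (A \<otimes>\<^sub>H C) \<otimes>\<^sub>T (B \<otimes>\<^sub>H D)"

abbreviation "sigma_term \<equiv> \<lambda>i j s t. direct_sum_inj Y.S (i + j) (sigma_part i j s t)"

definition "sigma_bilinear = direct_sum_bilinear ACBD sigma_term"

lemma bilinear_sigma_term: "bilinear_map (AB.S i) (CD.S j) ACBD (sigma_term i j)"
  by (rule bilinear_map_comp[OF bilinear_sigma_part linear_maps_id linear_maps_id Y.linear_tilde_inj])

lemma bilinear_sigma: "bilinear_map (A \<otimes>\<^sub>T B) (C \<otimes>\<^sub>T D) ACBD sigma_bilinear"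
  using bilinear_direct_sum[OF AB.cspace_summand CD.cspace_summand Y.cspace_tilde bilinear_sigma_term]
  by (simp add: sigma_bilinear_def bilinear_map_def AB.linear_maps_tilde CD.linear_maps_tilde
      tilde_tensor_simps(1) del: direct_sum_simps)

text \<open>The right actions on \<open>A \<otimes>\<^sub>T B\<close> act on every summand with its
  own shift, so each relation can be verified separately for every pair of summands.\<close>

lemma sigma_bilinear_compatible:
  assumes "((x, y), (x', y')) \<in> X.R"
  shows "sigma_bilinear x y = sigma_bilinear x' y'"
  using assms
proof (cases rule: X.hat_relations_cases)
  case (l f)
  have "x' i \<in> carrier (AB.S i)" for i
    using l(3) unfolding tilde_tensor_simps(1) by (rule direct_sumD(1))
  moreover have "y j \<in> carrier (CD.S j)" for j
    using l(4) unfolding tilde_tensor_simps(1) by (rule direct_sumD(1))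
  ultimately have "sigma_term i j (x i) (y j) = sigma_term i j (x' i) (y' j)" for i j
    unfolding l(1,2) AB.tilde_mu_l_right[OF l(3)] unfolding tilde_tensor_simps(6)
    by (simp only: sigma_part_balanced_l)
  then show ?thesis by (simp only: sigma_bilinear_def direct_sum_bilinear_def)
next
  case (r f)
  have "x' i \<in> carrier (AB.S i)" for i
    using r(3) unfolding tilde_tensor_simps(1) by (rule direct_sumD(1))
  moreover have "y j \<in> carrier (CD.S j)" for j
    using r(4) unfolding tilde_tensor_simps(1) by (rule direct_sumD(1))
  ultimately have "sigma_term i j (x i) (y j) = sigma_term i j (x' i) (y' j)" for i j
    unfolding r(1,2) AB.tilde_mu_r_right[OF r(3)] unfolding tilde_tensor_simps(7)
    by (simp only: sigma_part_balanced_r)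
  then show ?thesis by (simp only: sigma_bilinear_def direct_sum_bilinear_def)
qed

definition "sigma23 = tensor_lift ACBD sigma_bilinear"

lemma linear_sigma23: "sigma23 \<in> linear_maps X.Q ACBD"
  unfolding sigma23_def
  by (rule X.H.linear_maps_tensor_lift[OF Y.cspace_tilde bilinear_sigma sigma_bilinear_compatible])

lemma sigma_hat_pure:
  assumes "x \<in> carrier (A \<otimes>\<^sub>T B)" "y \<in> carrier (C \<otimes>\<^sub>T D)"
  shows "sigma23 (hat_pure (A \<otimes>\<^sub>T B) (C \<otimes>\<^sub>T D) x y) = sigma_bilinear x y"
  unfolding sigma23_def hat_pure_def
  by (rule X.H.tensor_lift_pure[OF Y.cspace_tilde bilinear_sigma sigma_bilinear_compatible assms])

lemma sigma_pure:
  assumes "a \<in> grade A \<alpha> \<gamma>" "b \<in> grade B \<gamma> \<beta>" "c \<in> grade C \<alpha>' \<gamma>'" "d \<in> grade D \<gamma>' \<beta>'"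
  shows "sigma23 (hat_pure (A \<otimes>\<^sub>T B) (C \<otimes>\<^sub>T D) (tilde_pure A B \<alpha> \<gamma> \<beta> a b) (tilde_pure C D \<alpha>' \<gamma>' \<beta>' c d)) =
    tilde_pure (A \<otimes>\<^sub>H C) (B \<otimes>\<^sub>H D) (\<alpha> + \<alpha>') (\<gamma> + \<gamma>') (\<beta> + \<beta>') (hat_pure A C a c) (hat_pure B D b d)"
proof -
  note ab = AB.tpure_closed[OF assms(1,2)] and cd = CD.tpure_closed[OF assms(3,4)]
  have "sigma23 (hat_pure (A \<otimes>\<^sub>T B) (C \<otimes>\<^sub>T D) (tilde_pure A B \<alpha> \<gamma> \<beta> a b) (tilde_pure C D \<alpha>' \<gamma>' \<beta>' c d)) =
      sigma_bilinear (tilde_pure A B \<alpha> \<gamma> \<beta> a b) (tilde_pure C D \<alpha>' \<gamma>' \<beta>' c d)"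
    unfolding AB.tilde_pure_eq CD.tilde_pure_eq
    by (rule sigma_hat_pure[OF linear_mapsD(1)[OF AB.linear_tilde_inj ab]
          linear_mapsD(1)[OF CD.linear_tilde_inj cd]])
  also have "\<dots> = sigma_term (\<alpha>, \<gamma>, \<beta>) (\<alpha>', \<gamma>', \<beta>') (AB.tpure \<alpha> \<gamma> \<beta> a b) (CD.tpure \<alpha>' \<gamma>' \<beta>' c d)"
    unfolding AB.tilde_pure_eq CD.tilde_pure_eq sigma_bilinear_def
    by (rule direct_sum_bilinear_inj[where B = sigma_term, OF AB.cspace_summand CD.cspace_summand Y.cspace_tilde
          bilinear_sigma_term ab cd])
  also have "\<dots> = tilde_pure (A \<otimes>\<^sub>H C) (B \<otimes>\<^sub>H D) (\<alpha> + \<alpha>') (\<gamma> + \<gamma>') (\<beta> + \<beta>')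
      (hat_pure A C a c) (hat_pure B D b d)"
    unfolding Y.tilde_pure_eq by (simp add: sigma_part_pure[OF assms])
  finally show ?thesis .
qed

text \<open>A pair of summands either has the outer degrees of x and y, and then its term has the
  sum of these degrees, or one of the two coordinates is zero and the term vanishes. The middle
  degrees are unrestricted.\<close>

lemma sigma_bilinear_grade:
  assumes x: "x \<in> grade (A \<otimes>\<^sub>T B) \<alpha>1 \<beta>1" and y: "y \<in> grade (C \<otimes>\<^sub>T D) \<alpha>2 \<beta>2"
  shows "sigma_bilinear x y \<in> grade ACBD (\<alpha>1 + \<alpha>2) (\<beta>1 + \<beta>2)"
  unfolding sigma_bilinear_def direct_sum_bilinear_def
proof (intro Y.tilde.fsum_in_subspace Y.tilde.subspace_grade)
  fix i j
  have xi: "x i \<in> carrier (AB.S i)" and yj: "y j \<in> carrier (CD.S j)"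
    using x y unfolding AB.tilde_grade_iff CD.tilde_grade_iff by (blast intro: direct_sumD(1))+
  show "sigma_term i j (x i) (y j) \<in> grade ACBD (\<alpha>1 + \<alpha>2) (\<beta>1 + \<beta>2)"
  proof (cases "(fst i, snd (snd i)) = (\<alpha>1, \<beta>1) \<and> (fst j, snd (snd j)) = (\<alpha>2, \<beta>2)")
    case True
    then show ?thesis
      using Y.tilde_inj_grade[OF bilinear_mapD(3)[OF bilinear_sigma_part xi yj]] by simp
  next
    case False
    then have "x i = \<zero>\<^bsub>AB.S i\<^esub> \<or> y j = \<zero>\<^bsub>CD.S j\<^esub>"
      using x y unfolding AB.tilde_grade_iff CD.tilde_grade_iff by blast
    moreover have "sigma_term i j \<zero>\<^bsub>AB.S i\<^esub> (y j) = \<zero>\<^bsub>ACBD\<^esub>"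
      by (rule linear_maps_zero[OF bilinear_mapD(2)[OF bilinear_sigma_term yj] AB.cspace_summand Y.cspace_tilde])
    moreover have "sigma_term i j (x i) \<zero>\<^bsub>CD.S j\<^esub> = \<zero>\<^bsub>ACBD\<^esub>"
      by (rule linear_maps_zero[OF bilinear_mapD(1)[OF bilinear_sigma_term xi] CD.cspace_summand Y.cspace_tilde])
    ultimately have "sigma_term i j (x i) (y j) = \<zero>\<^bsub>ACBD\<^esub>" by metis
    then show ?thesis by (simp only: Y.tilde.zero_grade)
  qed
qed

lemma sigma_grade:
  assumes "t \<in> grade ABCD \<alpha> \<beta>"
  shows "sigma23 t \<in> grade ACBD \<alpha> \<beta>"
proof -
  have "t \<in> {t \<in> carrier X.Q. sigma23 t \<in> grade ACBD \<alpha> \<beta>}"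
    by (rule X.hat_grade_induct[OF subspace_vimage[OF linear_sigma23 X.H.T.cspace_axioms
            Y.cspace_tilde Y.subspace_tilde_grade] _ assms])
      (auto simp: sigma_hat_pure X.hat_pure_closed AB.tilde.grade_closed CD.tilde.grade_closed
        intro: sigma_bilinear_grade)
  then show ?thesis by simp
qed

text \<open>The action on the target is linear and so enters the double sum. There it acts on the
  summand i + j, where the statement for a pair of summands applies.\<close>

lemma sigma_bilinear_mu:
  assumes "x \<in> carrier (A \<otimes>\<^sub>T B)" "y \<in> carrier (C \<otimes>\<^sub>T D)"
  shows "sigma_bilinear (mu_l (A \<otimes>\<^sub>T B) f x) y = mu_l ACBD f (sigma_bilinear x y)"
    "sigma_bilinear (mu_r (A \<otimes>\<^sub>T B) f x) y = mu_r ACBD f (sigma_bilinear x y)"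
proof -
  have xy: "x \<in> carrier (direct_sum AB.S)" "y \<in> carrier (direct_sum CD.S)"
    using assms unfolding tilde_tensor_simps(1) by simp_all
  then have xi: "x i \<in> carrier (AB.S i)" and yj: "y j \<in> carrier (CD.S j)" for i j
    by (blast intro: direct_sumD(1))+
  note eq = linear_maps_direct_sum_bilinear[where B = sigma_term, OF AB.cspace_summand CD.cspace_summand
      Y.cspace_tilde bilinear_sigma_term _ Y.cspace_tilde xy]
  have "mu_l ACBD f (sigma_bilinear x y) =
      direct_sum_bilinear ACBD (\<lambda>i j s t. mu_l ACBD f (sigma_term i j s t)) x y"
    unfolding sigma_bilinear_def by (rule eq[OF Y.tilde.linear_mu_l])
  then show "sigma_bilinear (mu_l (A \<otimes>\<^sub>T B) f x) y = mu_l ACBD f (sigma_bilinear x y)"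
    by (simp only: sigma_bilinear_def direct_sum_bilinear_def Y.tilde_mu_inj
        tilde_tensor_simps(6)[of A B] sigma_part_mu_l[OF xi yj])
  have "mu_r ACBD f (sigma_bilinear x y) =
      direct_sum_bilinear ACBD (\<lambda>i j s t. mu_r ACBD f (sigma_term i j s t)) x y"
    unfolding sigma_bilinear_def by (rule eq[OF Y.tilde.linear_mu_r])
  then show "sigma_bilinear (mu_r (A \<otimes>\<^sub>T B) f x) y = mu_r ACBD f (sigma_bilinear x y)"
    by (simp only: sigma_bilinear_def direct_sum_bilinear_def Y.tilde_mu_inj
        tilde_tensor_simps(7)[of A B] sigma_part_mu_r[OF xi yj])
qed

lemma sigma_mu:
  assumes "t \<in> carrier ABCD"
  shows "sigma23 (mu_l ABCD f t) = mu_l ACBD f (sigma23 t)"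
    "sigma23 (mu_r ABCD f t) = mu_r ACBD f (sigma23 t)"
proof -
  have t: "t \<in> carrier X.Q" using assms by (simp add: hat_tensor_simps)
  show "sigma23 (mu_l ABCD f t) = mu_l ACBD f (sigma23 t)"
    by (rule X.hat_linear_eqI[OF linear_maps_comp[OF X.linear_hat_mu(1) linear_sigma23]
          linear_maps_comp[OF linear_sigma23 Y.tilde.linear_mu_l] Y.cspace_tilde _ t])
      (simp add: X.hat_mu_pure sigma_hat_pure sigma_bilinear_mu)
  show "sigma23 (mu_r ABCD f t) = mu_r ACBD f (sigma23 t)"
    by (rule X.hat_linear_eqI[OF linear_maps_comp[OF X.linear_hat_mu(2) linear_sigma23]
          linear_maps_comp[OF linear_sigma23 Y.tilde.linear_mu_r] Y.cspace_tilde _ t])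
      (simp add: X.hat_mu_pure sigma_hat_pure sigma_bilinear_mu)
qed

lemma prealgebra_hom_sigma23: "prealgebra_hom ABCD ACBD sigma23"
  using X.prealgebra_hat Y.prealgebra_tilde linear_sigma23 sigma_grade sigma_mu
  unfolding prealgebra_hom_def X.linear_maps_hat by blast

end

text \<open>The second conjunct expresses that the formula for \<sigma> factors: a \<otimes> b and c
  \<otimes> d lie in \<open>\<otimes>\<^sub>T\<close> when the middle degrees match. Such elements
  span the source, so the values given determine \<sigma> on its carrier.\<close>

theorem lemma5p2:
  fixes A :: "('a, 'h::fd_commutative_lie_algebra) prealg"
    and B :: "('b, 'h) prealg"
    and C :: "('c, 'h) prealg"
    and D :: "('d, 'h) prealg"
  assumes "prealgebra A" and "prealgebra B" and "prealgebra C" and "prealgebra D"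
  shows "\<exists>\<sigma>.
    prealgebra_hom ((A \<otimes>\<^sub>T B) \<otimes>\<^sub>H (C \<otimes>\<^sub>T D)) ((A \<otimes>\<^sub>H C) \<otimes>\<^sub>T (B \<otimes>\<^sub>H D)) \<sigma> \<and>
    (\<forall>\<alpha> \<gamma> \<beta> \<alpha>' \<gamma>' \<beta>'. \<forall>a\<in>grade A \<alpha> \<gamma>. \<forall>b\<in>grade B \<gamma> \<beta>. \<forall>c\<in>grade C \<alpha>' \<gamma>'. \<forall>d\<in>grade D \<gamma>' \<beta>'.
      \<sigma> (hat_pure (A \<otimes>\<^sub>T B) (C \<otimes>\<^sub>T D) (tilde_pure A B \<alpha> \<gamma> \<beta> a b) (tilde_pure C D \<alpha>' \<gamma>' \<beta>' c d)) =
      tilde_pure (A \<otimes>\<^sub>H C) (B \<otimes>\<^sub>H D) (\<alpha> + \<alpha>') (\<gamma> + \<gamma>') (\<beta> + \<beta>') (hat_pure A C a c) (hat_pure B D b d))"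
proof -
  interpret prealg_quadruple A B C D
    by unfold_locales (fact assms)+
  show ?thesis using prealgebra_hom_sigma23 sigma_pure by blast
qed

end
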